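(* Let $A\to X$ be an abstract Lie algebroid (with anchor $\rho:A\to TX$) in a cartesian Rosický tangent category with scalar $R$-multiplication. Let $\mathcal{O}:=\mathrm{Hom}(X,R)$ and $\mathcal{A}:=\Gamma(X,A)$. Then the $\mathcal{O}$-module $\mathcal{A}$ with the action $a\cdot f:=(\rho\circ a)\cdot f$ on $\mathcal{O}$ is a Lie–Rinehart algebra over $\mathcal{O}$.
   Context: **Rosický tangent structure.** A Rosický tangent structure on a category $\mathcal{C}$ consists of a functor $T:\mathcal{C}\to\mathcal{C}$ and natural transformations $\pi:T\to 1$, $0:1\to T$, $+:T_2\to T$, $\lambda:T\to T^2$, $\tau:T^2\to T^2$ such that for all objects $X$: (i) for all $k\ge1$ the fiber product $T_kX=TX\times_X\cdots\times_XTX$ of $k$ copies of $\pi_X:TX\to X$ exists and is preserved by $T$, i.e. the natural morphism $\nu_{k,X}:T(T_kX)\to T^2X\times_{TX}^{T\pi_X,T\pi_X}\cdots\times_{TX}^{T\pi_X,T\pi_X}T^2X$ is an isomorphism; (ii) $\pi_X:TX\to X$ with addition $+_X$ and zero $0_X$ is an abelian group object in the slice category $\mathcal{C}_{/X}$; let $-_X:T_2X\to TX$ denote the fiberwise difference; (iii) $\tau_X\circ\tau_X=\mathrm{id}$, $\tau_{TX}\circ T\tau_X\circ\tau_{TX}=T\tau_X\circ\tau_{TX}\circ T\tau_X$, $\pi_{TX}\circ\tau_X=T\pi_X$, and $+_{TX}\circ(\tau_X\times_{TX}\tau_X)=\tau_X\circ T(+_X)\circ\nu_{2,X}^{-1}$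 on $T^2X\times_{TX}^{T\pi_X,T\pi_X}T^2X$; (iv) $\pi_{TX}\circ\lambda_X=0_X\circ\pi_X$, $\lambda_{TX}\circ\lambda_X=T\lambda_X\circ\lambda_X$, and $+_{TX}\circ(\lambda_X\times_{0_X}\lambda_X)=\lambda_X\circ+_X$; (v) $\tau_X\circ\lambda_X=\lambda_X$ and $T\tau_X\circ\tau_{TX}\circ T\lambda_X=\lambda_{TX}\circ\tau_X$; (vi) the commutative square $(\pi_{TX},T\pi_X)\circ\lambda_X=(0_X,0_X)\circ\pi_X:TX\to T_2X$ is a pullback square. The extended vertical lift is $(\lambda_2)_X:=\tau_X\circ+_{TX}\circ(T0_X\times_{0_X}\lambda_X):T_2X\to T^2X$. It is known that the square with $(\lambda_2)_X$, $T\pi_X:T^2X\to TX$, $\pi_X\circ\mathrm{pr}_1:T_2X\to X$ and $0_X:X\to TX$ is a pullback. **Cartesian.** The tangent structure is cartesian if $\mathcal{C}$ has finite products and $\chi_{X,Y}:=(T\mathrm{pr}_1,T\mathrm{pr}_2):T(X\times Y)\to TX\times TY$ is invertible for all $X,Y$. For $f:X\times Y\to Z$ the partial tangent morphisms are $T_{(1)}f:=Tf\circ\chi_{X,Y}^{-1}\circ(\mathrm{id}_{TX}\times0_Y):TX\times Y\to TZ$ and $T_{(2)}f:=Tf\circ\chi_{X,Y}^{-1}\circ(0_X\times\mathrm{id}_{TY}):X\times TY\to TZ$. **Vector fields.** A vector field on $X$ is a section $v:X\to TX$ of $\pi_X$; $\Gamma(X,TX)$ denotes the set of them, with sum $v+w:=+_X\circ(v,w)$.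 The bracket $[v,w]$ is the unique vector field with $\delta(v,w)=(\lambda_2)_X\circ(w,[v,w])$, where $\delta(v,w):=-_{TX}\circ(Tw\circ v,\ \tau_X\circ Tv\circ w):X\to T^2X$. It is known that this is a Lie bracket. **Scalar multiplication.** Let $R$ be a commutative unital ring object in $\mathcal{C}$ with addition $\hat{+}$, zero $\hat{0}$, multiplication $\hat{m}$, unit $\hat{1}$. An $R$-module structure on the tangent bundle is a natural morphism $\kappa_X:R\times TX\to TX$ with $\pi_X\circ\kappa_X=\pi_X\circ\mathrm{pr}_2$, $\kappa_X\circ(\mathrm{id}_R\times\kappa_X)=\kappa_X\circ(\hat{m}\times\mathrm{id}_{TX})$, $\kappa_X\circ(\hat{1}\times\mathrm{id}_{TX})$ equal to the canonical isomorphism $*\times TX\cong TX$, $\kappa_X\circ(\hat{+}\times\mathrm{id}_{TX})=+_X\circ(\kappa_X\circ(\mathrm{pr}_1,\mathrm{pr}_3),\kappa_X\circ(\mathrm{pr}_2,\mathrm{pr}_3))$, and $\kappa_X\circ(\mathrm{id}_R\times+_X)=+_X\circ(\kappa_X\circ(\mathrm{pr}_1,\mathrm{pr}_2),\kappa_X\circ(\mathrm{pr}_1,\mathrm{pr}_3))$ on $R\times T_2X$. The tangent fiber $T_{\hat{0}}R:=*\times_R^{\hat{0},\pi_R}TR$ (if it exists) inherits an $R$-module structure from $+_R,0_R,\kappa_R$. $R$ is tangent-stable if $T_{\hat{0}}R$ exists and there is an isomorphism of $R$-modules $T_{\hat{0}}R\cong R$, which is then fixed. In that case $\eta_R:TR\to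 R$ is the projection onto the fiber: the morphism $T_{(2)}\hat{+}\circ(\hat{\iota}\circ\pi_R,\mathrm{id}_{TR}):TR\to TR$ (with $\hat{\iota}$ the additive inverse of $R$) factors uniquely through $T_{\hat{0}}R\to TR$, and $\eta_R$ is the resulting $TR\to T_{\hat{0}}R$ followed by $T_{\hat{0}}R\cong R$. The $R$-module structure $\kappa$ is a scalar $R$-multiplication if $R$ is tangent-stable and for all $X$: (S1) $\lambda_X\circ\kappa_X=\kappa_{TX}\circ(\mathrm{id}_R\times\lambda_X)$; (S2) $T_{(1)}\kappa_X=(\lambda_2)_X\circ(\kappa_X\circ(\mathrm{pr}_1,\mathrm{pr}_3),\kappa_X\circ(\mathrm{pr}_2,\mathrm{pr}_3))\circ((\pi_R,\eta_R)\times\mathrm{id}_{TX})$ on $TR\times TX$; (S3) $T_{(2)}\kappa_X=\tau_X\circ\kappa_{TX}\circ(\mathrm{id}_R\times\tau_X)$ on $R\times T^2X$. **Functions.** $\mathrm{Hom}(X,R)$ is a commutative ring with $f+g:=\hat{+}\circ(f,g)$ and $fg:=\hat{m}\circ(f,g)$. Vector fields act on functions by $v\cdot f:=\eta_R\circ Tf\circ v$. **Abstract Lie algebroid.** A bundle of $R$-modules over $X$ is an abelian group object $p:A\to X$ in $\mathcal{C}_{/X}$ with a morphism $\kappa_A:R\times A\to A$ over $X$ satisfying the usual axioms of a linear $R$-action (for $A=TX$ it is $\kappa_X$). Its set of sections $\Gamma(X,A)$ is an abelian group and a module over $\mathrm{Hom}(X,R)$ via $fa:=\kappa_A\circ(f,a)$.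 An abstract Lie algebroid consists of a bundle of $R$-modules $A\to X$, a morphism $\rho:A\to TX$ of bundles of $R$-modules over $X$ (the anchor), and a Lie bracket on the abelian group $\Gamma(X,A)$ such that $[a,fb]=f[a,b]+((\rho\circ a)\cdot f)\,b$ and $\rho\circ[a,b]=[\rho\circ a,\rho\circ b]$ for all $a,b\in\Gamma(X,A)$ and $f:X\to R$. **Lie–Rinehart algebra.** A Lie–Rinehart algebra over a commutative ring $\mathcal{O}$ is an $\mathcal{O}$-module $\mathcal{X}$ equipped with a Lie bracket and an action of the Lie algebra $\mathcal{X}$ on $\mathcal{O}$ by derivations (i.e. a Lie algebra homomorphism from $\mathcal{X}$ to the derivations of the ring $\mathcal{O}$), satisfying $[v,fw]=(v\cdot f)\,w+f[v,w]$ for all $v,w\in\mathcal{X}$, $f\in\mathcal{O}$. *)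

theory Defs
  imports "HOL-Algebra.Module"
begin

section \<open>Categories, fiber products\<close>

record ('o, 'm) category =
  Ob :: "'o set"
  Ar :: "'m set"
  Dom :: "'m \<Rightarrow> 'o"
  Cod :: "'m \<Rightarrow> 'o"
  ide :: "'o \<Rightarrow> 'm"
  Comp :: "'m \<Rightarrow> 'm \<Rightarrow> 'm" (infixr \<open>\<cdot>\<index>\<close> 70)

definition Hom :: "('o, 'm, 'x) category_scheme \<Rightarrow> 'o \<Rightarrow> 'o \<Rightarrow> 'm set" where
  "Hom C X Y = {f \<in> Ar C. Dom C f = X \<and> Cod C f = Y}"

locale category =
  fixes C :: "('o, 'm, 'x) category_scheme" (structure)
  assumes Dom_closed: "f \<in> Ar C \<Longrightarrow> Dom C f \<in> Ob C"
    and Cod_closed: "f \<in> Ar C \<Longrightarrow> Cod C f \<in> Ob C"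
    and ide_closed: "X \<in> Ob C \<Longrightarrow> ide C X \<in> Hom C X X"
    and Comp_closed: "f \<in> Hom C X Y \<Longrightarrow> g \<in> Hom C Y Z \<Longrightarrow> g \<cdot> f \<in> Hom C X Z"
    and Comp_ide: "f \<in> Hom C X Y \<Longrightarrow> f \<cdot> ide C X = f"
    and ide_Comp: "f \<in> Hom C X Y \<Longrightarrow> ide C Y \<cdot> f = f"
    and Comp_assoc: "f \<in> Hom C W X \<Longrightarrow> g \<in> Hom C X Y \<Longrightarrow> h \<in> Hom C Y Z \<Longrightarrow>
      (h \<cdot> g) \<cdot> f = h \<cdot> (g \<cdot> f)"

definition inverse_arrows :: "('o, 'm, 'x) category_scheme \<Rightarrow> 'm \<Rightarrow> 'm \<Rightarrow> bool" where
  "inverse_arrows C f g \<longleftrightarrow> f \<in> Ar C \<and> g \<in> Hom C (Cod C f) (Dom C f) \<and>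
     g \<cdot>\<^bsub>C\<^esub> f = ide C (Dom C f) \<and> f \<cdot>\<^bsub>C\<^esub> g = ide C (Cod C f)"

definition is_iso :: "('o, 'm, 'x) category_scheme \<Rightarrow> 'm \<Rightarrow> bool" where
  "is_iso C f \<longleftrightarrow> (\<exists>g. inverse_arrows C f g)"

definition inv_ar :: "('o, 'm, 'x) category_scheme \<Rightarrow> 'm \<Rightarrow> 'm" where
  "inv_ar C f = (THE g. inverse_arrows C f g)"

definition is_pullback ::
    "('o, 'm, 'x) category_scheme \<Rightarrow> 'm \<Rightarrow> 'm \<Rightarrow> 'o \<Rightarrow> 'm \<Rightarrow> 'm \<Rightarrow> bool" where
  "is_pullback C f g P p q \<longleftrightarrow>
     f \<in> Ar C \<and> g \<in> Ar C \<and> Cod C f = Cod C g \<and>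
     p \<in> Hom C P (Dom C f) \<and> q \<in> Hom C P (Dom C g) \<and> f \<cdot>\<^bsub>C\<^esub> p = g \<cdot>\<^bsub>C\<^esub> q \<and>
     (\<forall>Z u v. u \<in> Hom C Z (Dom C f) \<longrightarrow> v \<in> Hom C Z (Dom C g) \<longrightarrow> f \<cdot>\<^bsub>C\<^esub> u = g \<cdot>\<^bsub>C\<^esub> v \<longrightarrow>
        (\<exists>!h. h \<in> Hom C Z P \<and> p \<cdot>\<^bsub>C\<^esub> h = u \<and> q \<cdot>\<^bsub>C\<^esub> h = v))"

text \<open>\<^term>\<open>is_fiber_power C k f P p\<close>: the object \<^term>\<open>P\<close> with the projections
  \<^term>\<open>p i\<close>, \<^term>\<open>i < k\<close>, is the fiber product of \<^term>\<open>k\<close> copies of \<^term>\<open>f\<close> (for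
  \<^term>\<open>k \<ge> (1 :: nat)\<close>). Projections are numbered from 0.\<close>

definition is_fiber_power ::
    "('o, 'm, 'x) category_scheme \<Rightarrow> nat \<Rightarrow> 'm \<Rightarrow> 'o \<Rightarrow> (nat \<Rightarrow> 'm) \<Rightarrow> bool" where
  "is_fiber_power C k f P p \<longleftrightarrow>
     f \<in> Ar C \<and>
     (\<forall>i<k. p i \<in> Hom C P (Dom C f)) \<and>
     (\<forall>i<k. \<forall>j<k. f \<cdot>\<^bsub>C\<^esub> p i = f \<cdot>\<^bsub>C\<^esub> p j) \<and>
     (\<forall>Z u. (\<forall>i<k. u i \<in> Hom C Z (Dom C f)) \<longrightarrow> (\<forall>i<k. \<forall>j<k. f \<cdot>\<^bsub>C\<^esub> u i = f \<cdot>\<^bsub>C\<^esub> u j) \<longrightarrow>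
        (\<exists>!h. h \<in> Hom C Z P \<and> (\<forall>i<k. p i \<cdot>\<^bsub>C\<^esub> h = u i)))"

definition ftuple ::
    "('o, 'm, 'x) category_scheme \<Rightarrow> nat \<Rightarrow> 'o \<Rightarrow> (nat \<Rightarrow> 'm) \<Rightarrow> (nat \<Rightarrow> 'm) \<Rightarrow> 'm" where
  "ftuple C k P p u = (THE h. h \<in> Hom C (Dom C (u 0)) P \<and> (\<forall>i<k. p i \<cdot>\<^bsub>C\<^esub> h = u i))"

definition fpair ::
    "('o, 'm, 'x) category_scheme \<Rightarrow> 'o \<Rightarrow> (nat \<Rightarrow> 'm) \<Rightarrow> 'm \<Rightarrow> 'm \<Rightarrow> 'm" where
  "fpair C P p f g = ftuple C 2 P p (\<lambda>i. if i = 0 then f else g)"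

section \<open>Abelian group objects in slice categories\<close>

text \<open>An object \<^term>\<open>bproj B\<close> : \<^term>\<open>tot B\<close> \<open>\<rightarrow>\<close> \<^term>\<open>base B\<close> of the slice category over
  \<^term>\<open>base B\<close>, with a chosen fiber product \<^term>\<open>tot2 B\<close> of two copies of it (which is its
  square in the slice category), an addition and a zero.\<close>

record ('o, 'm) ab_bundle =
  tot :: 'o
  base :: 'o
  bproj :: 'm
  tot2 :: 'o
  bpr :: "nat \<Rightarrow> 'm"
  badd :: 'm
  bzero :: 'm

definition bpair ::
    "('o, 'm, 'x) category_scheme \<Rightarrow> ('o, 'm, 'y) ab_bundle_scheme \<Rightarrow> 'm \<Rightarrow> 'm \<Rightarrow> 'm" where
  "bpair C B f g = fpair C (tot2 B) (bpr B) f g"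

definition bsum ::
    "('o, 'm, 'x) category_scheme \<Rightarrow> ('o, 'm, 'y) ab_bundle_scheme \<Rightarrow> 'm \<Rightarrow> 'm \<Rightarrow> 'm" where
  "bsum C B f g = badd B \<cdot>\<^bsub>C\<^esub> bpair C B f g"

definition is_bneg ::
    "('o, 'm, 'x) category_scheme \<Rightarrow> ('o, 'm, 'y) ab_bundle_scheme \<Rightarrow> 'm \<Rightarrow> bool" where
  "is_bneg C B n \<longleftrightarrow> n \<in> Hom C (tot B) (tot B) \<and> bproj B \<cdot>\<^bsub>C\<^esub> n = bproj B \<and>
     bsum C B (ide C (tot B)) n = bzero B \<cdot>\<^bsub>C\<^esub> bproj B"

locale ab_group_bundle =
  fixes C :: "('o, 'm, 'x) category_scheme" (structure)
    and B :: "('o, 'm, 'y) ab_bundle_scheme"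
  assumes bproj_closed: "bproj B \<in> Hom C (tot B) (base B)"
    and tot2_fiber_power: "is_fiber_power C 2 (bproj B) (tot2 B) (bpr B)"
    and badd_closed: "badd B \<in> Hom C (tot2 B) (tot B)"
    and badd_over: "bproj B \<cdot> badd B = bproj B \<cdot> bpr B 0"
    and bzero_closed: "bzero B \<in> Hom C (base B) (tot B)"
    and bzero_over: "bproj B \<cdot> bzero B = ide C (base B)"
    and badd_assoc: "\<exists>P p. is_fiber_power C 3 (bproj B) P p \<and>
      bsum C B (bsum C B (p 0) (p 1)) (p 2) = bsum C B (p 0) (bsum C B (p 1) (p 2))"
    and badd_comm: "bsum C B (bpr B 1) (bpr B 0) = badd B"
    and badd_bzero: "bsum C B (ide C (tot B)) (bzero B \<cdot> bproj B) = ide C (tot B)"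
    and badd_neg: "\<exists>n. is_bneg C B n"

definition bneg :: "('o, 'm, 'x) category_scheme \<Rightarrow> ('o, 'm, 'y) ab_bundle_scheme \<Rightarrow> 'm" where
  "bneg C B = (THE n. is_bneg C B n)"

definition bminus :: "('o, 'm, 'x) category_scheme \<Rightarrow> ('o, 'm, 'y) ab_bundle_scheme \<Rightarrow> 'm" where
  "bminus C B = bsum C B (bpr B 0) (bneg C B \<cdot>\<^bsub>C\<^esub> bpr B 1)"

definition sections :: "('o, 'm, 'x) category_scheme \<Rightarrow> ('o, 'm, 'y) ab_bundle_scheme \<Rightarrow> 'm set" where
  "sections C B = {a \<in> Hom C (base B) (tot B). bproj B \<cdot>\<^bsub>C\<^esub> a = ide C (base B)}"

section \<open>Rosicky tangent structures\<close>

text \<open>\<^term>\<open>TO\<close> and \<^term>\<open>TA\<close> are the tangent functor on objects and arrows; \<^term>\<open>Tk C k X\<close> with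
  the projections \<^term>\<open>Tpr C k X i\<close>, \<^term>\<open>i < k\<close>, is a choice of the fiber product of \<^term>\<open>k\<close>
  copies of \<^term>\<open>Tproj C X\<close>.\<close>

record ('o, 'm) tangent_category = "('o, 'm) category" +
  TO :: "'o \<Rightarrow> 'o"
  TA :: "'m \<Rightarrow> 'm"
  Tk :: "nat \<Rightarrow> 'o \<Rightarrow> 'o"
  Tpr :: "nat \<Rightarrow> 'o \<Rightarrow> nat \<Rightarrow> 'm"
  Tproj :: "'o \<Rightarrow> 'm"
  Tzero :: "'o \<Rightarrow> 'm"
  Tplus :: "'o \<Rightarrow> 'm"
  Tlift :: "'o \<Rightarrow> 'm"
  Tflip :: "'o \<Rightarrow> 'm"

definition tangent_bundle ::
    "('o, 'm, 'x) tangent_category_scheme \<Rightarrow> 'o \<Rightarrow> ('o, 'm) ab_bundle" where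
  "tangent_bundle C X = \<lparr>tot = TO C X, base = X, bproj = Tproj C X, tot2 = Tk C 2 X,
     bpr = Tpr C 2 X, badd = Tplus C X, bzero = Tzero C X\<rparr>"

abbreviation Tpair :: "('o, 'm, 'x) tangent_category_scheme \<Rightarrow> 'o \<Rightarrow> 'm \<Rightarrow> 'm \<Rightarrow> 'm" where
  "Tpair C X f g \<equiv> bpair C (tangent_bundle C X) f g"

abbreviation Tsum :: "('o, 'm, 'x) tangent_category_scheme \<Rightarrow> 'o \<Rightarrow> 'm \<Rightarrow> 'm \<Rightarrow> 'm" where
  "Tsum C X f g \<equiv> bsum C (tangent_bundle C X) f g"

text \<open>The comparison morphism \<open>\<nu>\<close> from \<open>T (T\<^sub>k X)\<close> to a fiber product \<^term>\<open>P\<close> of \<^term>\<open>k\<close> copies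
  of \<open>T \<pi>\<^sub>X\<close> with projections \<^term>\<open>p\<close>.\<close>

definition Tcomparison ::
    "('o, 'm, 'x) tangent_category_scheme \<Rightarrow> nat \<Rightarrow> 'o \<Rightarrow> 'o \<Rightarrow> (nat \<Rightarrow> 'm) \<Rightarrow> 'm" where
  "Tcomparison C k X P p = ftuple C k P p (\<lambda>i. TA C (Tpr C k X i))"

locale rosicky_tangent_category = category C
  for C :: "('o, 'm, 'x) tangent_category_scheme" (structure) +
  assumes TO_closed: "X \<in> Ob C \<Longrightarrow> TO C X \<in> Ob C"
    and TA_closed: "f \<in> Hom C X Y \<Longrightarrow> TA C f \<in> Hom C (TO C X) (TO C Y)"
    and TA_ide: "X \<in> Ob C \<Longrightarrow> TA C (ide C X) = ide C (TO C X)"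
    and TA_Comp: "f \<in> Hom C X Y \<Longrightarrow> g \<in> Hom C Y Z \<Longrightarrow> TA C (g \<cdot> f) = TA C g \<cdot> TA C f"
    and Tproj_closed: "X \<in> Ob C \<Longrightarrow> Tproj C X \<in> Hom C (TO C X) X"
    and Tproj_natural: "f \<in> Hom C X Y \<Longrightarrow> Tproj C Y \<cdot> TA C f = f \<cdot> Tproj C X"
    and Tzero_closed: "X \<in> Ob C \<Longrightarrow> Tzero C X \<in> Hom C X (TO C X)"
    and Tzero_natural: "f \<in> Hom C X Y \<Longrightarrow> Tzero C Y \<cdot> f = TA C f \<cdot> Tzero C X"
    and Tplus_closed: "X \<in> Ob C \<Longrightarrow> Tplus C X \<in> Hom C (Tk C 2 X) (TO C X)"
    and Tplus_natural: "f \<in> Hom C X Y \<Longrightarrow>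
      Tplus C Y \<cdot> Tpair C Y (TA C f \<cdot> Tpr C 2 X 0) (TA C f \<cdot> Tpr C 2 X 1) = TA C f \<cdot> Tplus C X"
    and Tlift_closed: "X \<in> Ob C \<Longrightarrow> Tlift C X \<in> Hom C (TO C X) (TO C (TO C X))"
    and Tlift_natural: "f \<in> Hom C X Y \<Longrightarrow> Tlift C Y \<cdot> TA C f = TA C (TA C f) \<cdot> Tlift C X"
    and Tflip_closed: "X \<in> Ob C \<Longrightarrow> Tflip C X \<in> Hom C (TO C (TO C X)) (TO C (TO C X))"
    and Tflip_natural: "f \<in> Hom C X Y \<Longrightarrow> Tflip C Y \<cdot> TA C (TA C f) = TA C (TA C f) \<cdot> Tflip C X"
    and Tk_fiber_power: "X \<in> Ob C \<Longrightarrow> k \<ge> 1 \<Longrightarrow>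
      is_fiber_power C k (Tproj C X) (Tk C k X) (Tpr C k X)"
    and Tk_preserved: "X \<in> Ob C \<Longrightarrow> k \<ge> 1 \<Longrightarrow>
      \<exists>P p. is_fiber_power C k (TA C (Tproj C X)) P p \<and> is_iso C (Tcomparison C k X P p)"
    and tangent_ab_group: "X \<in> Ob C \<Longrightarrow> ab_group_bundle C (tangent_bundle C X)"
    and Tflip_Tflip: "X \<in> Ob C \<Longrightarrow> Tflip C X \<cdot> Tflip C X = ide C (TO C (TO C X))"
    and Tflip_braid: "X \<in> Ob C \<Longrightarrow>
      Tflip C (TO C X) \<cdot> TA C (Tflip C X) \<cdot> Tflip C (TO C X) =
      TA C (Tflip C X) \<cdot> Tflip C (TO C X) \<cdot> TA C (Tflip C X)"
    and Tproj_Tflip: "X \<in> Ob C \<Longrightarrow> Tproj C (TO C X) \<cdot> Tflip C X = TA C (Tproj C X)"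
    and Tplus_Tflip: "X \<in> Ob C \<Longrightarrow> is_fiber_power C 2 (TA C (Tproj C X)) P p \<Longrightarrow>
      Tplus C (TO C X) \<cdot> Tpair C (TO C X) (Tflip C X \<cdot> p 0) (Tflip C X \<cdot> p 1) =
      Tflip C X \<cdot> TA C (Tplus C X) \<cdot> inv_ar C (Tcomparison C 2 X P p)"
    and Tproj_Tlift: "X \<in> Ob C \<Longrightarrow> Tproj C (TO C X) \<cdot> Tlift C X = Tzero C X \<cdot> Tproj C X"
    and Tlift_Tlift: "X \<in> Ob C \<Longrightarrow> Tlift C (TO C X) \<cdot> Tlift C X = TA C (Tlift C X) \<cdot> Tlift C X"
    and Tplus_Tlift: "X \<in> Ob C \<Longrightarrow>
      Tplus C (TO C X) \<cdot> Tpair C (TO C X) (Tlift C X \<cdot> Tpr C 2 X 0) (Tlift C X \<cdot> Tpr C 2 X 1) =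
      Tlift C X \<cdot> Tplus C X"
    and Tflip_Tlift: "X \<in> Ob C \<Longrightarrow> Tflip C X \<cdot> Tlift C X = Tlift C X"
    and Tflip_TA_Tlift: "X \<in> Ob C \<Longrightarrow>
      TA C (Tflip C X) \<cdot> Tflip C (TO C X) \<cdot> TA C (Tlift C X) = Tlift C (TO C X) \<cdot> Tflip C X"
    and Tlift_pullback: "X \<in> Ob C \<Longrightarrow>
      is_pullback C (Tpair C X (Tproj C (TO C X)) (TA C (Tproj C X)))
        (Tpair C X (Tzero C X) (Tzero C X)) (TO C X) (Tlift C X) (Tproj C X)"

definition Tlift2 :: "('o, 'm, 'x) tangent_category_scheme \<Rightarrow> 'o \<Rightarrow> 'm" where
  "Tlift2 C X = Tflip C X \<cdot>\<^bsub>C\<^esub> Tplus C (TO C X) \<cdot>\<^bsub>C\<^esub>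
     Tpair C (TO C X) (TA C (Tzero C X) \<cdot>\<^bsub>C\<^esub> Tpr C 2 X 0) (Tlift C X \<cdot>\<^bsub>C\<^esub> Tpr C 2 X 1)"

definition vector_fields :: "('o, 'm, 'x) tangent_category_scheme \<Rightarrow> 'o \<Rightarrow> 'm set" where
  "vector_fields C X = sections C (tangent_bundle C X)"

definition vf_delta :: "('o, 'm, 'x) tangent_category_scheme \<Rightarrow> 'o \<Rightarrow> 'm \<Rightarrow> 'm \<Rightarrow> 'm" where
  "vf_delta C X v w = bminus C (tangent_bundle C (TO C X)) \<cdot>\<^bsub>C\<^esub>
     Tpair C (TO C X) (TA C w \<cdot>\<^bsub>C\<^esub> v) (Tflip C X \<cdot>\<^bsub>C\<^esub> TA C v \<cdot>\<^bsub>C\<^esub> w)"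

definition vf_bracket :: "('o, 'm, 'x) tangent_category_scheme \<Rightarrow> 'o \<Rightarrow> 'm \<Rightarrow> 'm \<Rightarrow> 'm" where
  "vf_bracket C X v w =
     (THE u. u \<in> vector_fields C X \<and> vf_delta C X v w = Tlift2 C X \<cdot>\<^bsub>C\<^esub> Tpair C X w u)"

section \<open>Cartesian tangent structures\<close>

record ('o, 'm) cartesian_tangent_category = "('o, 'm) tangent_category" +
  Star :: 'o
  Prd :: "'o \<Rightarrow> 'o \<Rightarrow> 'o"
  pr1 :: "'o \<Rightarrow> 'o \<Rightarrow> 'm"
  pr2 :: "'o \<Rightarrow> 'o \<Rightarrow> 'm"

definition bang :: "('o, 'm, 'x) cartesian_tangent_category_scheme \<Rightarrow> 'o \<Rightarrow> 'm" where
  "bang C X = (THE h. h \<in> Hom C X (Star C))"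

definition pair ::
    "('o, 'm, 'x) cartesian_tangent_category_scheme \<Rightarrow> 'm \<Rightarrow> 'm \<Rightarrow> 'm" (\<open>\<langle>_,/ _\<rangle>\<index>\<close>) where
  "\<langle>f, g\<rangle>\<^bsub>C\<^esub> = (THE h. h \<in> Hom C (Dom C f) (Prd C (Cod C f) (Cod C g)) \<and>
     pr1 C (Cod C f) (Cod C g) \<cdot>\<^bsub>C\<^esub> h = f \<and> pr2 C (Cod C f) (Cod C g) \<cdot>\<^bsub>C\<^esub> h = g)"

definition cross ::
    "('o, 'm, 'x) cartesian_tangent_category_scheme \<Rightarrow> 'm \<Rightarrow> 'm \<Rightarrow> 'm" (infixr \<open>\<boxtimes>\<index>\<close> 75) where
  "f \<boxtimes>\<^bsub>C\<^esub> g = \<langle>f \<cdot>\<^bsub>C\<^esub> pr1 C (Dom C f) (Dom C g), g \<cdot>\<^bsub>C\<^esub> pr2 C (Dom C f) (Dom C g)\<rangle>\<^bsub>C\<^esub>"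

text \<open>The three projections of the triple product \<open>(X \<times> Y) \<times> Z\<close>.\<close>

definition tpr1 :: "('o, 'm, 'x) cartesian_tangent_category_scheme \<Rightarrow> 'o \<Rightarrow> 'o \<Rightarrow> 'o \<Rightarrow> 'm" where
  "tpr1 C X Y Z = pr1 C X Y \<cdot>\<^bsub>C\<^esub> pr1 C (Prd C X Y) Z"

definition tpr2 :: "('o, 'm, 'x) cartesian_tangent_category_scheme \<Rightarrow> 'o \<Rightarrow> 'o \<Rightarrow> 'o \<Rightarrow> 'm" where
  "tpr2 C X Y Z = pr2 C X Y \<cdot>\<^bsub>C\<^esub> pr1 C (Prd C X Y) Z"

definition tpr3 :: "('o, 'm, 'x) cartesian_tangent_category_scheme \<Rightarrow> 'o \<Rightarrow> 'o \<Rightarrow> 'o \<Rightarrow> 'm" where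
  "tpr3 C X Y Z = pr2 C (Prd C X Y) Z"

definition Tchi :: "('o, 'm, 'x) cartesian_tangent_category_scheme \<Rightarrow> 'o \<Rightarrow> 'o \<Rightarrow> 'm" where
  "Tchi C X Y = \<langle>TA C (pr1 C X Y), TA C (pr2 C X Y)\<rangle>\<^bsub>C\<^esub>"

locale cartesian_tangent_category = rosicky_tangent_category C
  for C :: "('o, 'm, 'x) cartesian_tangent_category_scheme" (structure) +
  assumes Star_closed: "Star C \<in> Ob C"
    and Star_terminal: "X \<in> Ob C \<Longrightarrow> \<exists>!h. h \<in> Hom C X (Star C)"
    and Prd_closed: "X \<in> Ob C \<Longrightarrow> Y \<in> Ob C \<Longrightarrow> Prd C X Y \<in> Ob C"
    and pr1_closed: "X \<in> Ob C \<Longrightarrow> Y \<in> Ob C \<Longrightarrow> pr1 C X Y \<in> Hom C (Prd C X Y) X"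
    and pr2_closed: "X \<in> Ob C \<Longrightarrow> Y \<in> Ob C \<Longrightarrow> pr2 C X Y \<in> Hom C (Prd C X Y) Y"
    and Prd_universal: "f \<in> Hom C Z X \<Longrightarrow> g \<in> Hom C Z Y \<Longrightarrow>
      \<exists>!h. h \<in> Hom C Z (Prd C X Y) \<and> pr1 C X Y \<cdot> h = f \<and> pr2 C X Y \<cdot> h = g"
    and Tchi_iso: "X \<in> Ob C \<Longrightarrow> Y \<in> Ob C \<Longrightarrow> is_iso C (Tchi C X Y)"

text \<open>Partial tangent morphisms of an arrow \<^term>\<open>f\<close> with domain \<open>X \<times> Y\<close>.\<close>

definition Tpartial1 ::
    "('o, 'm, 'x) cartesian_tangent_category_scheme \<Rightarrow> 'o \<Rightarrow> 'o \<Rightarrow> 'm \<Rightarrow> 'm" where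
  "Tpartial1 C X Y f =
     TA C f \<cdot>\<^bsub>C\<^esub> inv_ar C (Tchi C X Y) \<cdot>\<^bsub>C\<^esub> (ide C (TO C X) \<boxtimes>\<^bsub>C\<^esub> Tzero C Y)"

definition Tpartial2 ::
    "('o, 'm, 'x) cartesian_tangent_category_scheme \<Rightarrow> 'o \<Rightarrow> 'o \<Rightarrow> 'm \<Rightarrow> 'm" where
  "Tpartial2 C X Y f =
     TA C f \<cdot>\<^bsub>C\<^esub> inv_ar C (Tchi C X Y) \<cdot>\<^bsub>C\<^esub> (Tzero C X \<boxtimes>\<^bsub>C\<^esub> ide C (TO C Y))"

section \<open>Ring objects and scalar multiplications\<close>

text \<open>\<^term>\<open>RO\<close> is the ring object. \<^term>\<open>Rfib\<close> with \<^term>\<open>Rincl\<close> is a choice of its tangent fiber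
  at zero, and \<^term>\<open>Riso\<close> the fixed isomorphism from the tangent fiber to \<^term>\<open>RO\<close>.\<close>

record ('o, 'm) scalar_tangent_category = "('o, 'm) cartesian_tangent_category" +
  RO :: 'o
  Rplus :: 'm
  Rzero :: 'm
  Rmult :: 'm
  Rone :: 'm
  kappa :: "'o \<Rightarrow> 'm"
  Rfib :: 'o
  Rincl :: 'm
  Riso :: 'm

definition is_Rneg :: "('o, 'm, 'x) scalar_tangent_category_scheme \<Rightarrow> 'm \<Rightarrow> bool" where
  "is_Rneg C n \<longleftrightarrow> n \<in> Hom C (RO C) (RO C) \<and>
     Rplus C \<cdot>\<^bsub>C\<^esub> \<langle>ide C (RO C), n\<rangle>\<^bsub>C\<^esub> = Rzero C \<cdot>\<^bsub>C\<^esub> bang C (RO C)"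

definition Rneg :: "('o, 'm, 'x) scalar_tangent_category_scheme \<Rightarrow> 'm" where
  "Rneg C = (THE n. is_Rneg C n)"

locale comm_ring_object =
  fixes C :: "('o, 'm, 'x) scalar_tangent_category_scheme" (structure)
  assumes RO_closed: "RO C \<in> Ob C"
    and Rplus_closed: "Rplus C \<in> Hom C (Prd C (RO C) (RO C)) (RO C)"
    and Rzero_closed: "Rzero C \<in> Hom C (Star C) (RO C)"
    and Rmult_closed: "Rmult C \<in> Hom C (Prd C (RO C) (RO C)) (RO C)"
    and Rone_closed: "Rone C \<in> Hom C (Star C) (RO C)"
    and Rplus_assoc:
      "Rplus C \<cdot> \<langle>Rplus C \<cdot> \<langle>tpr1 C (RO C) (RO C) (RO C), tpr2 C (RO C) (RO C) (RO C)\<rangle>,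
         tpr3 C (RO C) (RO C) (RO C)\<rangle> =
       Rplus C \<cdot> \<langle>tpr1 C (RO C) (RO C) (RO C),
         Rplus C \<cdot> \<langle>tpr2 C (RO C) (RO C) (RO C), tpr3 C (RO C) (RO C) (RO C)\<rangle>\<rangle>"
    and Rplus_comm: "Rplus C \<cdot> \<langle>pr2 C (RO C) (RO C), pr1 C (RO C) (RO C)\<rangle> = Rplus C"
    and Rplus_Rzero: "Rplus C \<cdot> \<langle>ide C (RO C), Rzero C \<cdot> bang C (RO C)\<rangle> = ide C (RO C)"
    and Rplus_Rneg: "\<exists>n. is_Rneg C n"
    and Rmult_assoc:
      "Rmult C \<cdot> \<langle>Rmult C \<cdot> \<langle>tpr1 C (RO C) (RO C) (RO C), tpr2 C (RO C) (RO C) (RO C)\<rangle>,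
         tpr3 C (RO C) (RO C) (RO C)\<rangle> =
       Rmult C \<cdot> \<langle>tpr1 C (RO C) (RO C) (RO C),
         Rmult C \<cdot> \<langle>tpr2 C (RO C) (RO C) (RO C), tpr3 C (RO C) (RO C) (RO C)\<rangle>\<rangle>"
    and Rmult_comm: "Rmult C \<cdot> \<langle>pr2 C (RO C) (RO C), pr1 C (RO C) (RO C)\<rangle> = Rmult C"
    and Rmult_Rone: "Rmult C \<cdot> \<langle>ide C (RO C), Rone C \<cdot> bang C (RO C)\<rangle> = ide C (RO C)"
    and R_distrib:
      "Rmult C \<cdot> \<langle>tpr1 C (RO C) (RO C) (RO C),
         Rplus C \<cdot> \<langle>tpr2 C (RO C) (RO C) (RO C), tpr3 C (RO C) (RO C) (RO C)\<rangle>\<rangle> =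
       Rplus C \<cdot> \<langle>Rmult C \<cdot> \<langle>tpr1 C (RO C) (RO C) (RO C), tpr2 C (RO C) (RO C) (RO C)\<rangle>,
         Rmult C \<cdot> \<langle>tpr1 C (RO C) (RO C) (RO C), tpr3 C (RO C) (RO C) (RO C)\<rangle>\<rangle>"

text \<open>A bundle of modules over the ring object, with scalar multiplication \<^term>\<open>k\<close>. The laws for
  three arguments are stated on \<open>(R \<times> R) \<times> A\<close>, i.e. up to the canonical associativity
  isomorphism.\<close>

locale module_bundle = ab_group_bundle C B
  for C :: "('o, 'm, 'x) scalar_tangent_category_scheme" (structure)
    and B :: "('o, 'm, 'y) ab_bundle_scheme" +
  fixes k :: 'm
  assumes smult_closed: "k \<in> Hom C (Prd C (RO C) (tot B)) (tot B)"
    and smult_over: "bproj B \<cdot> k = bproj B \<cdot> pr2 C (RO C) (tot B)"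
    and smult_assoc:
      "k \<cdot> \<langle>tpr1 C (RO C) (RO C) (tot B),
         k \<cdot> \<langle>tpr2 C (RO C) (RO C) (tot B), tpr3 C (RO C) (RO C) (tot B)\<rangle>\<rangle> =
       k \<cdot> (Rmult C \<boxtimes> ide C (tot B))"
    and smult_one: "k \<cdot> (Rone C \<boxtimes> ide C (tot B)) = pr2 C (Star C) (tot B)"
    and smult_Rplus:
      "k \<cdot> (Rplus C \<boxtimes> ide C (tot B)) =
       bsum C B (k \<cdot> \<langle>tpr1 C (RO C) (RO C) (tot B), tpr3 C (RO C) (RO C) (tot B)\<rangle>)
         (k \<cdot> \<langle>tpr2 C (RO C) (RO C) (tot B), tpr3 C (RO C) (RO C) (tot B)\<rangle>)"
    and smult_badd:
      "k \<cdot> (ide C (RO C) \<boxtimes> badd B) =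
       bsum C B (k \<cdot> \<langle>pr1 C (RO C) (tot2 B), bpr B 0 \<cdot> pr2 C (RO C) (tot2 B)\<rangle>)
         (k \<cdot> \<langle>pr1 C (RO C) (tot2 B), bpr B 1 \<cdot> pr2 C (RO C) (tot2 B)\<rangle>)"

text \<open>Addition and scalar multiplication that the tangent fiber inherits from the tangent bundle
  of the ring object.\<close>

definition Rfib_add :: "('o, 'm, 'x) scalar_tangent_category_scheme \<Rightarrow> 'm" where
  "Rfib_add C = (THE h. h \<in> Hom C (Prd C (Rfib C) (Rfib C)) (Rfib C) \<and>
     Rincl C \<cdot>\<^bsub>C\<^esub> h = Tsum C (RO C) (Rincl C \<cdot>\<^bsub>C\<^esub> pr1 C (Rfib C) (Rfib C))
                               (Rincl C \<cdot>\<^bsub>C\<^esub> pr2 C (Rfib C) (Rfib C)))"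

definition Rfib_smult :: "('o, 'm, 'x) scalar_tangent_category_scheme \<Rightarrow> 'm" where
  "Rfib_smult C = (THE h. h \<in> Hom C (Prd C (RO C) (Rfib C)) (Rfib C) \<and>
     Rincl C \<cdot>\<^bsub>C\<^esub> h = kappa C (RO C) \<cdot>\<^bsub>C\<^esub> (ide C (RO C) \<boxtimes>\<^bsub>C\<^esub> Rincl C))"

definition tangent_stable :: "('o, 'm, 'x) scalar_tangent_category_scheme \<Rightarrow> bool" where
  "tangent_stable C \<longleftrightarrow>
     is_pullback C (Rzero C) (Tproj C (RO C)) (Rfib C) (bang C (Rfib C)) (Rincl C) \<and>
     Riso C \<in> Hom C (Rfib C) (RO C) \<and> is_iso C (Riso C) \<and>
     Riso C \<cdot>\<^bsub>C\<^esub> Rfib_add C = Rplus C \<cdot>\<^bsub>C\<^esub> (Riso C \<boxtimes>\<^bsub>C\<^esub> Riso C) \<and>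
     Riso C \<cdot>\<^bsub>C\<^esub> Rfib_smult C = Rmult C \<cdot>\<^bsub>C\<^esub> (ide C (RO C) \<boxtimes>\<^bsub>C\<^esub> Riso C)"

definition Reta :: "('o, 'm, 'x) scalar_tangent_category_scheme \<Rightarrow> 'm" where
  "Reta C = Riso C \<cdot>\<^bsub>C\<^esub> (THE h. h \<in> Hom C (TO C (RO C)) (Rfib C) \<and>
     Rincl C \<cdot>\<^bsub>C\<^esub> h = Tpartial2 C (RO C) (RO C) (Rplus C) \<cdot>\<^bsub>C\<^esub>
       \<langle>Rneg C \<cdot>\<^bsub>C\<^esub> Tproj C (RO C), ide C (TO C (RO C))\<rangle>\<^bsub>C\<^esub>)"

locale scalar_tangent_category = cartesian_tangent_category C + comm_ring_object C
  for C :: "('o, 'm, 'x) scalar_tangent_category_scheme" (structure) +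
  assumes kappa_module: "X \<in> Ob C \<Longrightarrow> module_bundle C (tangent_bundle C X) (kappa C X)"
    and kappa_natural: "f \<in> Hom C X Y \<Longrightarrow>
      kappa C Y \<cdot> (ide C (RO C) \<boxtimes> TA C f) = TA C f \<cdot> kappa C X"
    and R_tangent_stable: "tangent_stable C"
    and kappa_Tlift: "X \<in> Ob C \<Longrightarrow>
      Tlift C X \<cdot> kappa C X = kappa C (TO C X) \<cdot> (ide C (RO C) \<boxtimes> Tlift C X)"
    and kappa_Tpartial1: "X \<in> Ob C \<Longrightarrow>
      Tpartial1 C (RO C) (TO C X) (kappa C X) =
      Tlift2 C X \<cdot>
      Tpair C X (kappa C X \<cdot> \<langle>tpr1 C (RO C) (RO C) (TO C X), tpr3 C (RO C) (RO C) (TO C X)\<rangle>)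
        (kappa C X \<cdot> \<langle>tpr2 C (RO C) (RO C) (TO C X), tpr3 C (RO C) (RO C) (TO C X)\<rangle>) \<cdot>
      (\<langle>Tproj C (RO C), Reta C\<rangle> \<boxtimes> ide C (TO C X))"
    and kappa_Tpartial2: "X \<in> Ob C \<Longrightarrow>
      Tpartial2 C (RO C) (TO C X) (kappa C X) =
      Tflip C X \<cdot> kappa C (TO C X) \<cdot> (ide C (RO C) \<boxtimes> Tflip C X)"

text \<open>The commutative ring \<open>Hom(X, R)\<close>.\<close>

definition function_ring :: "('o, 'm, 'x) scalar_tangent_category_scheme \<Rightarrow> 'o \<Rightarrow> 'm ring" where
  "function_ring C X = \<lparr>carrier = Hom C X (RO C),
     mult = (\<lambda>f g. Rmult C \<cdot>\<^bsub>C\<^esub> \<langle>f, g\<rangle>\<^bsub>C\<^esub>), one = Rone C \<cdot>\<^bsub>C\<^esub> bang C X,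
     zero = Rzero C \<cdot>\<^bsub>C\<^esub> bang C X, add = (\<lambda>f g. Rplus C \<cdot>\<^bsub>C\<^esub> \<langle>f, g\<rangle>\<^bsub>C\<^esub>)\<rparr>"

definition vf_act :: "('o, 'm, 'x) scalar_tangent_category_scheme \<Rightarrow> 'm \<Rightarrow> 'm \<Rightarrow> 'm" where
  "vf_act C v f = Reta C \<cdot>\<^bsub>C\<^esub> TA C f \<cdot>\<^bsub>C\<^esub> v"

section \<open>Lie algebras, Lie-Rinehart algebras\<close>

text \<open>Lie brackets are taken over the integers, with \<open>[a, a] = 0\<close> as the skew-symmetry axiom.\<close>

definition is_lie_bracket :: "('a, 'b) ring_scheme \<Rightarrow> ('a \<Rightarrow> 'a \<Rightarrow> 'a) \<Rightarrow> bool" where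
  "is_lie_bracket M br \<longleftrightarrow>
     (\<forall>a\<in>carrier M. \<forall>b\<in>carrier M. br a b \<in> carrier M) \<and>
     (\<forall>a\<in>carrier M. \<forall>b\<in>carrier M. \<forall>c\<in>carrier M. br (a \<oplus>\<^bsub>M\<^esub> b) c = br a c \<oplus>\<^bsub>M\<^esub> br b c) \<and>
     (\<forall>a\<in>carrier M. \<forall>b\<in>carrier M. \<forall>c\<in>carrier M. br a (b \<oplus>\<^bsub>M\<^esub> c) = br a b \<oplus>\<^bsub>M\<^esub> br a c) \<and>
     (\<forall>a\<in>carrier M. br a a = \<zero>\<^bsub>M\<^esub>) \<and>
     (\<forall>a\<in>carrier M. \<forall>b\<in>carrier M. \<forall>c\<in>carrier M.
        br a (br b c) \<oplus>\<^bsub>M\<^esub> br b (br c a) \<oplus>\<^bsub>M\<^esub> br c (br a b) = \<zero>\<^bsub>M\<^esub>)"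

definition is_derivation :: "('a, 'b) ring_scheme \<Rightarrow> ('a \<Rightarrow> 'a) \<Rightarrow> bool" where
  "is_derivation S d \<longleftrightarrow> d \<in> carrier S \<rightarrow> carrier S \<and>
     (\<forall>f\<in>carrier S. \<forall>g\<in>carrier S. d (f \<oplus>\<^bsub>S\<^esub> g) = d f \<oplus>\<^bsub>S\<^esub> d g) \<and>
     (\<forall>f\<in>carrier S. \<forall>g\<in>carrier S. d (f \<otimes>\<^bsub>S\<^esub> g) = d f \<otimes>\<^bsub>S\<^esub> g \<oplus>\<^bsub>S\<^esub> f \<otimes>\<^bsub>S\<^esub> d g)"

text \<open>The Lie bracket of derivations is the commutator, so \<open>act_add\<close> and \<open>act_bracket\<close> say that
  \<^term>\<open>act\<close> is a homomorphism of Lie algebras to the derivations of \<^term>\<open>S\<close>.\<close>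

locale lie_rinehart_algebra = module S M
  for S :: "('r, 'b) ring_scheme" (structure)
    and M :: "('r, 'a, 'c) module_scheme" (structure) +
  fixes br :: "'a \<Rightarrow> 'a \<Rightarrow> 'a" and act :: "'a \<Rightarrow> 'r \<Rightarrow> 'r"
  assumes lie_bracket: "is_lie_bracket M br"
    and act_derivation: "v \<in> carrier M \<Longrightarrow> is_derivation S (act v)"
    and act_add: "v \<in> carrier M \<Longrightarrow> w \<in> carrier M \<Longrightarrow> f \<in> carrier S \<Longrightarrow>
      act (v \<oplus>\<^bsub>M\<^esub> w) f = act v f \<oplus>\<^bsub>S\<^esub> act w f"
    and act_bracket: "v \<in> carrier M \<Longrightarrow> w \<in> carrier M \<Longrightarrow> f \<in> carrier S \<Longrightarrow>
      act (br v w) f = act v (act w f) \<ominus>\<^bsub>S\<^esub> act w (act v f)"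
    and leibniz: "v \<in> carrier M \<Longrightarrow> w \<in> carrier M \<Longrightarrow> f \<in> carrier S \<Longrightarrow>
      br v (f \<odot>\<^bsub>M\<^esub> w) = act v f \<odot>\<^bsub>M\<^esub> w \<oplus>\<^bsub>M\<^esub> f \<odot>\<^bsub>M\<^esub> br v w"

section \<open>Abstract Lie algebroids\<close>

record ('o, 'm) algebroid = "('o, 'm) ab_bundle" +
  bsmult :: 'm
  anchor :: 'm
  bracket :: "'m \<Rightarrow> 'm \<Rightarrow> 'm"

text \<open>Sections as a module over the ring of functions on the base; the fields \<^const>\<open>mult\<close>
  and \<^const>\<open>one\<close> that the module record inherits from rings play no role.\<close>

definition section_module ::
    "('o, 'm, 'x) scalar_tangent_category_scheme \<Rightarrow> ('o, 'm, 'y) algebroid_scheme \<Rightarrow>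
      ('m, 'm) module" where
  "section_module C A = \<lparr>carrier = sections C A, mult = undefined, one = undefined,
     zero = bzero A, add = bsum C A, smult = (\<lambda>f a. bsmult A \<cdot>\<^bsub>C\<^esub> \<langle>f, a\<rangle>\<^bsub>C\<^esub>)\<rparr>"

definition algebroid_act ::
    "('o, 'm, 'x) scalar_tangent_category_scheme \<Rightarrow> ('o, 'm, 'y) algebroid_scheme \<Rightarrow>
      'm \<Rightarrow> 'm \<Rightarrow> 'm" where
  "algebroid_act C A a f = vf_act C (anchor A \<cdot>\<^bsub>C\<^esub> a) f"

locale abstract_lie_algebroid = module_bundle C A "bsmult A"
  for C :: "('o, 'm, 'x) scalar_tangent_category_scheme" (structure)
    and A :: "('o, 'm, 'y) algebroid_scheme" +
  assumes anchor_closed: "anchor A \<in> Hom C (tot A) (TO C (base A))"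
    and anchor_over: "Tproj C (base A) \<cdot> anchor A = bproj A"
    and anchor_badd: "anchor A \<cdot> badd A =
      Tsum C (base A) (anchor A \<cdot> bpr A 0) (anchor A \<cdot> bpr A 1)"
    and anchor_bsmult: "anchor A \<cdot> bsmult A =
      kappa C (base A) \<cdot> (ide C (RO C) \<boxtimes> anchor A)"
    and bracket_lie: "is_lie_bracket (section_module C A) (bracket A)"
    and bracket_leibniz: "a \<in> sections C A \<Longrightarrow> b \<in> sections C A \<Longrightarrow> f \<in> Hom C (base A) (RO C) \<Longrightarrow>
      bracket A a (f \<odot>\<^bsub>section_module C A\<^esub> b) =
      f \<odot>\<^bsub>section_module C A\<^esub> bracket A a b \<oplus>\<^bsub>section_module C A\<^esub>
      algebroid_act C A a f \<odot>\<^bsub>section_module C A\<^esub> b"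
    and anchor_bracket: "a \<in> sections C A \<Longrightarrow> b \<in> sections C A \<Longrightarrow>
      anchor A \<cdot> bracket A a b = vf_bracket C (base A) (anchor A \<cdot> a) (anchor A \<cdot> b)"

end

theory Submission
  imports Defs
begin

text \<open>Generalized elements of a bundle over a fixed base map form an abelian group, so sections can be
  computed with as in ordinary algebra. The vertical lift is a pullback; subtracting the \<open>T0\<close> part
  fiberwise, so is \<open>\<lambda>\<^sub>2\<close>, and hence the bracket of vector fields exists. Put \<open>\<eta> = \<eta>\<^sub>R\<close>
  and let \<open>j : R \<rightarrow> TR\<close> be the inclusion of the tangent fiber at zero, so that every \<open>t\<close> in \<open>TR\<close>
  is \<open>0(\<pi> t) + j(\<eta> t)\<close> for the addition \<open>T(+)\<close>. Axiom (S2) at the element \<open>j(1)\<close> reads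
  \<open>Tj(s) = \<lambda>\<^sub>2(j \<pi> s, j \<eta> s)\<close>, and from it follow the two identities for the second-order
  derivative \<open>\<eta> \<circ> T\<eta>\<close>: it is invariant under the flip, and \<open>\<eta> \<circ> T\<eta> \<circ> \<lambda> = \<eta>\<close>. Applied to the defining
  equation of \<open>[v, w]\<close> they give \<open>[v, w] \<cdot> f = v \<cdot> (w \<cdot> f) - w \<cdot> (v \<cdot> f)\<close>. Together with (S3), applied
  to \<open>\<kappa>(r, j(s)) = j(r s)\<close>, flip invariance also gives the product rule. The rest of the structure is part
  of the algebroid.\<close>

section \<open>Generalized elements and abelian group bundles\<close>

text \<open>The obstacle is that \<open>TR\<close> carries two additions: the fiberwise one, in
  which the bracket is written, and the tangent morphism of the addition of \<open>R\<close>, with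
  which \<open>\<eta>\<close> is defined. On the fiber at zero they agree by an Eckmann--Hilton
  argument, and this makes \<open>\<eta>\<close> additive for both. The bracket compares
  \<open>Tw \<circ> v\<close> with the flip of \<open>Tv \<circ> w\<close>; a function
  differentiated twice therefore meets a flip, and flip invariance is what lets it be dropped. There
  is no direct formula for \<open>T\<eta>\<close>. What can be differentiated is
  \<open>\<eta> \<circ> j = id\<close>, \<open>\<eta> \<circ> 0 = 0\<close> and the additivity of
  \<open>\<eta>\<close>. Hence the second-order identities are checked on the images of
  \<open>j\<close> and \<open>Tj\<close>, and the splitting of \<open>TR\<close>, or its tangent
  morphism, carries them to all elements. Differences are traded for the sums that characterize
  them, since sums are what tangent morphisms and lifts are known to preserve.\<close>

context category
begin

lemma Hom_iff [simp]: "f \<in> Hom C X Y \<longleftrightarrow> f \<in> Ar C \<and> Dom C f = X \<and> Cod C f = Y"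
  by (simp add: Hom_def)

lemma Dom_Ob [simp]: "f \<in> Ar C \<Longrightarrow> Dom C f \<in> Ob C"
  by (rule Dom_closed)

lemma Cod_Ob [simp]: "f \<in> Ar C \<Longrightarrow> Cod C f \<in> Ob C"
  by (rule Cod_closed)

lemma ide_simps [simp]:
  assumes "X \<in> Ob C"
  shows "ide C X \<in> Ar C" "Dom C (ide C X) = X" "Cod C (ide C X) = X"
  using ide_closed[OF assms] by simp_all

lemma Comp_simps [simp]:
  assumes "f \<in> Ar C" "g \<in> Ar C" "Cod C f = Dom C g"
  shows "g \<cdot> f \<in> Ar C" "Dom C (g \<cdot> f) = Dom C f" "Cod C (g \<cdot> f) = Cod C g"
  using Comp_closed[of f "Dom C f" "Dom C g" g "Cod C g"] assms by simp_all

lemma Comp_ide_right [simp]: "f \<in> Ar C \<Longrightarrow> Dom C f = X \<Longrightarrow> f \<cdot> ide C X = f"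
  using Comp_ide[of f X "Cod C f"] by simp

lemma Comp_ide_left [simp]: "f \<in> Ar C \<Longrightarrow> Cod C f = X \<Longrightarrow> ide C X \<cdot> f = f"
  using ide_Comp[of f "Dom C f" X] by simp

lemma Comp_Comp [simp]:
  "f \<in> Ar C \<Longrightarrow> g \<in> Ar C \<Longrightarrow> h \<in> Ar C \<Longrightarrow> Cod C f = Dom C g \<Longrightarrow> Cod C g = Dom C h \<Longrightarrow>
    (h \<cdot> g) \<cdot> f = h \<cdot> g \<cdot> f"
  using Comp_assoc[of f "Dom C f" "Dom C g" g "Dom C h" h "Cod C h"] by simp

text \<open>Composites are kept associated to the right, so an equation between composites no longer
  matches once a further arrow is composed on the right. This lemma and \<open>Comp_eq_right\<close>
  apply it there.\<close>

lemma Comp_cong_right: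
  assumes "h \<cdot> g = h' \<cdot> g'" "f \<in> Ar C" "g \<in> Ar C" "h \<in> Ar C" "g' \<in> Ar C" "h' \<in> Ar C"
    "Cod C f = Dom C g" "Cod C f = Dom C g'" "Cod C g = Dom C h" "Cod C g' = Dom C h'"
  shows "h \<cdot> g \<cdot> f = h' \<cdot> g' \<cdot> f"
  using Comp_Comp[of f g h] Comp_Comp[of f g' h'] assms by metis

lemma Comp_eq_right:
  assumes "h \<cdot> g = k" "f \<in> Ar C" "g \<in> Ar C" "h \<in> Ar C"
    "Cod C f = Dom C g" "Cod C g = Dom C h"
  shows "h \<cdot> g \<cdot> f = k \<cdot> f"
  using Comp_Comp[of f g h] assms by metis

lemma inverse_arrows_unique:
  assumes "inverse_arrows C f g" "inverse_arrows C f g'"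
  shows "g = g'"
proof -
  have *: "f \<in> Ar C" "g \<in> Ar C" "g' \<in> Ar C" "Dom C g = Cod C f" "Cod C g = Dom C f"
    "Dom C g' = Cod C f" "Cod C g' = Dom C f"
    "g \<cdot> f = ide C (Dom C f)" "f \<cdot> g' = ide C (Cod C f)"
    using assms by (auto simp: inverse_arrows_def)
  have "g = g \<cdot> f \<cdot> g'" using * by simp
  also have "\<dots> = (g \<cdot> f) \<cdot> g'" using * by (intro Comp_Comp[symmetric]) auto
  also have "\<dots> = g'" using * by simp
  finally show ?thesis .
qed

lemma inv_ar_inverse_arrows:
  assumes "is_iso C f"
  shows "inverse_arrows C f (inv_ar C f)"
  using assms inverse_arrows_unique unfolding is_iso_def inv_ar_def by (metis theI')

lemma inv_ar_simps:
  assumes "is_iso C f"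
  shows "f \<in> Ar C" "inv_ar C f \<in> Ar C" "Dom C (inv_ar C f) = Cod C f" "Cod C (inv_ar C f) = Dom C f"
    "inv_ar C f \<cdot> f = ide C (Dom C f)" "f \<cdot> inv_ar C f = ide C (Cod C f)"
  using inv_ar_inverse_arrows[OF assms] by (auto simp: inverse_arrows_def)

lemma Comp_cancel_inv:
  assumes "is_iso C f" "a \<in> Ar C"
  shows "Cod C a = Dom C f \<Longrightarrow> inv_ar C f \<cdot> f \<cdot> a = a"
    and "Cod C a = Cod C f \<Longrightarrow> f \<cdot> inv_ar C f \<cdot> a = a"
proof -
  note f = inv_ar_simps[OF assms(1)]
  assume "Cod C a = Dom C f"
  then show "inv_ar C f \<cdot> f \<cdot> a = a"
    using Comp_eq_right[OF f(5) assms(2) f(1,2)] f(1-4) assms(2) by simp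
next
  note f = inv_ar_simps[OF assms(1)]
  assume "Cod C a = Cod C f"
  then show "f \<cdot> inv_ar C f \<cdot> a = a"
    using Comp_eq_right[OF f(6) assms(2) f(2,1)] f(1-4) assms(2) by simp
qed

lemma is_fiber_powerD:
  assumes "is_fiber_power C k f P p"
  shows "f \<in> Ar C" "i < k \<Longrightarrow> p i \<in> Ar C" "i < k \<Longrightarrow> Dom C (p i) = P"
    "i < k \<Longrightarrow> Cod C (p i) = Dom C f" "i < k \<Longrightarrow> j < k \<Longrightarrow> f \<cdot> p i = f \<cdot> p j"
  using assms unfolding is_fiber_power_def Hom_iff by blast+

lemma is_fiber_power_ex1:
  assumes "is_fiber_power C k f P p" "\<forall>i<k. u i \<in> Hom C Z (Dom C f)"
    "\<forall>i<k. \<forall>j<k. f \<cdot> u i = f \<cdot> u j"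
  shows "\<exists>!h. h \<in> Hom C Z P \<and> (\<forall>i<k. p i \<cdot> h = u i)"
  using assms unfolding is_fiber_power_def by blast

lemma ftuple_simps:
  assumes "is_fiber_power C k f P p" "k \<ge> 1" "\<forall>i<k. u i \<in> Hom C Z (Dom C f)"
    "\<forall>i<k. \<forall>j<k. f \<cdot> u i = f \<cdot> u j"
  shows "ftuple C k P p u \<in> Hom C Z P" "i < k \<Longrightarrow> p i \<cdot> ftuple C k P p u = u i"
proof -
  have Z: "Dom C (u 0) = Z" using assms(2,3) by auto
  from theI'[OF is_fiber_power_ex1[OF assms(1,3,4)]]
  show "ftuple C k P p u \<in> Hom C Z P" "i < k \<Longrightarrow> p i \<cdot> ftuple C k P p u = u i"
    unfolding ftuple_def Z by blast+
qed

text \<open>Both arrows mediate the cone that \<open>h\<close> induces; this cone is compatible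
  because the projections are.\<close>

lemma fiber_power_ext:
  assumes "is_fiber_power C k f P p" "k \<ge> 1" "h \<in> Hom C Z P" "h' \<in> Hom C Z P"
    "\<And>i. i < k \<Longrightarrow> p i \<cdot> h = p i \<cdot> h'"
  shows "h = h'"
proof -
  note f = is_fiber_powerD(1)[OF assms(1)] and p = is_fiber_powerD(2-4)[OF assms(1)]
    and e = is_fiber_powerD(5)[OF assms(1)]
  have h: "h \<in> Ar C" "Dom C h = Z" "Cod C h = P" using assms(3) by simp_all
  have "\<forall>i<k. p i \<cdot> h \<in> Hom C Z (Dom C f)" using p h by simp
  moreover have "\<forall>i<k. \<forall>j<k. f \<cdot> p i \<cdot> h = f \<cdot> p j \<cdot> h"
  proof (intro allI impI)
    fix i j assume ij: "i < k" "j < k"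
    show "f \<cdot> p i \<cdot> h = f \<cdot> p j \<cdot> h"
      by (rule Comp_cong_right[OF e[OF ij] h(1)]) (use p[OF ij(1)] p[OF ij(2)] f h in simp_all)
  qed
  ultimately have "\<exists>!g. g \<in> Hom C Z P \<and> (\<forall>i<k. p i \<cdot> g = p i \<cdot> h)"
    by (rule is_fiber_power_ex1[OF assms(1)])
  moreover have "h \<in> Hom C Z P \<and> (\<forall>i<k. p i \<cdot> h = p i \<cdot> h)" using assms(3) by blast
  moreover have "h' \<in> Hom C Z P \<and> (\<forall>i<k. p i \<cdot> h' = p i \<cdot> h)" using assms(4,5) by metis
  ultimately show ?thesis by blast
qed

end

section \<open>Abelian group objects in a slice category, on generalized elements\<close>

locale slice_ab_group = category C + ab_group_bundle C B
  for C :: "('o, 'm, 'x) category_scheme" (structure)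
    and B :: "('o, 'm, 'y) ab_bundle_scheme"
begin

lemma bundle_simps [simp]:
  "bproj B \<in> Ar C" "Dom C (bproj B) = tot B" "Cod C (bproj B) = base B"
  "badd B \<in> Ar C" "Dom C (badd B) = tot2 B" "Cod C (badd B) = tot B"
  "bzero B \<in> Ar C" "Dom C (bzero B) = base B" "Cod C (bzero B) = tot B"
  using bproj_closed badd_closed bzero_closed by simp_all

lemma Ob_simps [simp]: "tot B \<in> Ob C" "base B \<in> Ob C" "tot2 B \<in> Ob C"
  using bundle_simps Dom_Ob Cod_Ob by metis+

lemma bpr_simps [simp]:
  assumes "i < 2"
  shows "bpr B i \<in> Ar C" "Dom C (bpr B i) = tot2 B" "Cod C (bpr B i) = tot B"
  using is_fiber_powerD(2-4)[OF tot2_fiber_power assms] by simp_all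

lemma bproj_bpr: "bproj B \<cdot> bpr B 0 = bproj B \<cdot> bpr B 1"
  using is_fiber_powerD(5)[OF tot2_fiber_power, of 0 1] by simp

lemma bproj_bzero [simp]: "x \<in> Ar C \<Longrightarrow> Cod C x = base B \<Longrightarrow> bproj B \<cdot> bzero B \<cdot> x = x"
  using Comp_eq_right[OF bzero_over] by simp

text \<open>These are the generalized elements of the bundle lying above \<open>x\<close>. Fixing
  \<open>x\<close> fixes their domain as well, so any two of them can be added; for \<open>x\<close>
  the identity of the base they are the sections.\<close>

definition over :: "'m \<Rightarrow> 'm set" where
  "over x = {a \<in> Hom C (Dom C x) (tot B). bproj B \<cdot> a = x}"

lemma overI: "a \<in> Ar C \<Longrightarrow> Cod C a = tot B \<Longrightarrow> a \<in> over (bproj B \<cdot> a)"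
  by (simp add: over_def)

lemma overD:
  assumes "a \<in> over x"
  shows "a \<in> Ar C" "Dom C a = Dom C x" "Cod C a = tot B" "bproj B \<cdot> a = x"
    "x \<in> Ar C" "Cod C x = base B"
  using assms by (auto simp: over_def)

lemma bpair_simps:
  assumes "a \<in> over x" "b \<in> over x"
  shows "bpair C B a b \<in> Ar C" "Dom C (bpair C B a b) = Dom C x" "Cod C (bpair C B a b) = tot2 B"
    "bpr B 0 \<cdot> bpair C B a b = a" "bpr B 1 \<cdot> bpair C B a b = b"
  using ftuple_simps[OF tot2_fiber_power, of "\<lambda>i. if i = 0 then a else b" "Dom C x"]
    overD[OF assms(1)] overD[OF assms(2)] unfolding bpair_def fpair_def
  by (simp_all split: if_splits)

lemma bpair_unique:
  assumes "h \<in> Ar C" "Cod C h = tot2 B"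
  shows "bpair C B (bpr B 0 \<cdot> h) (bpr B 1 \<cdot> h) = h"
proof (rule fiber_power_ext[OF tot2_fiber_power, of _ "Dom C h"])
  have e: "bproj B \<cdot> bpr B 0 \<cdot> h = bproj B \<cdot> bpr B 1 \<cdot> h"
    using bproj_bpr assms by (intro Comp_cong_right) simp_all
  have o: "bpr B 0 \<cdot> h \<in> over (bproj B \<cdot> bpr B 0 \<cdot> h)"
    "bpr B 1 \<cdot> h \<in> over (bproj B \<cdot> bpr B 0 \<cdot> h)"
    unfolding over_def using assms e by simp_all
  note * = bpair_simps[OF o]
  show "bpair C B (bpr B 0 \<cdot> h) (bpr B 1 \<cdot> h) \<in> Hom C (Dom C h) (tot2 B)"
    using * assms by simp
  fix i :: nat assume "i < 2"
  then have "i = 0 \<or> i = 1" by linarith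
  then show "bpr B i \<cdot> bpair C B (bpr B 0 \<cdot> h) (bpr B 1 \<cdot> h) = bpr B i \<cdot> h"
    using *(4,5) by fastforce
qed (use assms in simp_all)

lemma bpair_Comp:
  assumes "a \<in> over x" "b \<in> over x" "c \<in> Ar C" "Cod C c = Dom C x"
  shows "bpair C B a b \<cdot> c = bpair C B (a \<cdot> c) (b \<cdot> c)"
proof -
  note * = bpair_simps[OF assms(1,2)]
  have "bpr B 0 \<cdot> bpair C B a b \<cdot> c = a \<cdot> c"
    by (rule Comp_eq_right[OF *(4)]) (use * assms in simp_all)
  moreover have "bpr B 1 \<cdot> bpair C B a b \<cdot> c = b \<cdot> c"
    by (rule Comp_eq_right[OF *(5)]) (use * assms in simp_all)
  ultimately show ?thesis using bpair_unique[of "bpair C B a b \<cdot> c"] * assms(3,4) by simp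
qed

lemma bsum_over:
  assumes "a \<in> over x" "b \<in> over x"
  shows "bsum C B a b \<in> over x"
proof -
  note * = bpair_simps[OF assms]
  have "bproj B \<cdot> bsum C B a b = (bproj B \<cdot> bpr B 0) \<cdot> bpair C B a b"
    unfolding bsum_def badd_over[symmetric] using * by simp
  also have "\<dots> = x" using * overD[OF assms(1)] by simp
  finally show ?thesis using * by (simp add: over_def bsum_def)
qed

lemma bsum_Comp:
  assumes "a \<in> over x" "b \<in> over x" "c \<in> Ar C" "Cod C c = Dom C x"
  shows "bsum C B a b \<cdot> c = bsum C B (a \<cdot> c) (b \<cdot> c)"
  using bpair_Comp[OF assms] bpair_simps[OF assms(1,2)] assms by (simp add: bsum_def)

lemma over_Comp:
  assumes "a \<in> over x" "c \<in> Ar C" "Cod C c = Dom C x"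
  shows "a \<cdot> c \<in> over (x \<cdot> c)"
proof -
  note a = overD[OF assms(1)]
  have "bproj B \<cdot> a \<cdot> c = x \<cdot> c"
    by (rule Comp_eq_right[OF a(4)]) (use a assms in simp_all)
  then show ?thesis using a assms by (simp add: over_def)
qed

text \<open>The law \<open>badd_comm\<close> concerns the two projections, that is, the universal
  pair. Composing it with \<open>bpair C B a b\<close> carries it to arbitrary elements; most
  structural laws below are transported in this way.\<close>

lemma bsum_commute:
  assumes "a \<in> over x" "b \<in> over x"
  shows "bsum C B a b = bsum C B b a"
proof -
  have o: "bpr B 0 \<in> over (bproj B \<cdot> bpr B 1)" "bpr B 1 \<in> over (bproj B \<cdot> bpr B 1)"
    by (simp_all add: over_def bproj_bpr)
  have "bsum C B a b = bsum C B (bpr B 1) (bpr B 0) \<cdot> bpair C B a b"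
    unfolding badd_comm by (simp only: bsum_def)
  also have "\<dots> = bsum C B b a"
    using bsum_Comp[OF o(2,1), of "bpair C B a b"] bpair_simps[OF assms] by simp
  finally show ?thesis .
qed

lemma bsum_bzero:
  assumes "a \<in> over x"
  shows "bsum C B a (bzero B \<cdot> x) = a"
proof -
  have o: "ide C (tot B) \<in> over (bproj B)" "bzero B \<cdot> bproj B \<in> over (bproj B)"
    by (simp_all add: over_def)
  have "bsum C B (ide C (tot B)) (bzero B \<cdot> bproj B) \<cdot> a = bsum C B a (bzero B \<cdot> x)"
    using bsum_Comp[OF o, of a] overD[OF assms] by simp
  then show ?thesis using badd_bzero overD[OF assms] by simp
qed

text \<open>Associativity is given on some threefold fiber product, not on a chosen one. The arrow
  \<open>h\<close> into it with components \<open>a\<close>, \<open>b\<close>, \<open>c\<close>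
  carries the law to these elements.\<close>

lemma bsum_assoc:
  assumes "a \<in> over x" "b \<in> over x" "c \<in> over x"
  shows "bsum C B (bsum C B a b) c = bsum C B a (bsum C B b c)"
proof -
  obtain P p where P: "is_fiber_power C 3 (bproj B) P p"
    and e: "bsum C B (bsum C B (p 0) (p 1)) (p 2) = bsum C B (p 0) (bsum C B (p 1) (p 2))"
    using badd_assoc by blast
  have p: "p 0 \<in> over (bproj B \<cdot> p 0)" "p 1 \<in> over (bproj B \<cdot> p 0)" "p 2 \<in> over (bproj B \<cdot> p 0)"
    using is_fiber_powerD(2-4)[OF P] is_fiber_powerD(5)[OF P, of 1 0]
      is_fiber_powerD(5)[OF P, of 2 0] by (simp_all add: over_def)
  have P': "Dom C (bproj B \<cdot> p 0) = P" using is_fiber_powerD(2-4)[OF P, of 0] by simp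
  define u where "u = (\<lambda>i::nat. if i = 0 then a else if i = 1 then b else c)"
  have u: "\<forall>i<3. u i \<in> Hom C (Dom C x) (Dom C (bproj B))"
    "\<forall>i<3. \<forall>j<3. bproj B \<cdot> u i = bproj B \<cdot> u j"
    using overD[OF assms(1)] overD[OF assms(2)] overD[OF assms(3)] by (simp_all add: u_def)
  define h where "h = ftuple C 3 P p u"
  have h: "h \<in> Ar C" "Dom C h = Dom C x" "Cod C h = P"
    using ftuple_simps(1)[OF P _ u] by (simp_all add: h_def)
  have h': "p 0 \<cdot> h = a" "p 1 \<cdot> h = b" "p 2 \<cdot> h = c"
    using ftuple_simps(2)[OF P _ u, of 0] ftuple_simps(2)[OF P _ u, of 1]
      ftuple_simps(2)[OF P _ u, of 2] by (simp_all add: h_def u_def)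
  note s = bsum_over[OF p(1,2)] bsum_over[OF p(2,3)]
  have "bsum C B (bsum C B (p 0) (p 1)) (p 2) \<cdot> h = bsum C B (bsum C B a b) c"
    "bsum C B (p 0) (bsum C B (p 1) (p 2)) \<cdot> h = bsum C B a (bsum C B b c)"
    using bsum_Comp[OF s(1) p(3), of h] bsum_Comp[OF p(1) s(2), of h]
      bsum_Comp[OF p(1,2), of h] bsum_Comp[OF p(2,3), of h] h h' P' by simp_all
  then show ?thesis using e by simp
qed

lemma bsum_neg_ex:
  assumes "a \<in> over x"
  shows "\<exists>b \<in> over x. bsum C B b a = bzero B \<cdot> x"
proof -
  obtain n where n: "is_bneg C B n" using badd_neg by blast
  then have n: "n \<in> Ar C" "Dom C n = tot B" "Cod C n = tot B" "bproj B \<cdot> n = bproj B"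
    "bsum C B (ide C (tot B)) n = bzero B \<cdot> bproj B" by (simp_all add: is_bneg_def)
  note a = overD[OF assms]
  have o: "ide C (tot B) \<in> over (bproj B)" "n \<in> over (bproj B)"
    using n by (simp_all add: over_def)
  have na: "n \<cdot> a \<in> over x" using over_Comp[OF o(2), of a] a by simp
  have "bsum C B a (n \<cdot> a) = bzero B \<cdot> x"
    using bsum_Comp[OF o, of a] n a by simp
  then have "bsum C B (n \<cdot> a) a = bzero B \<cdot> x" unfolding bsum_commute[OF na assms] .
  then show ?thesis using na by blast
qed

lemma bzero_over_mem: "x \<in> Ar C \<Longrightarrow> Cod C x = base B \<Longrightarrow> bzero B \<cdot> x \<in> over x"
  by (simp add: over_def)

lemma bzero_bsum: "a \<in> over x \<Longrightarrow> bsum C B (bzero B \<cdot> x) a = a"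
  using bsum_commute[of "bzero B \<cdot> x" x a] bzero_over_mem[of x] bsum_bzero[of a x]
    overD(5,6)[of a x] by simp

lemma bsum_left_cancel:
  assumes "a \<in> over x" "b \<in> over x" "c \<in> over x" "bsum C B a b = bsum C B a c"
  shows "b = c"
proof -
  obtain n where n: "n \<in> over x" "bsum C B n a = bzero B \<cdot> x" using bsum_neg_ex[OF assms(1)] by blast
  then show ?thesis
    using bsum_assoc[OF n(1) assms(1,2)] bsum_assoc[OF n(1) assms(1,3)] bzero_bsum assms by metis
qed

text \<open>Cancellation in a group. Together with additivity it shows that scalar multiplication
  fixes the zero.\<close>

lemma bsum_idem:
  assumes "a \<in> over x" "bsum C B a a = a"
  shows "a = bzero B \<cdot> x"
  using bsum_left_cancel[OF assms(1,1) bzero_over_mem[OF overD(5,6)[OF assms(1)]]]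
    bsum_bzero[OF assms(1)] assms(2) by simp

text \<open>Only carrier, addition and zero of \<open>M\<close> are prescribed, so that it applies
  to a module record whatever its other fields are.\<close>

lemma abelian_group_over:
  assumes "x \<in> Ar C" "Cod C x = base B"
    and M: "carrier M = over x" "add M = bsum C B" "\<zero>\<^bsub>M\<^esub> = bzero B \<cdot> x"
  shows "abelian_group M"
proof (rule abelian_groupI, unfold M)
  fix a b assume "a \<in> over x" "b \<in> over x"
  then show "bsum C B a b \<in> over x" by (rule bsum_over)
next
  fix a b c assume "a \<in> over x" "b \<in> over x" "c \<in> over x"
  then show "bsum C B (bsum C B a b) c = bsum C B a (bsum C B b c)" by (rule bsum_assoc)
next
  fix a b assume "a \<in> over x" "b \<in> over x"
  then show "bsum C B a b = bsum C B b a" by (rule bsum_commute)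
qed (use bzero_over_mem[OF assms(1,2)] bsum_neg_ex bzero_bsum in simp_all)

text \<open>The difference is characterized by the sum that it solves; with this, later computations
  need no rules for negation.\<close>

lemma bminus_bpair:
  assumes "a \<in> over x" "b \<in> over x"
  shows "bminus C B \<cdot> bpair C B a b \<in> over x" "bsum C B (bminus C B \<cdot> bpair C B a b) b = a"
proof -
  \<comment> \<open>\<open>bneg\<close> is a definite description, so its properties are available
    only once negations are known to be unique.\<close>
  have uniq: "n = n'" if "is_bneg C B n" "is_bneg C B n'" for n n'
  proof -
    have o: "ide C (tot B) \<in> over (bproj B)" "n \<in> over (bproj B)" "n' \<in> over (bproj B)"
      using that by (simp_all add: over_def is_bneg_def)
    have "bsum C B (ide C (tot B)) n = bsum C B (ide C (tot B)) n'"
      using that by (simp add: is_bneg_def)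
    then show ?thesis by (rule bsum_left_cancel[OF o])
  qed
  have "is_bneg C B (bneg C B)"
    unfolding bneg_def using badd_neg uniq by (metis theI')
  then have n: "bneg C B \<in> Ar C" "Dom C (bneg C B) = tot B" "Cod C (bneg C B) = tot B"
    "bproj B \<cdot> bneg C B = bproj B"
    "bsum C B (ide C (tot B)) (bneg C B) = bzero B \<cdot> bproj B" by (simp_all add: is_bneg_def)
  have o: "ide C (tot B) \<in> over (bproj B)" "bneg C B \<in> over (bproj B)"
    using n by (simp_all add: over_def)
  note b = overD[OF assms(2)]
  have nb: "bneg C B \<cdot> b \<in> over x" using over_Comp[OF o(2), of b] b by simp
  have s: "bsum C B b (bneg C B \<cdot> b) = bzero B \<cdot> x"
    using bsum_Comp[OF o, of b] n b by simp
  note p = bpair_simps[OF assms]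
  have q: "bpr B 0 \<in> over (bproj B \<cdot> bpr B 1)" "bpr B 1 \<in> over (bproj B \<cdot> bpr B 1)"
    by (simp_all add: over_def bproj_bpr)
  have "bneg C B \<cdot> bpr B 1 \<in> over (bproj B \<cdot> bpr B 1)"
    using over_Comp[OF o(2), of "bpr B 1"] by simp
  then have e: "bminus C B \<cdot> bpair C B a b = bsum C B a (bneg C B \<cdot> b)"
    unfolding bminus_def using bsum_Comp[OF q(1), of "bneg C B \<cdot> bpr B 1" "bpair C B a b"] p n
    by simp
  show "bminus C B \<cdot> bpair C B a b \<in> over x" unfolding e by (rule bsum_over[OF assms(1) nb])
  have "bsum C B (bsum C B a (bneg C B \<cdot> b)) b = bsum C B a (bsum C B b (bneg C B \<cdot> b))"
    using bsum_assoc[OF assms(1) nb assms(2)] bsum_commute[OF nb assms(2)] by simp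
  then show "bsum C B (bminus C B \<cdot> bpair C B a b) b = a"
    unfolding e using s bsum_bzero[OF assms(1)] by simp
qed

end

section \<open>The tangent functor on generalized elements\<close>

context rosicky_tangent_category
begin

lemma tangent_bundle_simps [simp]:
  "tot (tangent_bundle C X) = TO C X" "base (tangent_bundle C X) = X"
  "bproj (tangent_bundle C X) = Tproj C X" "tot2 (tangent_bundle C X) = Tk C 2 X"
  "bpr (tangent_bundle C X) = Tpr C 2 X" "badd (tangent_bundle C X) = Tplus C X"
  "bzero (tangent_bundle C X) = Tzero C X"
  by (simp_all add: tangent_bundle_def)

lemma slice_tangent: "X \<in> Ob C \<Longrightarrow> slice_ab_group C (tangent_bundle C X)"
  by (intro slice_ab_group.intro category_axioms tangent_ab_group)

lemma TO_Ob [simp]: "X \<in> Ob C \<Longrightarrow> TO C X \<in> Ob C"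
  by (rule TO_closed)

lemma TA_simps [simp]:
  assumes "f \<in> Ar C"
  shows "TA C f \<in> Ar C" "Dom C (TA C f) = TO C (Dom C f)" "Cod C (TA C f) = TO C (Cod C f)"
  using TA_closed[of f "Dom C f" "Cod C f"] assms by simp_all

lemma TA_ide_simp [simp]: "X \<in> Ob C \<Longrightarrow> TA C (ide C X) = ide C (TO C X)"
  by (rule TA_ide)

lemma TA_Comp_simp [simp]:
  "f \<in> Ar C \<Longrightarrow> g \<in> Ar C \<Longrightarrow> Cod C f = Dom C g \<Longrightarrow> TA C (g \<cdot> f) = TA C g \<cdot> TA C f"
  using TA_Comp[of f "Dom C f" "Dom C g" g "Cod C g"] by simp

lemma structure_simps [simp]:
  assumes "X \<in> Ob C"
  shows "Tproj C X \<in> Ar C" "Dom C (Tproj C X) = TO C X" "Cod C (Tproj C X) = X"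
    "Tzero C X \<in> Ar C" "Dom C (Tzero C X) = X" "Cod C (Tzero C X) = TO C X"
    "Tplus C X \<in> Ar C" "Dom C (Tplus C X) = Tk C 2 X" "Cod C (Tplus C X) = TO C X"
    "Tlift C X \<in> Ar C" "Dom C (Tlift C X) = TO C X" "Cod C (Tlift C X) = TO C (TO C X)"
    "Tflip C X \<in> Ar C" "Dom C (Tflip C X) = TO C (TO C X)" "Cod C (Tflip C X) = TO C (TO C X)"
  using Tproj_closed[OF assms] Tzero_closed[OF assms] Tplus_closed[OF assms] Tlift_closed[OF assms]
    Tflip_closed[OF assms] by simp_all

text \<open>The naturality rules are oriented so that projections move to the right, and zeros,
  flips and lifts to the left. Each has a form that ends in a further arrow, because composites
  associate to the right.\<close>

lemma Tproj_TA [simp]: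
  assumes "f \<in> Ar C" "Cod C f = Y"
  shows "Tproj C Y \<cdot> TA C f = f \<cdot> Tproj C (Dom C f)"
    and "a \<in> Ar C \<Longrightarrow> Cod C a = TO C (Dom C f) \<Longrightarrow> Tproj C Y \<cdot> TA C f \<cdot> a = f \<cdot> Tproj C (Dom C f) \<cdot> a"
proof -
  show *: "Tproj C Y \<cdot> TA C f = f \<cdot> Tproj C (Dom C f)"
    using Tproj_natural[of f "Dom C f" Y] assms by simp
  have Y: "Y \<in> Ob C" using assms by auto
  show "Tproj C Y \<cdot> TA C f \<cdot> a = f \<cdot> Tproj C (Dom C f) \<cdot> a"
    if "a \<in> Ar C" "Cod C a = TO C (Dom C f)"
    by (rule Comp_cong_right[OF *]) (use that assms Y in simp_all)
qed

lemma TA_Tzero [simp]: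
  assumes "f \<in> Ar C" "Dom C f = X"
  shows "TA C f \<cdot> Tzero C X = Tzero C (Cod C f) \<cdot> f"
    and "a \<in> Ar C \<Longrightarrow> Cod C a = X \<Longrightarrow> TA C f \<cdot> Tzero C X \<cdot> a = Tzero C (Cod C f) \<cdot> f \<cdot> a"
proof -
  show *: "TA C f \<cdot> Tzero C X = Tzero C (Cod C f) \<cdot> f"
    using Tzero_natural[of f X "Cod C f"] assms by simp
  have X: "X \<in> Ob C" using assms by auto
  show "TA C f \<cdot> Tzero C X \<cdot> a = Tzero C (Cod C f) \<cdot> f \<cdot> a"
    if "a \<in> Ar C" "Cod C a = X"
    by (rule Comp_cong_right[OF *]) (use that assms X in simp_all)
qed

lemma TA_Tflip [simp]:
  assumes "f \<in> Ar C" "Dom C f = X" "a \<in> Ar C" "Cod C a = TO C (TO C X)"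
  shows "TA C (TA C f) \<cdot> Tflip C X \<cdot> a = Tflip C (Cod C f) \<cdot> TA C (TA C f) \<cdot> a"
proof -
  have X: "X \<in> Ob C" using assms by auto
  show ?thesis
    by (rule Comp_cong_right[OF Tflip_natural[of f X "Cod C f", symmetric]]) (use assms X in simp_all)
qed

lemma TA_Tlift [simp]:
  assumes "f \<in> Ar C" "Dom C f = X" "a \<in> Ar C" "Cod C a = TO C X"
  shows "TA C (TA C f) \<cdot> Tlift C X \<cdot> a = Tlift C (Cod C f) \<cdot> TA C f \<cdot> a"
proof -
  have X: "X \<in> Ob C" using assms by auto
  show ?thesis
    by (rule Comp_cong_right[OF Tlift_natural[of f X "Cod C f", symmetric]]) (use assms X in simp_all)
qed

lemma Tproj_Tzero [simp]:
  assumes "X \<in> Ob C"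
  shows "Tproj C X \<cdot> Tzero C X = ide C X"
    and "a \<in> Ar C \<Longrightarrow> Cod C a = X \<Longrightarrow> Tproj C X \<cdot> Tzero C X \<cdot> a = a"
    and "b \<in> Ar C \<Longrightarrow> Cod C b = TO C X \<Longrightarrow> TA C (Tproj C X) \<cdot> TA C (Tzero C X) \<cdot> b = b"
proof -
  interpret slice_ab_group C "tangent_bundle C X" by (rule slice_tangent[OF assms])
  show *: "Tproj C X \<cdot> Tzero C X = ide C X" using bzero_over by simp
  show "Tproj C X \<cdot> Tzero C X \<cdot> a = a" if "a \<in> Ar C" "Cod C a = X"
    using bproj_bzero[of a] that by simp
  have "TA C (Tproj C X) \<cdot> TA C (Tzero C X) = ide C (TO C X)"
    using TA_Comp_simp[of "Tzero C X" "Tproj C X"] * assms by simp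
  from Comp_eq_right[OF this, of b]
  show "TA C (Tproj C X) \<cdot> TA C (Tzero C X) \<cdot> b = b" if "b \<in> Ar C" "Cod C b = TO C X"
    using that assms by simp
qed

lemma Tflip_Tflip_simp [simp]:
  assumes "X \<in> Ob C" "a \<in> Ar C" "Cod C a = TO C (TO C X)"
  shows "Tflip C X \<cdot> Tflip C X \<cdot> a = a"
  using Comp_eq_right[OF Tflip_Tflip[OF assms(1)] assms(2)] assms by simp

lemma Tproj_Tflip_simp [simp]:
  assumes "X \<in> Ob C" "a \<in> Ar C" "Cod C a = TO C (TO C X)"
  shows "Tproj C (TO C X) \<cdot> Tflip C X \<cdot> a = TA C (Tproj C X) \<cdot> a"
  using Comp_eq_right[OF Tproj_Tflip[OF assms(1)] assms(2)] assms by simp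

text \<open>The flip is an involution, so the law for the other projection can be read
  backwards.\<close>

lemma TA_Tproj_Tflip [simp]:
  assumes "X \<in> Ob C" "a \<in> Ar C" "Cod C a = TO C (TO C X)"
  shows "TA C (Tproj C X) \<cdot> Tflip C X \<cdot> a = Tproj C (TO C X) \<cdot> a"
  using Tproj_Tflip_simp[of X "Tflip C X \<cdot> a"] assms by simp

lemma Tflip_Tlift_simp [simp]:
  assumes "X \<in> Ob C" "a \<in> Ar C" "Cod C a = TO C X"
  shows "Tflip C X \<cdot> Tlift C X \<cdot> a = Tlift C X \<cdot> a"
  using Comp_eq_right[OF Tflip_Tlift[OF assms(1)] assms(2)] assms by simp

lemma Tproj_Tlift_simp [simp]:
  assumes "X \<in> Ob C" "a \<in> Ar C" "Cod C a = TO C X"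
  shows "Tproj C (TO C X) \<cdot> Tlift C X \<cdot> a = Tzero C X \<cdot> Tproj C X \<cdot> a"
  by (rule Comp_cong_right[OF Tproj_Tlift[OF assms(1)]]) (use assms in simp_all)

text \<open>The flip fixes the lift and exchanges the two projections of the double tangent bundle,
  so the law for one projection yields the other.\<close>

lemma TA_Tproj_Tlift [simp]:
  assumes "X \<in> Ob C" "a \<in> Ar C" "Cod C a = TO C X"
  shows "TA C (Tproj C X) \<cdot> Tlift C X \<cdot> a = Tzero C X \<cdot> Tproj C X \<cdot> a"
  using Tproj_Tflip_simp[of X "Tlift C X \<cdot> a"] assms by simp

lemma Tpr_simps:
  assumes "X \<in> Ob C"
  shows "Tpr C 2 X 0 \<in> Ar C" "Dom C (Tpr C 2 X 0) = Tk C 2 X" "Cod C (Tpr C 2 X 0) = TO C X"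
    "Tpr C 2 X 1 \<in> Ar C" "Dom C (Tpr C 2 X 1) = Tk C 2 X" "Cod C (Tpr C 2 X 1) = TO C X"
    "Tproj C X \<cdot> Tpr C 2 X 0 = Tproj C X \<cdot> Tpr C 2 X 1"
proof -
  interpret S: slice_ab_group C "tangent_bundle C X" by (rule slice_tangent[OF assms])
  show "Tpr C 2 X 0 \<in> Ar C" "Dom C (Tpr C 2 X 0) = Tk C 2 X" "Cod C (Tpr C 2 X 0) = TO C X"
    "Tpr C 2 X 1 \<in> Ar C" "Dom C (Tpr C 2 X 1) = Tk C 2 X" "Cod C (Tpr C 2 X 1) = TO C X"
    "Tproj C X \<cdot> Tpr C 2 X 0 = Tproj C X \<cdot> Tpr C 2 X 1"
    using S.bpr_simps[of 0] S.bpr_simps[of 1] S.bproj_bpr by simp_all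
qed

lemma Tpair_simps:
  assumes "X \<in> Ob C" "a \<in> Ar C" "b \<in> Ar C" "Cod C a = TO C X" "Cod C b = TO C X"
    "Tproj C X \<cdot> a = Tproj C X \<cdot> b"
  shows "Tpair C X a b \<in> Ar C" "Dom C (Tpair C X a b) = Dom C a" "Cod C (Tpair C X a b) = Tk C 2 X"
    "Tpr C 2 X 0 \<cdot> Tpair C X a b = a" "Tpr C 2 X 1 \<cdot> Tpair C X a b = b"
    "c \<in> Ar C \<Longrightarrow> Cod C c = Dom C a \<Longrightarrow> Tpair C X a b \<cdot> c = Tpair C X (a \<cdot> c) (b \<cdot> c)"
proof -
  interpret S: slice_ab_group C "tangent_bundle C X" by (rule slice_tangent[OF assms(1)])
  have o: "a \<in> S.over (Tproj C X \<cdot> a)" "b \<in> S.over (Tproj C X \<cdot> a)"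
    using S.overI[of a] S.overI[of b] assms by simp_all
  show "Tpair C X a b \<in> Ar C" "Dom C (Tpair C X a b) = Dom C a" "Cod C (Tpair C X a b) = Tk C 2 X"
    "Tpr C 2 X 0 \<cdot> Tpair C X a b = a" "Tpr C 2 X 1 \<cdot> Tpair C X a b = b"
    using S.bpair_simps[OF o] S.overD(2)[OF o(1)] by simp_all
  show "Tpair C X a b \<cdot> c = Tpair C X (a \<cdot> c) (b \<cdot> c)" if "c \<in> Ar C" "Cod C c = Dom C a"
    using S.bpair_Comp[OF o that(1)] S.overD(2)[OF o(1)] that by simp
qed

lemma Tsum_simps [simp]:
  assumes "X \<in> Ob C" "a \<in> Ar C" "b \<in> Ar C" "Cod C a = TO C X" "Cod C b = TO C X"
    "Tproj C X \<cdot> a = Tproj C X \<cdot> b"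
  shows "Tsum C X a b \<in> Ar C" "Dom C (Tsum C X a b) = Dom C a" "Cod C (Tsum C X a b) = TO C X"
    "Tproj C X \<cdot> Tsum C X a b = Tproj C X \<cdot> b"
    "c \<in> Ar C \<Longrightarrow> Cod C c = Dom C a \<Longrightarrow> Tsum C X a b \<cdot> c = Tsum C X (a \<cdot> c) (b \<cdot> c)"
proof -
  interpret S: slice_ab_group C "tangent_bundle C X" by (rule slice_tangent[OF assms(1)])
  have o: "a \<in> S.over (Tproj C X \<cdot> a)" "b \<in> S.over (Tproj C X \<cdot> a)"
    using S.overI[of a] S.overI[of b] assms by simp_all
  show "Tsum C X a b \<in> Ar C" "Dom C (Tsum C X a b) = Dom C a" "Cod C (Tsum C X a b) = TO C X"
    "Tproj C X \<cdot> Tsum C X a b = Tproj C X \<cdot> b"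
    using S.overD[OF S.bsum_over[OF o]] S.overD(2)[OF o(1)] assms(6) by simp_all
  show "Tsum C X a b \<cdot> c = Tsum C X (a \<cdot> c) (b \<cdot> c)" if "c \<in> Ar C" "Cod C c = Dom C a"
    using S.bsum_Comp[OF o that(1)] S.overD(2)[OF o(1)] that by simp
qed

lemma Tsum_commute:
  assumes "X \<in> Ob C" "a \<in> Ar C" "b \<in> Ar C" "Cod C a = TO C X" "Cod C b = TO C X"
    "Tproj C X \<cdot> a = Tproj C X \<cdot> b"
  shows "Tsum C X a b = Tsum C X b a"
proof -
  interpret S: slice_ab_group C "tangent_bundle C X" by (rule slice_tangent[OF assms(1)])
  show ?thesis
    by (rule S.bsum_commute) (use S.overI[of a] S.overI[of b] assms in simp_all)
qed

lemma Tsum_Tzero: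
  assumes "X \<in> Ob C" "a \<in> Ar C" "Cod C a = TO C X" "Tproj C X \<cdot> a = x"
  shows "Tsum C X a (Tzero C X \<cdot> x) = a" "Tsum C X (Tzero C X \<cdot> x) a = a"
proof -
  interpret S: slice_ab_group C "tangent_bundle C X" by (rule slice_tangent[OF assms(1)])
  have a: "a \<in> S.over x" using S.overI[of a] assms by simp
  show "Tsum C X a (Tzero C X \<cdot> x) = a" "Tsum C X (Tzero C X \<cdot> x) a = a"
    using S.bsum_bzero[OF a] S.bzero_bsum[OF a] by simp_all
qed

lemma Tsum_left_cancel:
  assumes "X \<in> Ob C" "a \<in> Ar C" "b \<in> Ar C" "c \<in> Ar C"
    "Cod C a = TO C X" "Cod C b = TO C X" "Cod C c = TO C X"
    "Tproj C X \<cdot> a = Tproj C X \<cdot> b" "Tproj C X \<cdot> a = Tproj C X \<cdot> c"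
    "Tsum C X a b = Tsum C X a c"
  shows "b = c"
proof -
  interpret S: slice_ab_group C "tangent_bundle C X" by (rule slice_tangent[OF assms(1)])
  show ?thesis
    by (rule S.bsum_left_cancel[of a "Tproj C X \<cdot> a"])
      (use S.overI[of a] S.overI[of b] S.overI[of c] assms in simp_all)
qed

text \<open>Cancellation of \<open>b\<close>. With \<open>a = b\<close> it says that an idempotent
  is zero, which is how additive morphisms are seen to preserve zeros; in \<open>vf_bracket\<close>
  it shows that a difference has vanishing projection.\<close>

lemma Tsum_eq_right:
  assumes "X \<in> Ob C" "a \<in> Ar C" "b \<in> Ar C" "Cod C a = TO C X" "Cod C b = TO C X"
    "Tproj C X \<cdot> a = Tproj C X \<cdot> b" "Tsum C X a b = b"
  shows "a = Tzero C X \<cdot> Tproj C X \<cdot> b"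
proof -
  have "Tsum C X b a = Tsum C X b (Tzero C X \<cdot> Tproj C X \<cdot> b)"
    using Tsum_commute[OF assms(1-6)] Tsum_Tzero(1)[OF assms(1,3,5) refl] assms(7) by metis
  then show ?thesis
    by (rule Tsum_left_cancel[rotated -1]) (use assms in simp_all)
qed

lemma TA_Tsum [simp]:
  assumes "f \<in> Ar C" "Dom C f = X" "a \<in> Ar C" "b \<in> Ar C" "Cod C a = TO C X" "Cod C b = TO C X"
    "Tproj C X \<cdot> a = Tproj C X \<cdot> b"
  shows "TA C f \<cdot> Tsum C X a b = Tsum C (Cod C f) (TA C f \<cdot> a) (TA C f \<cdot> b)"
proof -
  have X: "X \<in> Ob C" using assms by auto
  note p = Tpair_simps[OF X assms(3-7)]
  note q = Tpr_simps[OF X]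
  have "TA C f \<cdot> Tplus C X = Tsum C (Cod C f) (TA C f \<cdot> Tpr C 2 X 0) (TA C f \<cdot> Tpr C 2 X 1)"
    using Tplus_natural[of f X "Cod C f"] assms by (simp add: bsum_def)
  from Comp_eq_right[OF this, of "Tpair C X a b"]
  have "TA C f \<cdot> Tsum C X a b =
      Tsum C (Cod C f) (TA C f \<cdot> Tpr C 2 X 0) (TA C f \<cdot> Tpr C 2 X 1) \<cdot> Tpair C X a b"
    using p X assms by (simp add: bsum_def)
  also have "\<dots> = Tsum C (Cod C f) (TA C f \<cdot> a) (TA C f \<cdot> b)"
    using p q X assms by simp
  finally show ?thesis .
qed

lemma Tlift_Tsum [simp]:
  assumes "X \<in> Ob C" "a \<in> Ar C" "b \<in> Ar C" "Cod C a = TO C X" "Cod C b = TO C X"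
    "Tproj C X \<cdot> a = Tproj C X \<cdot> b"
  shows "Tlift C X \<cdot> Tsum C X a b = Tsum C (TO C X) (Tlift C X \<cdot> a) (Tlift C X \<cdot> b)"
proof -
  note p = Tpair_simps[OF assms]
  note q = Tpr_simps[OF assms(1)]
  have "Tlift C X \<cdot> Tplus C X = Tsum C (TO C X) (Tlift C X \<cdot> Tpr C 2 X 0) (Tlift C X \<cdot> Tpr C 2 X 1)"
    using Tplus_Tlift[OF assms(1)] by (simp add: bsum_def)
  from Comp_eq_right[OF this, of "Tpair C X a b"]
  have "Tlift C X \<cdot> Tsum C X a b =
      Tsum C (TO C X) (Tlift C X \<cdot> Tpr C 2 X 0) (Tlift C X \<cdot> Tpr C 2 X 1) \<cdot> Tpair C X a b"
    using p assms by (simp add: bsum_def)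
  also have "\<dots> = Tsum C (TO C X) (Tlift C X \<cdot> a) (Tlift C X \<cdot> b)"
    using p q assms by simp
  finally show ?thesis .
qed

lemma Tlift_Tzero [simp]:
  assumes "X \<in> Ob C" "a \<in> Ar C" "Cod C a = X"
  shows "Tlift C X \<cdot> Tzero C X \<cdot> a = Tzero C (TO C X) \<cdot> Tzero C X \<cdot> a"
proof -
  have "Tsum C X (Tzero C X \<cdot> a) (Tzero C X \<cdot> a) = Tzero C X \<cdot> a"
    using Tsum_Tzero(1)[of X "Tzero C X \<cdot> a" a] assms by simp
  then have "Tsum C (TO C X) (Tlift C X \<cdot> Tzero C X \<cdot> a) (Tlift C X \<cdot> Tzero C X \<cdot> a) =
      Tlift C X \<cdot> Tzero C X \<cdot> a"
    using Tlift_Tsum[of X "Tzero C X \<cdot> a" "Tzero C X \<cdot> a"] assms by simp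
  from Tsum_eq_right[OF _ _ _ _ _ _ this] show ?thesis using assms by simp
qed

text \<open>By \<open>Tplus_Tflip\<close> the flip is additive from \<open>TA C (Tproj C X)\<close>,
  with the addition \<open>TA C (Tplus C X)\<close>, to the tangent bundle of \<open>TO C X\<close>.
  The element \<open>TA C (Tzero C X) \<cdot> a\<close> is idempotent for the first addition, so its
  image is idempotent for the second and hence zero.\<close>

lemma Tflip_TA_Tzero [simp]:
  assumes "X \<in> Ob C" "a \<in> Ar C" "Cod C a = TO C X"
  shows "Tflip C X \<cdot> TA C (Tzero C X) \<cdot> a = Tzero C (TO C X) \<cdot> a"
proof -
  obtain P p where P: "is_fiber_power C 2 (TA C (Tproj C X)) P p"
    and iso: "is_iso C (Tcomparison C 2 X P p)"
    using Tk_preserved[OF assms(1), of 2] by auto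
  define nu where "nu = Tcomparison C 2 X P p"
  \<comment> \<open>The pair of two zeros: differentiating the law that zero plus zero is zero makes
    \<open>TA C (Tzero C X)\<close> idempotent.\<close>
  define z where "z = Tpair C X (Tzero C X) (Tzero C X)"
  have z: "z \<in> Ar C" "Dom C z = X" "Cod C z = Tk C 2 X" "Tpr C 2 X 0 \<cdot> z = Tzero C X"
    "Tpr C 2 X 1 \<cdot> z = Tzero C X"
    using Tpair_simps[of X "Tzero C X" "Tzero C X"] assms by (simp_all add: z_def)
  have pz: "Tplus C X \<cdot> z = Tzero C X"
    using Tsum_Tzero(1)[of X "Tzero C X" "ide C X"] assms by (simp add: bsum_def z_def)
  note pr = Tpr_simps[OF assms(1)]
  have i2: "i = 0 \<or> i = 1" if "i < 2" for i :: nat using that by linarith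
  have Tpr: "\<forall>i<2. TA C (Tpr C 2 X i) \<in> Hom C (TO C (Tk C 2 X)) (Dom C (TA C (Tproj C X)))"
    using pr assms by (auto dest!: i2)
  have "TA C (Tproj C X) \<cdot> TA C (Tpr C 2 X 0) = TA C (Tproj C X) \<cdot> TA C (Tpr C 2 X 1)"
    using pr assms by (simp flip: TA_Comp_simp)
  then have e: "\<forall>i<2. \<forall>j<2. TA C (Tproj C X) \<cdot> TA C (Tpr C 2 X i) =
      TA C (Tproj C X) \<cdot> TA C (Tpr C 2 X j)"
    using i2 by metis
  have nu: "nu \<in> Ar C" "Dom C nu = TO C (Tk C 2 X)" "Cod C nu = P"
    using ftuple_simps(1)[OF P _ Tpr e] by (simp_all add: nu_def Tcomparison_def)
  have pnu: "p 0 \<cdot> nu = TA C (Tpr C 2 X 0)" "p 1 \<cdot> nu = TA C (Tpr C 2 X 1)"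
    using ftuple_simps(2)[OF P _ Tpr e, of 0] ftuple_simps(2)[OF P _ Tpr e, of 1]
    by (simp_all add: nu_def Tcomparison_def)
  note ps = is_fiber_powerD[OF P]
  have p: "p 0 \<in> Ar C" "Dom C (p 0) = P" "Cod C (p 0) = TO C (TO C X)"
    "p 1 \<in> Ar C" "Dom C (p 1) = P" "Cod C (p 1) = TO C (TO C X)"
    "TA C (Tproj C X) \<cdot> p 0 = TA C (Tproj C X) \<cdot> p 1"
    using ps(2-4)[of 0] ps(2-4)[of 1] ps(5)[of 0 1] assms by simp_all
  \<comment> \<open>The pair with both components \<open>TA C (Tzero C X) \<cdot> a\<close>, written
    as an image under \<open>nu\<close> so that the inverse of \<open>nu\<close> in
    \<open>Tplus_Tflip\<close> cancels.\<close>
  define u where "u = nu \<cdot> TA C z \<cdot> a"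
  have u: "u \<in> Ar C" "Dom C u = Dom C a" "Cod C u = P"
    using nu z assms by (simp_all add: u_def)
  have pu: "p 0 \<cdot> u = TA C (Tzero C X) \<cdot> a" "p 1 \<cdot> u = TA C (Tzero C X) \<cdot> a"
  proof -
    have "p 0 \<cdot> nu \<cdot> TA C z \<cdot> a = TA C (Tpr C 2 X 0) \<cdot> TA C z \<cdot> a"
      by (rule Comp_eq_right[OF pnu(1)]) (use nu z assms p in simp_all)
    also have "\<dots> = TA C (Tzero C X) \<cdot> a"
      by (rule Comp_eq_right) (use z pr assms in \<open>simp_all flip: TA_Comp_simp\<close>)
    finally show "p 0 \<cdot> u = TA C (Tzero C X) \<cdot> a" by (simp add: u_def)
    have "p 1 \<cdot> nu \<cdot> TA C z \<cdot> a = TA C (Tpr C 2 X 1) \<cdot> TA C z \<cdot> a"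
      by (rule Comp_eq_right[OF pnu(2)]) (use nu z assms p in simp_all)
    also have "\<dots> = TA C (Tzero C X) \<cdot> a"
      by (rule Comp_eq_right) (use z pr assms in \<open>simp_all flip: TA_Comp_simp\<close>)
    finally show "p 1 \<cdot> u = TA C (Tzero C X) \<cdot> a" by (simp add: u_def)
  qed
  note inv = inv_ar_simps[OF iso[folded nu_def]] and canc = Comp_cancel_inv[OF iso[folded nu_def]]
  have "Tsum C (TO C X) (Tflip C X \<cdot> p 0) (Tflip C X \<cdot> p 1) =
      Tflip C X \<cdot> TA C (Tplus C X) \<cdot> inv_ar C nu"
    using Tplus_Tflip[OF assms(1) P] by (simp add: bsum_def nu_def)
  then have "Tsum C (TO C X) (Tflip C X \<cdot> p 0) (Tflip C X \<cdot> p 1) \<cdot> u =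
      (Tflip C X \<cdot> TA C (Tplus C X) \<cdot> inv_ar C nu) \<cdot> u"
    by simp
  moreover have "Tsum C (TO C X) (Tflip C X \<cdot> p 0) (Tflip C X \<cdot> p 1) \<cdot> u =
      Tsum C (TO C X) (Tflip C X \<cdot> TA C (Tzero C X) \<cdot> a) (Tflip C X \<cdot> TA C (Tzero C X) \<cdot> a)"
    using Tsum_simps(5)[of "TO C X" "Tflip C X \<cdot> p 0" "Tflip C X \<cdot> p 1" u] p u pu assms by simp
  moreover have "(Tflip C X \<cdot> TA C (Tplus C X) \<cdot> inv_ar C nu) \<cdot> u =
      Tflip C X \<cdot> TA C (Tplus C X) \<cdot> TA C z \<cdot> a"
    using canc(1)[of "TA C z \<cdot> a"] inv(1-4) nu z u assms by (simp add: u_def)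
  moreover have "TA C (Tplus C X) \<cdot> TA C z \<cdot> a = TA C (Tzero C X) \<cdot> a"
    by (rule Comp_eq_right) (use z pz assms in \<open>simp_all flip: TA_Comp_simp\<close>)
  ultimately have "Tsum C (TO C X) (Tflip C X \<cdot> TA C (Tzero C X) \<cdot> a)
      (Tflip C X \<cdot> TA C (Tzero C X) \<cdot> a) = Tflip C X \<cdot> TA C (Tzero C X) \<cdot> a"
    by simp
  from Tsum_eq_right[OF _ _ _ _ _ _ this] show ?thesis using assms by simp
qed

end

section \<open>The vertical lift and the existence of the bracket\<close>

context rosicky_tangent_category
begin

text \<open>This is \<open>Tlift_pullback\<close> with the two pairs into \<open>Tk C 2 X\<close>
  resolved into their components.\<close>

lemma Tlift_universal:
  assumes "X \<in> Ob C" "m \<in> Ar C" "Cod C m = TO C (TO C X)" "x \<in> Ar C" "Cod C x = X"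
    "Tproj C (TO C X) \<cdot> m = Tzero C X \<cdot> x" "TA C (Tproj C X) \<cdot> m = Tzero C X \<cdot> x"
  shows "\<exists>!u. u \<in> Hom C (Dom C x) (TO C X) \<and> Tlift C X \<cdot> u = m \<and> Tproj C X \<cdot> u = x"
proof -
  have "Dom C (Tproj C (TO C X) \<cdot> m) = Dom C (Tzero C X \<cdot> x)" using assms(6) by simp
  then have D: "Dom C m = Dom C x" using assms(1-5) by simp
  have "Tproj C X \<cdot> Tproj C (TO C X) = Tproj C X \<cdot> TA C (Tproj C X)" using assms by simp
  note p = Tpair_simps[OF assms(1) _ _ _ _ this]
  have "Tproj C X \<cdot> Tzero C X = Tproj C X \<cdot> Tzero C X" by simp
  note z = Tpair_simps[OF assms(1) _ _ _ _ this]
  have U: "\<And>Z u v. u \<in> Hom C Z (TO C (TO C X)) \<Longrightarrow> v \<in> Hom C Z X \<Longrightarrow>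
      Tpair C X (Tproj C (TO C X)) (TA C (Tproj C X)) \<cdot> u =
      Tpair C X (Tzero C X) (Tzero C X) \<cdot> v \<Longrightarrow>
      \<exists>!h. h \<in> Hom C Z (TO C X) \<and> Tlift C X \<cdot> h = u \<and> Tproj C X \<cdot> h = v"
    using Tlift_pullback[OF assms(1)] p(2) z(2) assms(1) unfolding is_pullback_def by simp
  show ?thesis
    by (rule U) (use p(6)[of m] z(6)[of x] assms D in simp_all)
qed

lemma Tlift2_eq:
  "X \<in> Ob C \<Longrightarrow> Tlift2 C X = Tflip C X \<cdot>
    Tsum C (TO C X) (TA C (Tzero C X) \<cdot> Tpr C 2 X 0) (Tlift C X \<cdot> Tpr C 2 X 1)"
  by (simp add: Tlift2_def bsum_def)

lemma Tlift2_Tpair: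
  assumes "X \<in> Ob C" "w \<in> Ar C" "u \<in> Ar C" "Cod C w = TO C X" "Cod C u = TO C X"
    "Tproj C X \<cdot> w = Tproj C X \<cdot> u"
  shows "Tlift2 C X \<cdot> Tpair C X w u =
    Tflip C X \<cdot> Tsum C (TO C X) (TA C (Tzero C X) \<cdot> w) (Tlift C X \<cdot> u)"
proof -
  note p = Tpair_simps[OF assms]
  note q = Tpr_simps[OF assms(1)]
  show ?thesis unfolding Tlift2_eq[OF assms(1)] using p q assms by simp
qed

lemma vector_fields_iff:
  "v \<in> vector_fields C X \<longleftrightarrow> v \<in> Hom C X (TO C X) \<and> Tproj C X \<cdot> v = ide C X"
  by (simp add: vector_fields_def sections_def)

text \<open>The bracket is a definite description, so existence and uniqueness have to come before
  any other property. Both rest on \<open>Tlift_pullback\<close>. The second claim is the defining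
  equation with its difference moved across, the form to which additive maps apply.\<close>

lemma vf_bracket:
  assumes X: "X \<in> Ob C" and "v \<in> vector_fields C X" "w \<in> vector_fields C X"
  shows "vf_bracket C X v w \<in> vector_fields C X"
    and "Tsum C (TO C X)
        (Tflip C X \<cdot> Tsum C (TO C X) (TA C (Tzero C X) \<cdot> w) (Tlift C X \<cdot> vf_bracket C X v w))
        (Tflip C X \<cdot> TA C v \<cdot> w) = TA C w \<cdot> v"
proof -
  interpret S: slice_ab_group C "tangent_bundle C (TO C X)"
    by (rule slice_tangent) (simp add: X)
  note v = assms(2)[unfolded vector_fields_iff Hom_iff] and w = assms(3)[unfolded vector_fields_iff Hom_iff]
  \<comment> \<open>Subtraction in the tangent bundle of \<open>TO C X\<close> enters only through
    these properties.\<close>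
  have sub: "bminus C (tangent_bundle C (TO C X)) \<cdot> Tpair C (TO C X) a b \<in> Hom C X (TO C (TO C X)) \<and>
      Tproj C (TO C X) \<cdot> bminus C (tangent_bundle C (TO C X)) \<cdot> Tpair C (TO C X) a b =
        Tproj C (TO C X) \<cdot> a \<and>
      Tsum C (TO C X) (bminus C (tangent_bundle C (TO C X)) \<cdot> Tpair C (TO C X) a b) b = a"
    if "a \<in> Hom C X (TO C (TO C X))" "b \<in> Hom C X (TO C (TO C X))"
      "Tproj C (TO C X) \<cdot> a = Tproj C (TO C X) \<cdot> b" for a b
  proof -
    have o: "a \<in> S.over (Tproj C (TO C X) \<cdot> a)" "b \<in> S.over (Tproj C (TO C X) \<cdot> a)"
      using S.overI[of a] S.overI[of b] that by simp_all
    show ?thesis using S.bminus_bpair[OF o] S.overD[OF S.bminus_bpair(1)[OF o]] that X by simp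
  qed
  define d where "d = vf_delta C X v w"
  have vw: "Tproj C X \<cdot> v = ide C X" "Tproj C X \<cdot> w = ide C X" using v w by simp_all
  have vw': "TA C (Tproj C X) \<cdot> TA C v \<cdot> a = a" "TA C (Tproj C X) \<cdot> TA C w \<cdot> a = a"
    if "a \<in> Ar C" "Cod C a = TO C X" for a
    using Comp_eq_right[of "TA C (Tproj C X)" "TA C v" "ide C (TO C X)" a]
      Comp_eq_right[of "TA C (Tproj C X)" "TA C w" "ide C (TO C X)" a] v w X that
    by (simp_all flip: TA_Comp_simp)
  have d: "d \<in> Ar C" "Dom C d = X" "Cod C d = TO C (TO C X)" "Tproj C (TO C X) \<cdot> d = w"
    and dsum: "Tsum C (TO C X) d (Tflip C X \<cdot> TA C v \<cdot> w) = TA C w \<cdot> v"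
    using sub[of "TA C w \<cdot> v" "Tflip C X \<cdot> TA C v \<cdot> w"] v w vw vw' X
    by (simp_all add: d_def vf_delta_def)
  \<comment> \<open>Both \<open>TA C w \<cdot> v\<close> and the flip of
    \<open>TA C v \<cdot> w\<close> are sent to \<open>v\<close> by \<open>TA C (Tproj C X)\<close>,
    so their difference is sent to zero.\<close>
  have Tpd: "TA C (Tproj C X) \<cdot> d = Tzero C X"
  proof -
    have "Tsum C X (TA C (Tproj C X) \<cdot> d) v = v"
      using arg_cong[OF dsum, of "\<lambda>z. TA C (Tproj C X) \<cdot> z"] d v w vw vw' X by simp
    from Tsum_eq_right[OF X _ _ _ _ _ this] show ?thesis using d v vw w X by simp
  qed
  \<comment> \<open>Undoing the flip in \<open>Tlift2\<close> and removing the part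
    \<open>TA C (Tzero C X) \<cdot> w\<close> leaves the element whose preimage under the lift is
    the bracket.\<close>
  define m where "m = bminus C (tangent_bundle C (TO C X)) \<cdot>
    Tpair C (TO C X) (Tflip C X \<cdot> d) (TA C (Tzero C X) \<cdot> w)"
  have m: "m \<in> Ar C" "Dom C m = X" "Cod C m = TO C (TO C X)" "Tproj C (TO C X) \<cdot> m = Tzero C X"
    and msum: "Tsum C (TO C X) m (TA C (Tzero C X) \<cdot> w) = Tflip C X \<cdot> d"
    using sub[of "Tflip C X \<cdot> d" "TA C (Tzero C X) \<cdot> w"] d w vw Tpd X by (simp_all add: m_def)
  have Tpm: "TA C (Tproj C X) \<cdot> m = Tzero C X"
  proof -
    have "Tsum C X (TA C (Tproj C X) \<cdot> m) w = w"
      using arg_cong[OF msum, of "\<lambda>z. TA C (Tproj C X) \<cdot> z"] d m w vw X by simp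
    from Tsum_eq_right[OF X _ _ _ _ _ this] show ?thesis using m w vw X by simp
  qed
  have ex1: "\<exists>!u. u \<in> Hom C X (TO C X) \<and> Tlift C X \<cdot> u = m \<and> Tproj C X \<cdot> u = ide C X"
    using Tlift_universal[of X m "ide C X"] m Tpm X by simp
  \<comment> \<open>The flip and the addition of a fixed summand can be undone, so the equation that
    defines the bracket is equivalent to a lifting problem with a unique solution.\<close>
  have iff: "vf_delta C X v w = Tlift2 C X \<cdot> Tpair C X w u \<longleftrightarrow> Tlift C X \<cdot> u = m"
    if u: "u \<in> Ar C" "Dom C u = X" "Cod C u = TO C X" "Tproj C X \<cdot> u = ide C X" for u
  proof -
    let ?s = "Tsum C (TO C X) (TA C (Tzero C X) \<cdot> w)"
    have l2: "Tlift2 C X \<cdot> Tpair C X w u = Tflip C X \<cdot> ?s (Tlift C X \<cdot> u)"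
      using Tlift2_Tpair[of X w u] u w vw X by simp
    have dm: "Tflip C X \<cdot> d = ?s m"
      using Tsum_commute[of "TO C X" m "TA C (Tzero C X) \<cdot> w"] msum m w vw X by simp
    have sm: "?s m \<in> Ar C" "Cod C (?s m) = TO C (TO C X)"
      "?s (Tlift C X \<cdot> u) \<in> Ar C" "Cod C (?s (Tlift C X \<cdot> u)) = TO C (TO C X)"
      using m w u vw X by simp_all
    have d': "d = Tflip C X \<cdot> ?s m" using dm d X by (metis Tflip_Tflip_simp)
    show ?thesis
    proof
      assume "vf_delta C X v w = Tlift2 C X \<cdot> Tpair C X w u"
      then have "Tflip C X \<cdot> ?s (Tlift C X \<cdot> u) = Tflip C X \<cdot> ?s m"
        using l2 d' d_def by simp
      then have "?s (Tlift C X \<cdot> u) = ?s m"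
        using Tflip_Tflip_simp[OF X sm(1,2)] Tflip_Tflip_simp[OF X sm(3,4)] by metis
      then show "Tlift C X \<cdot> u = m"
        by (rule Tsum_left_cancel[rotated -1]) (use m w u vw X in simp_all)
    next
      assume "Tlift C X \<cdot> u = m"
      then show "vf_delta C X v w = Tlift2 C X \<cdot> Tpair C X w u" using l2 d' d_def by simp
    qed
  qed
  have "\<exists>!u. u \<in> vector_fields C X \<and> vf_delta C X v w = Tlift2 C X \<cdot> Tpair C X w u"
    using ex1 iff unfolding vector_fields_iff Hom_iff by metis
  from theI'[OF this]
  have b: "vf_bracket C X v w \<in> vector_fields C X"
    "d = Tlift2 C X \<cdot> Tpair C X w (vf_bracket C X v w)"
    unfolding vf_bracket_def d_def by blast+
  show "vf_bracket C X v w \<in> vector_fields C X" by (rule b(1))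
  have "d = Tflip C X \<cdot> Tsum C (TO C X) (TA C (Tzero C X) \<cdot> w) (Tlift C X \<cdot> vf_bracket C X v w)"
    using b Tlift2_Tpair[of X w "vf_bracket C X v w"] w vw X unfolding vector_fields_iff by simp
  then show "Tsum C (TO C X)
      (Tflip C X \<cdot> Tsum C (TO C X) (TA C (Tzero C X) \<cdot> w) (Tlift C X \<cdot> vf_bracket C X v w))
      (Tflip C X \<cdot> TA C v \<cdot> w) = TA C w \<cdot> v"
    using dsum by simp
qed

end

section \<open>Products and their tangent bundles\<close>

context cartesian_tangent_category
begin

lemma Star_Ob [simp]: "Star C \<in> Ob C"
  by (rule Star_closed)

lemma Prd_Ob [simp]: "X \<in> Ob C \<Longrightarrow> Y \<in> Ob C \<Longrightarrow> Prd C X Y \<in> Ob C"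
  by (rule Prd_closed)

lemma bang_simps [simp]:
  assumes "X \<in> Ob C"
  shows "bang C X \<in> Ar C" "Dom C (bang C X) = X" "Cod C (bang C X) = Star C"
  using theI'[OF Star_terminal[OF assms]] by (simp_all add: bang_def)

lemma bang_unique: "f \<in> Ar C \<Longrightarrow> Cod C f = Star C \<Longrightarrow> f = bang C (Dom C f)"
  using Star_terminal[of "Dom C f"] bang_simps[of "Dom C f"] by (metis Dom_Ob Hom_iff)

lemma bang_Comp [simp]: "f \<in> Ar C \<Longrightarrow> Cod C f = X \<Longrightarrow> bang C X \<cdot> f = bang C (Dom C f)"
  using bang_unique[of "bang C X \<cdot> f"] by auto

lemma pr_simps [simp]:
  assumes "X \<in> Ob C" "Y \<in> Ob C"
  shows "pr1 C X Y \<in> Ar C" "Dom C (pr1 C X Y) = Prd C X Y" "Cod C (pr1 C X Y) = X"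
    "pr2 C X Y \<in> Ar C" "Dom C (pr2 C X Y) = Prd C X Y" "Cod C (pr2 C X Y) = Y"
  using pr1_closed[OF assms] pr2_closed[OF assms] by simp_all

lemma pair_simps [simp]:
  assumes "f \<in> Ar C" "g \<in> Ar C" "Dom C f = Dom C g"
  shows "\<langle>f, g\<rangle> \<in> Ar C" "Dom C \<langle>f, g\<rangle> = Dom C f" "Cod C \<langle>f, g\<rangle> = Prd C (Cod C f) (Cod C g)"
    "Cod C f = X \<Longrightarrow> Cod C g = Y \<Longrightarrow> pr1 C X Y \<cdot> \<langle>f, g\<rangle> = f"
    "Cod C f = X \<Longrightarrow> Cod C g = Y \<Longrightarrow> pr2 C X Y \<cdot> \<langle>f, g\<rangle> = g"
proof -
  have "\<exists>!h. h \<in> Hom C (Dom C f) (Prd C (Cod C f) (Cod C g)) \<and>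
      pr1 C (Cod C f) (Cod C g) \<cdot> h = f \<and> pr2 C (Cod C f) (Cod C g) \<cdot> h = g"
    by (rule Prd_universal) (use assms in simp_all)
  from theI'[OF this]
  show "\<langle>f, g\<rangle> \<in> Ar C" "Dom C \<langle>f, g\<rangle> = Dom C f" "Cod C \<langle>f, g\<rangle> = Prd C (Cod C f) (Cod C g)"
    "Cod C f = X \<Longrightarrow> Cod C g = Y \<Longrightarrow> pr1 C X Y \<cdot> \<langle>f, g\<rangle> = f"
    "Cod C f = X \<Longrightarrow> Cod C g = Y \<Longrightarrow> pr2 C X Y \<cdot> \<langle>f, g\<rangle> = g"
    unfolding pair_def by auto
qed

lemma pair_ext:
  assumes "X \<in> Ob C" "Y \<in> Ob C" "h \<in> Ar C" "h' \<in> Ar C" "Cod C h = Prd C X Y" "Cod C h' = Prd C X Y"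
    "pr1 C X Y \<cdot> h = pr1 C X Y \<cdot> h'" "pr2 C X Y \<cdot> h = pr2 C X Y \<cdot> h'"
  shows "h = h'"
proof -
  have "Dom C (pr1 C X Y \<cdot> h) = Dom C (pr1 C X Y \<cdot> h')" using assms(7) by simp
  then have D: "Dom C h = Dom C h'" using assms(1-6) by simp
  have "\<exists>!k. k \<in> Hom C (Dom C h') (Prd C X Y) \<and>
      pr1 C X Y \<cdot> k = pr1 C X Y \<cdot> h' \<and> pr2 C X Y \<cdot> k = pr2 C X Y \<cdot> h'"
    by (rule Prd_universal) (use assms in simp_all)
  moreover have "h \<in> Hom C (Dom C h') (Prd C X Y)" "h' \<in> Hom C (Dom C h') (Prd C X Y)"
    using assms D by simp_all
  ultimately show ?thesis using assms(7,8) by metis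
qed

lemma pr_pair_Comp [simp]:
  assumes "f \<in> Ar C" "g \<in> Ar C" "Dom C f = Dom C g" "Cod C f = X" "Cod C g = Y"
    "a \<in> Ar C" "Cod C a = Dom C g"
  shows "pr1 C X Y \<cdot> \<langle>f, g\<rangle> \<cdot> a = f \<cdot> a" "pr2 C X Y \<cdot> \<langle>f, g\<rangle> \<cdot> a = g \<cdot> a"
proof -
  have XY: "X \<in> Ob C" "Y \<in> Ob C" using assms by auto
  show "pr1 C X Y \<cdot> \<langle>f, g\<rangle> \<cdot> a = f \<cdot> a" "pr2 C X Y \<cdot> \<langle>f, g\<rangle> \<cdot> a = g \<cdot> a"
    by (rule Comp_eq_right; use assms XY in simp)+
qed

lemma pair_Comp [simp]:
  assumes "f \<in> Ar C" "g \<in> Ar C" "Dom C f = Dom C g" "a \<in> Ar C" "Cod C a = Dom C f"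
  shows "\<langle>f, g\<rangle> \<cdot> a = \<langle>f \<cdot> a, g \<cdot> a\<rangle>"
  by (rule pair_ext[of "Cod C f" "Cod C g"]) (use assms in simp_all)

lemma pair_pr [simp]:
  "X \<in> Ob C \<Longrightarrow> Y \<in> Ob C \<Longrightarrow> a \<in> Ar C \<Longrightarrow> Cod C a = Prd C X Y \<Longrightarrow>
    \<langle>pr1 C X Y \<cdot> a, pr2 C X Y \<cdot> a\<rangle> = a"
  by (rule pair_ext[of X Y]) simp_all

lemma cross_pair [simp]:
  assumes "f \<in> Ar C" "g \<in> Ar C" "a \<in> Ar C" "b \<in> Ar C" "Dom C a = Dom C b"
    "Cod C a = Dom C f" "Cod C b = Dom C g"
  shows "(f \<boxtimes> g) \<cdot> \<langle>a, b\<rangle> = \<langle>f \<cdot> a, g \<cdot> b\<rangle>"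
  using assms by (simp add: cross_def)

lemma cross_simps [simp]:
  assumes "f \<in> Ar C" "g \<in> Ar C"
  shows "f \<boxtimes> g \<in> Ar C" "Dom C (f \<boxtimes> g) = Prd C (Dom C f) (Dom C g)"
    "Cod C (f \<boxtimes> g) = Prd C (Cod C f) (Cod C g)"
  using assms by (simp_all add: cross_def)

lemma tpr_simps [simp]:
  assumes "X \<in> Ob C" "Y \<in> Ob C" "Z \<in> Ob C"
  shows "tpr1 C X Y Z \<in> Ar C" "Dom C (tpr1 C X Y Z) = Prd C (Prd C X Y) Z" "Cod C (tpr1 C X Y Z) = X"
    "tpr2 C X Y Z \<in> Ar C" "Dom C (tpr2 C X Y Z) = Prd C (Prd C X Y) Z" "Cod C (tpr2 C X Y Z) = Y"
    "tpr3 C X Y Z \<in> Ar C" "Dom C (tpr3 C X Y Z) = Prd C (Prd C X Y) Z" "Cod C (tpr3 C X Y Z) = Z"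
  using assms by (simp_all add: tpr1_def tpr2_def tpr3_def)

lemma tpr_pair [simp]:
  assumes "a \<in> Ar C" "b \<in> Ar C" "c \<in> Ar C" "Dom C a = Dom C b" "Dom C b = Dom C c"
    "Cod C a = X" "Cod C b = Y" "Cod C c = Z"
  shows "tpr1 C X Y Z \<cdot> \<langle>\<langle>a, b\<rangle>, c\<rangle> = a" "tpr2 C X Y Z \<cdot> \<langle>\<langle>a, b\<rangle>, c\<rangle> = b"
    "tpr3 C X Y Z \<cdot> \<langle>\<langle>a, b\<rangle>, c\<rangle> = c"
proof -
  have "X \<in> Ob C" "Y \<in> Ob C" "Z \<in> Ob C" using assms by auto
  then show "tpr1 C X Y Z \<cdot> \<langle>\<langle>a, b\<rangle>, c\<rangle> = a" "tpr2 C X Y Z \<cdot> \<langle>\<langle>a, b\<rangle>, c\<rangle> = b"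
    "tpr3 C X Y Z \<cdot> \<langle>\<langle>a, b\<rangle>, c\<rangle> = c"
    using assms by (simp_all add: tpr1_def tpr2_def tpr3_def)
qed

text \<open>\<open>TO C (Prd C X Y)\<close> is itself a product of \<open>TO C X\<close> and
  \<open>TO C Y\<close>, with the tangent morphisms of \<open>pr1\<close> and \<open>pr2\<close> as
  projections. This is its pairing, and it keeps the inverse of \<open>Tchi\<close> out of
  sight.\<close>

definition Tprd :: "'o \<Rightarrow> 'o \<Rightarrow> 'm \<Rightarrow> 'm \<Rightarrow> 'm" where
  "Tprd X Y a b = inv_ar C (Tchi C X Y) \<cdot> \<langle>a, b\<rangle>"

lemma Tchi_simps:
  assumes "X \<in> Ob C" "Y \<in> Ob C"
  shows "Tchi C X Y \<in> Ar C" "Dom C (Tchi C X Y) = TO C (Prd C X Y)"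
    "Cod C (Tchi C X Y) = Prd C (TO C X) (TO C Y)"
    "inv_ar C (Tchi C X Y) \<in> Ar C" "Cod C (inv_ar C (Tchi C X Y)) = TO C (Prd C X Y)"
    "Dom C (inv_ar C (Tchi C X Y)) = Prd C (TO C X) (TO C Y)"
  using inv_ar_simps[OF Tchi_iso[OF assms]] assms by (simp_all add: Tchi_def)

lemma Tprd_simps [simp]:
  assumes "a \<in> Ar C" "b \<in> Ar C" "Dom C a = Dom C b" "Cod C a = TO C X" "Cod C b = TO C Y"
    "X \<in> Ob C" "Y \<in> Ob C"
  shows "Tprd X Y a b \<in> Ar C" "Dom C (Tprd X Y a b) = Dom C a"
    "Cod C (Tprd X Y a b) = TO C (Prd C X Y)"
    "TA C (pr1 C X Y) \<cdot> Tprd X Y a b = a" "TA C (pr2 C X Y) \<cdot> Tprd X Y a b = b"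
    "c \<in> Ar C \<Longrightarrow> Cod C c = Dom C a \<Longrightarrow> Tprd X Y a b \<cdot> c = Tprd X Y (a \<cdot> c) (b \<cdot> c)"
proof -
  note chi = Tchi_simps[OF assms(6,7)]
  show t: "Tprd X Y a b \<in> Ar C" "Dom C (Tprd X Y a b) = Dom C a"
    "Cod C (Tprd X Y a b) = TO C (Prd C X Y)"
    and "c \<in> Ar C \<Longrightarrow> Cod C c = Dom C a \<Longrightarrow> Tprd X Y a b \<cdot> c = Tprd X Y (a \<cdot> c) (b \<cdot> c)"
    using chi assms by (simp_all add: Tprd_def)
  have "Tchi C X Y \<cdot> Tprd X Y a b = \<langle>a, b\<rangle>"
    using Comp_cancel_inv(2)[OF Tchi_iso[OF assms(6,7)], of "\<langle>a, b\<rangle>"] chi assms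
    by (simp add: Tprd_def)
  then have e: "\<langle>TA C (pr1 C X Y) \<cdot> Tprd X Y a b, TA C (pr2 C X Y) \<cdot> Tprd X Y a b\<rangle> = \<langle>a, b\<rangle>"
    using t assms by (simp add: Tchi_def)
  have ty: "TA C (pr1 C X Y) \<cdot> Tprd X Y a b \<in> Ar C" "TA C (pr2 C X Y) \<cdot> Tprd X Y a b \<in> Ar C"
    "Dom C (TA C (pr1 C X Y) \<cdot> Tprd X Y a b) = Dom C (TA C (pr2 C X Y) \<cdot> Tprd X Y a b)"
    "Cod C (TA C (pr1 C X Y) \<cdot> Tprd X Y a b) = TO C X"
    "Cod C (TA C (pr2 C X Y) \<cdot> Tprd X Y a b) = TO C Y"
    using t assms by simp_all
  show "TA C (pr1 C X Y) \<cdot> Tprd X Y a b = a"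
    using pair_simps(4)[OF ty] pair_simps(4)[OF assms(1-5)] e by simp
  show "TA C (pr2 C X Y) \<cdot> Tprd X Y a b = b"
    using pair_simps(5)[OF ty] pair_simps(5)[OF assms(1-5)] e by simp
qed

lemma Tprd_ext:
  assumes "X \<in> Ob C" "Y \<in> Ob C" "h \<in> Ar C" "h' \<in> Ar C"
    "Cod C h = TO C (Prd C X Y)" "Cod C h' = TO C (Prd C X Y)"
    "TA C (pr1 C X Y) \<cdot> h = TA C (pr1 C X Y) \<cdot> h'" "TA C (pr2 C X Y) \<cdot> h = TA C (pr2 C X Y) \<cdot> h'"
  shows "h = h'"
proof -
  have "h = Tprd X Y (TA C (pr1 C X Y) \<cdot> h) (TA C (pr2 C X Y) \<cdot> h)"
    if "h \<in> Ar C" "Cod C h = TO C (Prd C X Y)" for h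
    using Comp_cancel_inv(1)[OF Tchi_iso[OF assms(1,2)], of h] Tchi_simps[OF assms(1,2)] that assms(1,2)
    by (simp add: Tprd_def Tchi_def)
  then show ?thesis using assms by metis
qed

lemma TA_pair [simp]:
  assumes "f \<in> Ar C" "g \<in> Ar C" "Dom C f = Dom C g" "a \<in> Ar C" "Cod C a = TO C (Dom C f)"
  shows "TA C \<langle>f, g\<rangle> \<cdot> a = Tprd (Cod C f) (Cod C g) (TA C f \<cdot> a) (TA C g \<cdot> a)"
proof (rule Tprd_ext[of "Cod C f" "Cod C g"])
  have "TA C (pr1 C (Cod C f) (Cod C g)) \<cdot> TA C \<langle>f, g\<rangle> \<cdot> a = TA C f \<cdot> a"
    "TA C (pr2 C (Cod C f) (Cod C g)) \<cdot> TA C \<langle>f, g\<rangle> \<cdot> a = TA C g \<cdot> a"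
    by (rule Comp_eq_right; use assms in \<open>simp flip: TA_Comp_simp\<close>)+
  then show "TA C (pr1 C (Cod C f) (Cod C g)) \<cdot> TA C \<langle>f, g\<rangle> \<cdot> a =
      TA C (pr1 C (Cod C f) (Cod C g)) \<cdot> Tprd (Cod C f) (Cod C g) (TA C f \<cdot> a) (TA C g \<cdot> a)"
    "TA C (pr2 C (Cod C f) (Cod C g)) \<cdot> TA C \<langle>f, g\<rangle> \<cdot> a =
      TA C (pr2 C (Cod C f) (Cod C g)) \<cdot> Tprd (Cod C f) (Cod C g) (TA C f \<cdot> a) (TA C g \<cdot> a)"
    using assms by simp_all
qed (use assms in simp_all)

lemma Tproj_Tprd [simp]:
  assumes "a \<in> Ar C" "b \<in> Ar C" "Dom C a = Dom C b" "Cod C a = TO C X" "Cod C b = TO C Y"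
    "X \<in> Ob C" "Y \<in> Ob C"
  shows "Tproj C (Prd C X Y) \<cdot> Tprd X Y a b = \<langle>Tproj C X \<cdot> a, Tproj C Y \<cdot> b\<rangle>"
proof (rule pair_ext[of X Y])
  have "pr1 C X Y \<cdot> Tproj C (Prd C X Y) \<cdot> Tprd X Y a b = Tproj C X \<cdot> TA C (pr1 C X Y) \<cdot> Tprd X Y a b"
    "pr2 C X Y \<cdot> Tproj C (Prd C X Y) \<cdot> Tprd X Y a b = Tproj C Y \<cdot> TA C (pr2 C X Y) \<cdot> Tprd X Y a b"
    using assms by (simp_all del: Tprd_simps(4,5))
  then show "pr1 C X Y \<cdot> Tproj C (Prd C X Y) \<cdot> Tprd X Y a b = pr1 C X Y \<cdot> \<langle>Tproj C X \<cdot> a, Tproj C Y \<cdot> b\<rangle>"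
    "pr2 C X Y \<cdot> Tproj C (Prd C X Y) \<cdot> Tprd X Y a b = pr2 C X Y \<cdot> \<langle>Tproj C X \<cdot> a, Tproj C Y \<cdot> b\<rangle>"
    using assms by simp_all
qed (use assms in simp_all)

lemma Tprd_Tzero [simp]:
  assumes "x \<in> Ar C" "y \<in> Ar C" "Dom C x = Dom C y" "Cod C x = X" "Cod C y = Y"
  shows "Tprd X Y (Tzero C X \<cdot> x) (Tzero C Y \<cdot> y) = Tzero C (Prd C X Y) \<cdot> \<langle>x, y\<rangle>"
proof -
  have XY: "X \<in> Ob C" "Y \<in> Ob C" using assms by auto
  show ?thesis by (rule Tprd_ext[of X Y]) (use assms XY in simp_all)
qed

lemma Tsum_Tprd:
  assumes "a \<in> Ar C" "b \<in> Ar C" "a' \<in> Ar C" "b' \<in> Ar C"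
    "Dom C a = Z" "Dom C b = Z" "Dom C a' = Z" "Dom C b' = Z"
    "Cod C a = TO C X" "Cod C b = TO C Y" "Cod C a' = TO C X" "Cod C b' = TO C Y"
    "Tproj C X \<cdot> a = Tproj C X \<cdot> a'" "Tproj C Y \<cdot> b = Tproj C Y \<cdot> b'" "X \<in> Ob C" "Y \<in> Ob C"
  shows "Tsum C (Prd C X Y) (Tprd X Y a b) (Tprd X Y a' b') =
    Tprd X Y (Tsum C X a a') (Tsum C Y b b')"
  by (rule Tprd_ext[of X Y]) (use assms in simp_all)

text \<open>An interchange law: fiberwise sums on a product are componentwise, and tangent morphisms
  are fiberwise additive. It is the source of the Eckmann--Hilton argument and of the splitting of
  the product rule into two partial derivatives.\<close>

lemma TA_Tprd_Tsum:
  assumes "f \<in> Ar C" "Dom C f = Prd C X Y" "Cod C f = W"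
    "a \<in> Ar C" "b \<in> Ar C" "a' \<in> Ar C" "b' \<in> Ar C"
    "Dom C a = Z" "Dom C b = Z" "Dom C a' = Z" "Dom C b' = Z"
    "Cod C a = TO C X" "Cod C b = TO C Y" "Cod C a' = TO C X" "Cod C b' = TO C Y"
    "Tproj C X \<cdot> a = Tproj C X \<cdot> a'" "Tproj C Y \<cdot> b = Tproj C Y \<cdot> b'" "X \<in> Ob C" "Y \<in> Ob C"
  shows "TA C f \<cdot> Tprd X Y (Tsum C X a a') (Tsum C Y b b') =
    Tsum C W (TA C f \<cdot> Tprd X Y a b) (TA C f \<cdot> Tprd X Y a' b')"
  using assms by (simp flip: Tsum_Tprd[of a b a' b' Z])

text \<open>An argument that is held fixed enters as a zero vector. In this form the axioms on the
  partial tangent morphisms of \<open>kappa\<close> are applied to elements.\<close>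

lemma Tpartial_pair:
  assumes "f \<in> Ar C" "Dom C f = Prd C X Y" "X \<in> Ob C" "Y \<in> Ob C"
    "a \<in> Ar C" "b \<in> Ar C" "Dom C a = Dom C b"
  shows "Cod C a = TO C X \<Longrightarrow> Cod C b = Y \<Longrightarrow>
      Tpartial1 C X Y f \<cdot> \<langle>a, b\<rangle> = TA C f \<cdot> Tprd X Y a (Tzero C Y \<cdot> b)"
    and "Cod C a = X \<Longrightarrow> Cod C b = TO C Y \<Longrightarrow>
      Tpartial2 C X Y f \<cdot> \<langle>a, b\<rangle> = TA C f \<cdot> Tprd X Y (Tzero C X \<cdot> a) b"
  using Tchi_simps[of X Y] assms by (simp_all add: Tpartial1_def Tpartial2_def Tprd_def)

end

section \<open>Scalar multiplication\<close>

context cartesian_tangent_category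
begin

text \<open>Preservation of the terminal object follows from that of binary products: the two
  projections of \<open>Prd C (Star C) (Star C)\<close> coincide, hence so do the two components of
  any arrow into its tangent bundle.\<close>

lemma TO_Star_unique:
  assumes "h \<in> Ar C" "Cod C h = TO C (Star C)"
  shows "h = Tzero C (Star C) \<cdot> bang C (Dom C h)"
proof -
  have "pr1 C (Star C) (Star C) = pr2 C (Star C) (Star C)"
    using bang_unique[of "pr1 C (Star C) (Star C)"] bang_unique[of "pr2 C (Star C) (Star C)"] by simp
  then show ?thesis
    using Tprd_simps(4,5)[of h "Tzero C (Star C) \<cdot> bang C (Dom C h)" "Star C" "Star C"] assms
    by simp
qed

lemma TA_bang [simp]:
  "X \<in> Ob C \<Longrightarrow> a \<in> Ar C \<Longrightarrow> Cod C a = TO C X \<Longrightarrow>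
    TA C (bang C X) \<cdot> a = Tzero C (Star C) \<cdot> bang C (Dom C a)"
  using TO_Star_unique[of "TA C (bang C X) \<cdot> a"] by simp

lemma Tprd_TA_pr:
  assumes "X \<in> Ob C" "Y \<in> Ob C" "u \<in> Ar C" "Cod C u = TO C (Prd C X Y)"
  shows "Tprd X Y (TA C (pr1 C X Y) \<cdot> u) (TA C (pr2 C X Y) \<cdot> u) = u"
  by (rule Tprd_ext[of X Y]) (use assms in simp_all)

end

section \<open>The ring object and the ring of functions\<close>

context scalar_tangent_category
begin

lemma R_simps [simp]:
  "RO C \<in> Ob C"
  "Rplus C \<in> Ar C" "Dom C (Rplus C) = Prd C (RO C) (RO C)" "Cod C (Rplus C) = RO C"
  "Rzero C \<in> Ar C" "Dom C (Rzero C) = Star C" "Cod C (Rzero C) = RO C"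
  "Rmult C \<in> Ar C" "Dom C (Rmult C) = Prd C (RO C) (RO C)" "Cod C (Rmult C) = RO C"
  "Rone C \<in> Ar C" "Dom C (Rone C) = Star C" "Cod C (Rone C) = RO C"
  using RO_closed Rplus_closed Rzero_closed Rmult_closed Rone_closed by simp_all

abbreviation Radd :: "'m \<Rightarrow> 'm \<Rightarrow> 'm" where "Radd a b \<equiv> Rplus C \<cdot> \<langle>a, b\<rangle>"

abbreviation Rmul :: "'m \<Rightarrow> 'm \<Rightarrow> 'm" where "Rmul a b \<equiv> Rmult C \<cdot> \<langle>a, b\<rangle>"

lemma R_laws:
  assumes "a \<in> Hom C Z (RO C)" "b \<in> Hom C Z (RO C)" "c \<in> Hom C Z (RO C)"
  shows "Radd (Radd a b) c = Radd a (Radd b c)" "Rmul (Rmul a b) c = Rmul a (Rmul b c)"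
    "Rmul a (Radd b c) = Radd (Rmul a b) (Rmul a c)"
    "Radd a b = Radd b a" "Rmul a b = Rmul b a"
    "Radd a (Rzero C \<cdot> bang C Z) = a" "Rmul a (Rone C \<cdot> bang C Z) = a"
proof -
  show "Radd (Radd a b) c = Radd a (Radd b c)"
    using arg_cong[OF Rplus_assoc, of "\<lambda>h. h \<cdot> \<langle>\<langle>a, b\<rangle>, c\<rangle>"] assms by simp
  show "Rmul (Rmul a b) c = Rmul a (Rmul b c)"
    using arg_cong[OF Rmult_assoc, of "\<lambda>h. h \<cdot> \<langle>\<langle>a, b\<rangle>, c\<rangle>"] assms by simp
  show "Rmul a (Radd b c) = Radd (Rmul a b) (Rmul a c)"
    using arg_cong[OF R_distrib, of "\<lambda>h. h \<cdot> \<langle>\<langle>a, b\<rangle>, c\<rangle>"] assms by simp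
  show "Radd a b = Radd b a"
    using arg_cong[OF Rplus_comm, of "\<lambda>h. h \<cdot> \<langle>b, a\<rangle>"] assms by simp
  show "Rmul a b = Rmul b a"
    using arg_cong[OF Rmult_comm, of "\<lambda>h. h \<cdot> \<langle>b, a\<rangle>"] assms by simp
  show "Radd a (Rzero C \<cdot> bang C Z) = a"
    using arg_cong[OF Rplus_Rzero, of "\<lambda>h. h \<cdot> a"] assms by simp
  show "Rmul a (Rone C \<cdot> bang C Z) = a"
    using arg_cong[OF Rmult_Rone, of "\<lambda>h. h \<cdot> a"] assms by simp
qed

lemma Rneg_simps [simp]:
  shows "Rneg C \<in> Ar C" "Dom C (Rneg C) = RO C" "Cod C (Rneg C) = RO C"
    and "a \<in> Ar C \<Longrightarrow> Cod C a = RO C \<Longrightarrow> Radd a (Rneg C \<cdot> a) = Rzero C \<cdot> bang C (Dom C a)"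
proof -
  have uniq: "n = n'" if "is_Rneg C n" "is_Rneg C n'" for n n'
  proof -
    let ?i = "ide C (RO C)" and ?z = "Rzero C \<cdot> bang C (RO C)"
    have h: "?i \<in> Hom C (RO C) (RO C)" "n \<in> Hom C (RO C) (RO C)" "n' \<in> Hom C (RO C) (RO C)"
      "?z \<in> Hom C (RO C) (RO C)"
      and e: "Radd ?i n = ?z" "Radd ?i n' = ?z"
      using that unfolding is_Rneg_def by simp_all
    have "n = Radd n (Radd ?i n')" using R_laws(6)[OF h(2,2,2)] e by simp
    also have "\<dots> = Radd (Radd ?i n) n'" using R_laws(1)[OF h(2,1,3)] R_laws(4)[OF h(2,1,1)] by simp
    also have "\<dots> = n'" using R_laws(6)[OF h(3,3,3)] R_laws(4)[OF h(3,4,4)] e by simp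
    finally show ?thesis .
  qed
  have "is_Rneg C (Rneg C)"
    unfolding Rneg_def using Rplus_Rneg uniq by (metis theI')
  then have n: "Rneg C \<in> Ar C" "Dom C (Rneg C) = RO C" "Cod C (Rneg C) = RO C"
    "Radd (ide C (RO C)) (Rneg C) = Rzero C \<cdot> bang C (RO C)"
    unfolding is_Rneg_def by simp_all
  then show "Rneg C \<in> Ar C" "Dom C (Rneg C) = RO C" "Cod C (Rneg C) = RO C" by blast+
  show "Radd a (Rneg C \<cdot> a) = Rzero C \<cdot> bang C (Dom C a)" if "a \<in> Ar C" "Cod C a = RO C"
    using arg_cong[OF n(4), of "\<lambda>h. h \<cdot> a"] n(1-3) that by simp
qed

lemma function_ring_simps [simp]:
  "carrier (function_ring C X) = Hom C X (RO C)" "add (function_ring C X) = Radd"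
  "mult (function_ring C X) = Rmul" "zero (function_ring C X) = Rzero C \<cdot> bang C X"
  "one (function_ring C X) = Rone C \<cdot> bang C X"
  by (simp_all add: function_ring_def)

lemma cring_function_ring:
  assumes "X \<in> Ob C"
  shows "cring (function_ring C X)"
proof (rule cringI)
  have z: "Rzero C \<cdot> bang C X \<in> Hom C X (RO C)" and o: "Rone C \<cdot> bang C X \<in> Hom C X (RO C)"
    using assms by simp_all
  show "abelian_group (function_ring C X)"
  proof (rule abelian_groupI, unfold function_ring_simps)
    fix a b c assume h: "a \<in> Hom C X (RO C)" "b \<in> Hom C X (RO C)" "c \<in> Hom C X (RO C)"
    show "Radd (Radd a b) c = Radd a (Radd b c)" by (rule R_laws(1)[OF h])
  next
    fix a b assume h: "a \<in> Hom C X (RO C)" "b \<in> Hom C X (RO C)"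
    show "Radd a b = Radd b a" by (rule R_laws(4)[OF h h(1)])
  next
    fix a assume h: "a \<in> Hom C X (RO C)"
    show "Radd (Rzero C \<cdot> bang C X) a = a"
      using R_laws(4)[OF z h h] R_laws(6)[OF h h h] by simp
    have n: "Rneg C \<cdot> a \<in> Hom C X (RO C)" using h by simp
    show "\<exists>b\<in>Hom C X (RO C). Radd b a = Rzero C \<cdot> bang C X"
      by (rule bexI[OF _ n]) (use R_laws(4)[OF n h h] h in simp)
  qed (use assms in simp_all)
  show "comm_monoid (function_ring C X)"
  proof (rule comm_monoidI, unfold function_ring_simps)
    fix a b c assume h: "a \<in> Hom C X (RO C)" "b \<in> Hom C X (RO C)" "c \<in> Hom C X (RO C)"
    show "Rmul (Rmul a b) c = Rmul a (Rmul b c)" by (rule R_laws(2)[OF h])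
  next
    fix a b assume h: "a \<in> Hom C X (RO C)" "b \<in> Hom C X (RO C)"
    show "Rmul a b = Rmul b a" by (rule R_laws(5)[OF h h(1)])
  next
    fix a assume h: "a \<in> Hom C X (RO C)"
    show "Rmul (Rone C \<cdot> bang C X) a = a"
      using R_laws(5)[OF o h h] R_laws(7)[OF h h h] by simp
  qed (use assms in simp_all)
next
  fix a b c
  assume "a \<in> carrier (function_ring C X)" "b \<in> carrier (function_ring C X)"
    "c \<in> carrier (function_ring C X)"
  then have h: "a \<in> Hom C X (RO C)" "b \<in> Hom C X (RO C)" "c \<in> Hom C X (RO C)"
    unfolding function_ring_simps by blast+
  have s: "Radd a b \<in> Hom C X (RO C)" using h by simp
  show "(a \<oplus>\<^bsub>function_ring C X\<^esub> b) \<otimes>\<^bsub>function_ring C X\<^esub> c =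
      a \<otimes>\<^bsub>function_ring C X\<^esub> c \<oplus>\<^bsub>function_ring C X\<^esub> b \<otimes>\<^bsub>function_ring C X\<^esub> c"
    unfolding function_ring_simps
    using R_laws(5)[OF s h(3,3)] R_laws(3)[OF h(3,1,2)] R_laws(5)[OF h(1,3,3)] R_laws(5)[OF h(2,3,3)]
    by simp
qed

end

section \<open>Bundles of modules, on generalized elements\<close>

locale slice_module = scalar_tangent_category C + module_bundle C B k
  for C :: "('o, 'm, 'x) scalar_tangent_category_scheme" (structure)
    and B :: "('o, 'm, 'y) ab_bundle_scheme"
    and k :: 'm
begin

sublocale slice_ab_group C B ..

lemma smult_simps:
  assumes "r \<in> Hom C Z (RO C)" "a \<in> Hom C Z (tot B)"
  shows "k \<cdot> \<langle>r, a\<rangle> \<in> Hom C Z (tot B)" "bproj B \<cdot> k \<cdot> \<langle>r, a\<rangle> = bproj B \<cdot> a"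
proof -
  have k: "k \<in> Ar C" "Dom C k = Prd C (RO C) (tot B)" "Cod C k = tot B"
    using smult_closed by simp_all
  then show "k \<cdot> \<langle>r, a\<rangle> \<in> Hom C Z (tot B)" using assms by simp
  have "bproj B \<cdot> k \<cdot> \<langle>r, a\<rangle> = bproj B \<cdot> pr2 C (RO C) (tot B) \<cdot> \<langle>r, a\<rangle>"
    by (rule Comp_cong_right[OF smult_over]) (use k assms in simp_all)
  then show "bproj B \<cdot> k \<cdot> \<langle>r, a\<rangle> = bproj B \<cdot> a" using assms by simp
qed

lemma smult_over_mem: "r \<in> Hom C (Dom C x) (RO C) \<Longrightarrow> a \<in> over x \<Longrightarrow> k \<cdot> \<langle>r, a\<rangle> \<in> over x"
  using smult_simps[of r "Dom C x" a] unfolding over_def by blast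

lemma smult_mult_one:
  assumes "r \<in> Hom C Z (RO C)" "s \<in> Hom C Z (RO C)" "a \<in> Hom C Z (tot B)"
  shows "k \<cdot> \<langle>r, k \<cdot> \<langle>s, a\<rangle>\<rangle> = k \<cdot> \<langle>Rmul r s, a\<rangle>" "k \<cdot> \<langle>Rone C \<cdot> bang C Z, a\<rangle> = a"
proof -
  have k: "k \<in> Ar C" "Dom C k = Prd C (RO C) (tot B)" "Cod C k = tot B"
    using smult_closed by simp_all
  show "k \<cdot> \<langle>r, k \<cdot> \<langle>s, a\<rangle>\<rangle> = k \<cdot> \<langle>Rmul r s, a\<rangle>"
    using arg_cong[OF smult_assoc, of "\<lambda>h. h \<cdot> \<langle>\<langle>r, s\<rangle>, a\<rangle>"] k assms by simp
  have "Z \<in> Ob C" using assms(1) by auto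
  then show "k \<cdot> \<langle>Rone C \<cdot> bang C Z, a\<rangle> = a"
    using arg_cong[OF smult_one, of "\<lambda>h. h \<cdot> \<langle>bang C Z, a\<rangle>"] k assms by simp
qed

lemma smult_add_left:
  assumes "r \<in> Hom C Z (RO C)" "s \<in> Hom C Z (RO C)" "a \<in> Hom C Z (tot B)"
  shows "k \<cdot> \<langle>Radd r s, a\<rangle> = bsum C B (k \<cdot> \<langle>r, a\<rangle>) (k \<cdot> \<langle>s, a\<rangle>)"
proof -
  have k: "k \<in> Ar C" "Dom C k = Prd C (RO C) (tot B)" "Cod C k = tot B"
    using smult_closed by simp_all
  let ?p = "Prd C (Prd C (RO C) (RO C)) (tot B)"
  let ?f = "k \<cdot> \<langle>tpr1 C (RO C) (RO C) (tot B), tpr3 C (RO C) (RO C) (tot B)\<rangle>"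
  let ?g = "k \<cdot> \<langle>tpr2 C (RO C) (RO C) (tot B), tpr3 C (RO C) (RO C) (tot B)\<rangle>"
  let ?x = "bproj B \<cdot> tpr3 C (RO C) (RO C) (tot B)"
  have o: "?f \<in> over ?x" "?g \<in> over ?x"
    by (intro smult_over_mem overI; simp)+
  have "bsum C B ?f ?g \<cdot> \<langle>\<langle>r, s\<rangle>, a\<rangle> = bsum C B (k \<cdot> \<langle>r, a\<rangle>) (k \<cdot> \<langle>s, a\<rangle>)"
    using bsum_Comp[OF o, of "\<langle>\<langle>r, s\<rangle>, a\<rangle>"] k assms by simp
  then show ?thesis
    using arg_cong[OF smult_Rplus, of "\<lambda>h. h \<cdot> \<langle>\<langle>r, s\<rangle>, a\<rangle>"] k assms by simp
qed

lemma smult_add_right: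
  assumes "r \<in> Hom C (Dom C x) (RO C)" "a \<in> over x" "b \<in> over x"
  shows "k \<cdot> \<langle>r, bsum C B a b\<rangle> = bsum C B (k \<cdot> \<langle>r, a\<rangle>) (k \<cdot> \<langle>r, b\<rangle>)"
proof -
  have k: "k \<in> Ar C" "Dom C k = Prd C (RO C) (tot B)" "Cod C k = tot B"
    using smult_closed by simp_all
  note p = bpair_simps[OF assms(2,3)] and ab = overD[OF assms(2)] overD[OF assms(3)]
  let ?q = "pr2 C (RO C) (tot2 B)"
  let ?f = "k \<cdot> \<langle>pr1 C (RO C) (tot2 B), bpr B 0 \<cdot> ?q\<rangle>"
  let ?g = "k \<cdot> \<langle>pr1 C (RO C) (tot2 B), bpr B 1 \<cdot> ?q\<rangle>"
  let ?y = "bproj B \<cdot> bpr B 1 \<cdot> ?q"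
  have "bproj B \<cdot> bpr B 0 \<cdot> ?q = ?y"
    by (rule Comp_cong_right[OF bproj_bpr]) simp_all
  then have "bpr B 0 \<cdot> ?q \<in> over ?y" "bpr B 1 \<cdot> ?q \<in> over ?y"
    by (simp_all add: over_def)
  then have o: "?f \<in> over ?y" "?g \<in> over ?y" by (intro smult_over_mem; simp)+
  have u: "\<langle>r, bpair C B a b\<rangle> \<in> Ar C" "Dom C \<langle>r, bpair C B a b\<rangle> = Dom C x"
    "Cod C \<langle>r, bpair C B a b\<rangle> = Prd C (RO C) (tot2 B)"
    using p assms(1) by simp_all
  have q: "?q \<cdot> \<langle>r, bpair C B a b\<rangle> = bpair C B a b" using p assms(1) by simp
  have "bsum C B ?f ?g \<cdot> \<langle>r, bpair C B a b\<rangle> = bsum C B (k \<cdot> \<langle>r, a\<rangle>) (k \<cdot> \<langle>r, b\<rangle>)"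
    using bsum_Comp[OF o, of "\<langle>r, bpair C B a b\<rangle>"] k u q p(1-5) assms(1) by simp
  then show ?thesis
    using arg_cong[OF smult_badd, of "\<lambda>h. h \<cdot> \<langle>r, bpair C B a b\<rangle>"] k u p assms(1)
    by (simp add: bsum_def)
qed

text \<open>Multiplication by \<open>r\<close> is additive, so it sends the zero to an
  idempotent.\<close>

lemma smult_bzero:
  assumes "r \<in> Hom C (Dom C x) (RO C)" "x \<in> Ar C" "Cod C x = base B"
  shows "k \<cdot> \<langle>r, bzero B \<cdot> x\<rangle> = bzero B \<cdot> x"
proof -
  have z: "bzero B \<cdot> x \<in> over x" by (rule bzero_over_mem[OF assms(2,3)])
  show ?thesis
    by (rule bsum_idem[OF smult_over_mem[OF assms(1) z]])
      (use smult_add_right[OF assms(1) z z] bsum_bzero[OF z] in simp)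
qed

end

context scalar_tangent_category
begin

lemma slice_module_tangent: "X \<in> Ob C \<Longrightarrow> slice_module C (tangent_bundle C X) (kappa C X)"
  by (intro slice_module.intro scalar_tangent_category_axioms kappa_module)

lemma kappa_simps [simp]:
  assumes "X \<in> Ob C"
  shows "kappa C X \<in> Ar C" "Dom C (kappa C X) = Prd C (RO C) (TO C X)" "Cod C (kappa C X) = TO C X"
    "r \<in> Ar C \<Longrightarrow> a \<in> Ar C \<Longrightarrow> Cod C r = RO C \<Longrightarrow> Cod C a = TO C X \<Longrightarrow> Dom C r = Dom C a \<Longrightarrow>
      Tproj C X \<cdot> kappa C X \<cdot> \<langle>r, a\<rangle> = Tproj C X \<cdot> a"
    "r \<in> Ar C \<Longrightarrow> x \<in> Ar C \<Longrightarrow> Cod C r = RO C \<Longrightarrow> Cod C x = X \<Longrightarrow> Dom C r = Dom C x \<Longrightarrow>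
      kappa C X \<cdot> \<langle>r, Tzero C X \<cdot> x\<rangle> = Tzero C X \<cdot> x"
proof -
  interpret K: slice_module C "tangent_bundle C X" "kappa C X"
    by (rule slice_module_tangent[OF assms])
  show "kappa C X \<in> Ar C" "Dom C (kappa C X) = Prd C (RO C) (TO C X)" "Cod C (kappa C X) = TO C X"
    using K.smult_closed by simp_all
  show "Tproj C X \<cdot> kappa C X \<cdot> \<langle>r, a\<rangle> = Tproj C X \<cdot> a"
    if "r \<in> Ar C" "a \<in> Ar C" "Cod C r = RO C" "Cod C a = TO C X" "Dom C r = Dom C a"
    using K.smult_simps(2)[of r "Dom C a" a] that by simp
  show "kappa C X \<cdot> \<langle>r, Tzero C X \<cdot> x\<rangle> = Tzero C X \<cdot> x"
    if "r \<in> Ar C" "x \<in> Ar C" "Cod C r = RO C" "Cod C x = X" "Dom C r = Dom C x"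
    using K.smult_bzero[of r x] that by simp
qed

lemma TA_kappa [simp]:
  assumes "f \<in> Ar C" "Dom C f = X" "r \<in> Ar C" "a \<in> Ar C" "Cod C r = RO C" "Cod C a = TO C X"
    "Dom C r = Dom C a"
  shows "TA C f \<cdot> kappa C X \<cdot> \<langle>r, a\<rangle> = kappa C (Cod C f) \<cdot> \<langle>r, TA C f \<cdot> a\<rangle>"
proof -
  have X: "X \<in> Ob C" using assms by auto
  have "TA C f \<cdot> kappa C X \<cdot> \<langle>r, a\<rangle> = kappa C (Cod C f) \<cdot> (ide C (RO C) \<boxtimes> TA C f) \<cdot> \<langle>r, a\<rangle>"
    by (rule Comp_cong_right[OF kappa_natural[of f X "Cod C f", symmetric]]) (use X assms in simp_all)
  then show ?thesis using assms by simp
qed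

text \<open>Scalar multiplication is natural along the two projections, hence componentwise.\<close>

lemma kappa_Tprd:
  assumes "X \<in> Ob C" "Y \<in> Ob C" "r \<in> Ar C" "a \<in> Ar C" "b \<in> Ar C"
    "Dom C r = Dom C b" "Dom C a = Dom C b" "Cod C r = RO C" "Cod C a = TO C X" "Cod C b = TO C Y"
  shows "kappa C (Prd C X Y) \<cdot> \<langle>r, Tprd X Y a b\<rangle> =
    Tprd X Y (kappa C X \<cdot> \<langle>r, a\<rangle>) (kappa C Y \<cdot> \<langle>r, b\<rangle>)"
  by (rule Tprd_ext[of X Y]) (use assms in simp_all)

end

section \<open>The tangent bundle of the ring object\<close>

context scalar_tangent_category
begin

lemma Radd_Rneg_left [simp]:
  "a \<in> Ar C \<Longrightarrow> Cod C a = RO C \<Longrightarrow> Radd (Rneg C \<cdot> a) a = Rzero C \<cdot> bang C (Dom C a)"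
  using R_laws(4)[of "Rneg C \<cdot> a" "Dom C a" a a] by simp

text \<open>Unlike \<open>Tsum\<close>, which adds vectors at the same base point, this addition is
  defined for all pairs and adds the base points too. It is the addition for which vectors split
  into a zero vector and a vector at zero, see \<open>Tadd_decomposition\<close>.\<close>

definition Tadd :: "'m \<Rightarrow> 'm \<Rightarrow> 'm" where
  "Tadd s t = TA C (Rplus C) \<cdot> Tprd (RO C) (RO C) s t"

lemma Tadd_simps [simp]:
  assumes "s \<in> Ar C" "t \<in> Ar C" "Dom C s = Dom C t" "Cod C s = TO C (RO C)" "Cod C t = TO C (RO C)"
  shows "Tadd s t \<in> Ar C" "Dom C (Tadd s t) = Dom C s" "Cod C (Tadd s t) = TO C (RO C)"
    "Tproj C (RO C) \<cdot> Tadd s t = Radd (Tproj C (RO C) \<cdot> s) (Tproj C (RO C) \<cdot> t)"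
  using assms by (simp_all add: Tadd_def)

lemma Tadd_Tzero [simp]:
  assumes "x \<in> Ar C" "y \<in> Ar C" "Dom C x = Dom C y" "Cod C x = RO C" "Cod C y = RO C"
  shows "Tadd (Tzero C (RO C) \<cdot> x) (Tzero C (RO C) \<cdot> y) = Tzero C (RO C) \<cdot> Radd x y"
  using assms by (simp add: Tadd_def)

text \<open>The laws of \<open>Rplus\<close> are equations between arrows out of products, and the
  tangent functor preserves products; differentiating them gives the laws of
  \<open>Tadd\<close>.\<close>

lemma Tadd_assoc:
  assumes "s \<in> Hom C Z (TO C (RO C))" "t \<in> Hom C Z (TO C (RO C))" "u \<in> Hom C Z (TO C (RO C))"
  shows "Tadd (Tadd s t) u = Tadd s (Tadd t u)"
proof -
  let ?R = "RO C"
  define w where "w = Tprd (Prd C ?R ?R) ?R (Tprd ?R ?R s t) u"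
  have w: "w \<in> Ar C" "Cod C w = TO C (Prd C (Prd C ?R ?R) ?R)"
    "TA C (pr1 C (Prd C ?R ?R) ?R) \<cdot> w = Tprd ?R ?R s t"
    "TA C (pr2 C (Prd C ?R ?R) ?R) \<cdot> w = u"
    using assms by (simp_all add: w_def)
  have "TA C (tpr1 C ?R ?R ?R) \<cdot> w = s" "TA C (tpr2 C ?R ?R ?R) \<cdot> w = t"
    "TA C (tpr3 C ?R ?R ?R) \<cdot> w = u"
    using w assms by (simp_all add: tpr1_def tpr2_def tpr3_def)
  then show ?thesis
    using arg_cong[OF Rplus_assoc, of "\<lambda>h. TA C h \<cdot> w"] w(1,2) assms by (simp add: Tadd_def)
qed

text \<open>Stated for every symmetric \<open>f\<close>, since it serves the addition here and the
  multiplication in the product rule.\<close>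

lemma TA_Tprd_swap:
  assumes "s \<in> Hom C Z (TO C (RO C))" "t \<in> Hom C Z (TO C (RO C))"
    "f \<in> Hom C (Prd C (RO C) (RO C)) Y" "f \<cdot> \<langle>pr2 C (RO C) (RO C), pr1 C (RO C) (RO C)\<rangle> = f"
  shows "TA C f \<cdot> Tprd (RO C) (RO C) s t = TA C f \<cdot> Tprd (RO C) (RO C) t s"
  using arg_cong[OF assms(4), of "\<lambda>h. TA C h \<cdot> Tprd (RO C) (RO C) t s"] assms(1-3) by simp

lemma Tadd_commute:
  assumes "s \<in> Hom C Z (TO C (RO C))" "t \<in> Hom C Z (TO C (RO C))"
  shows "Tadd s t = Tadd t s"
  unfolding Tadd_def by (rule TA_Tprd_swap[OF assms _ Rplus_comm]) simp

lemma Tadd_zero: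
  assumes "t \<in> Hom C Z (TO C (RO C))"
  shows "Tadd t (Tzero C (RO C) \<cdot> Rzero C \<cdot> bang C Z) = t"
    and "Tadd (Tzero C (RO C) \<cdot> Rzero C \<cdot> bang C Z) t = t"
proof -
  have Z: "Z \<in> Ob C" using assms by auto
  show e: "Tadd t (Tzero C (RO C) \<cdot> Rzero C \<cdot> bang C Z) = t"
    using arg_cong[OF Rplus_Rzero, of "\<lambda>h. TA C h \<cdot> t"] assms Z by (simp add: Tadd_def)
  show "Tadd (Tzero C (RO C) \<cdot> Rzero C \<cdot> bang C Z) t = t"
    using e Tadd_commute[OF assms, of "Tzero C (RO C) \<cdot> Rzero C \<cdot> bang C Z"] Z by simp
qed

lemma Tadd_left_commute:
  assumes "s \<in> Hom C Z (TO C (RO C))" "t \<in> Hom C Z (TO C (RO C))" "u \<in> Hom C Z (TO C (RO C))"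
  shows "Tadd s (Tadd t u) = Tadd t (Tadd s u)"
  using Tadd_assoc[OF assms] Tadd_assoc[OF assms(2,1,3)] Tadd_commute[OF assms(1,2)] by simp

text \<open>The Eckmann--Hilton argument, for the addition of the fibers of \<open>TR\<close> and the
  tangent morphism of the addition of \<open>R\<close>.\<close>

lemma Tsum_eq_Tadd:
  assumes "s \<in> Hom C Z (TO C (RO C))" "t \<in> Hom C Z (TO C (RO C))"
    "Tproj C (RO C) \<cdot> s = Rzero C \<cdot> bang C Z" "Tproj C (RO C) \<cdot> t = Rzero C \<cdot> bang C Z"
  shows "Tsum C (RO C) s t = Tadd s t"
proof -
  let ?z = "Tzero C (RO C) \<cdot> Rzero C \<cdot> bang C Z"
  have Z: "Z \<in> Ob C" using assms by auto
  have "Tadd (Tsum C (RO C) s ?z) (Tsum C (RO C) ?z t) = Tsum C (RO C) (Tadd s ?z) (Tadd ?z t)"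
    unfolding Tadd_def by (rule TA_Tprd_Tsum) (use assms Z in simp_all)
  then show ?thesis
    using Tsum_Tzero[of "RO C" s "Rzero C \<cdot> bang C Z"] Tsum_Tzero[of "RO C" t "Rzero C \<cdot> bang C Z"]
      Tadd_zero[OF assms(1)] Tadd_zero[OF assms(2)] assms by simp
qed

text \<open>The inclusion \<open>j : R \<rightarrow> TR\<close> of the tangent fiber at zero, identified with \<open>R\<close>.\<close>

definition Rfibre_map :: 'm where
  "Rfibre_map = Rincl C \<cdot> inv_ar C (Riso C)"

text \<open>The pullback that defines the tangent fiber has the terminal object as a corner, so only
  the component in \<open>TO C (RO C)\<close> carries information.\<close>

lemma Rfib_universal:
  shows "Rfib C \<in> Ob C" "Rincl C \<in> Ar C" "Dom C (Rincl C) = Rfib C" "Cod C (Rincl C) = TO C (RO C)"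
    "Tproj C (RO C) \<cdot> Rincl C = Rzero C \<cdot> bang C (Rfib C)"
    "v \<in> Hom C Z (TO C (RO C)) \<Longrightarrow> Tproj C (RO C) \<cdot> v = Rzero C \<cdot> bang C Z \<Longrightarrow>
      \<exists>!h. h \<in> Hom C Z (Rfib C) \<and> Rincl C \<cdot> h = v"
proof -
  have p: "is_pullback C (Rzero C) (Tproj C (RO C)) (Rfib C) (bang C (Rfib C)) (Rincl C)"
    using R_tangent_stable by (simp add: tangent_stable_def)
  then have q: "Rincl C \<in> Hom C (Rfib C) (TO C (RO C))"
    "Rzero C \<cdot> bang C (Rfib C) = Tproj C (RO C) \<cdot> Rincl C"
    unfolding is_pullback_def by simp_all
  then show F: "Rincl C \<in> Ar C" "Dom C (Rincl C) = Rfib C" "Cod C (Rincl C) = TO C (RO C)"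
    "Tproj C (RO C) \<cdot> Rincl C = Rzero C \<cdot> bang C (Rfib C)" by simp_all
  show "Rfib C \<in> Ob C" using F(1,2) Dom_Ob by metis
  assume v: "v \<in> Hom C Z (TO C (RO C))" "Tproj C (RO C) \<cdot> v = Rzero C \<cdot> bang C Z"
  have Z: "Z \<in> Ob C" using v by auto
  have "\<And>Z u v. u \<in> Hom C Z (Dom C (Rzero C)) \<Longrightarrow> v \<in> Hom C Z (Dom C (Tproj C (RO C))) \<Longrightarrow>
      Rzero C \<cdot> u = Tproj C (RO C) \<cdot> v \<Longrightarrow>
      \<exists>!h. h \<in> Hom C Z (Rfib C) \<and> bang C (Rfib C) \<cdot> h = u \<and> Rincl C \<cdot> h = v"
    using p unfolding is_pullback_def by blast
  from this[of "bang C Z" Z v]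
  have "\<exists>!h. h \<in> Hom C Z (Rfib C) \<and> bang C (Rfib C) \<cdot> h = bang C Z \<and> Rincl C \<cdot> h = v"
    using v Z by simp
  moreover have "bang C (Rfib C) \<cdot> h = bang C Z" if "h \<in> Hom C Z (Rfib C)" for h using that by simp
  ultimately show "\<exists>!h. h \<in> Hom C Z (Rfib C) \<and> Rincl C \<cdot> h = v" by metis
qed

lemma Rincl_cancel:
  assumes "g \<in> Hom C Z (Rfib C)" "h \<in> Hom C Z (Rfib C)" "Rincl C \<cdot> g = Rincl C \<cdot> h"
  shows "g = h"
proof -
  note R = Rfib_universal(1-4)
  have Z: "Z \<in> Ob C" using assms by auto
  have e: "Tproj C (RO C) \<cdot> Rincl C \<cdot> h = (Rzero C \<cdot> bang C (Rfib C)) \<cdot> h"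
    by (rule Comp_eq_right[OF Rfib_universal(5)]) (use R assms in simp_all)
  have "\<exists>!g. g \<in> Hom C Z (Rfib C) \<and> Rincl C \<cdot> g = Rincl C \<cdot> h"
    by (rule Rfib_universal(6)) (use e R assms in simp_all)
  then show ?thesis using assms by metis
qed

lemma Riso_simps:
  shows "Riso C \<in> Ar C" "Dom C (Riso C) = Rfib C" "Cod C (Riso C) = RO C"
    "inv_ar C (Riso C) \<in> Ar C" "Dom C (inv_ar C (Riso C)) = RO C" "Cod C (inv_ar C (Riso C)) = Rfib C"
    "a \<in> Ar C \<Longrightarrow> Cod C a = Rfib C \<Longrightarrow> inv_ar C (Riso C) \<cdot> Riso C \<cdot> a = a"
    "a \<in> Ar C \<Longrightarrow> Cod C a = RO C \<Longrightarrow> Riso C \<cdot> inv_ar C (Riso C) \<cdot> a = a"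
proof -
  have iso: "is_iso C (Riso C)" and r: "Riso C \<in> Hom C (Rfib C) (RO C)"
    using R_tangent_stable by (simp_all add: tangent_stable_def)
  show "Riso C \<in> Ar C" "Dom C (Riso C) = Rfib C" "Cod C (Riso C) = RO C"
    "inv_ar C (Riso C) \<in> Ar C" "Dom C (inv_ar C (Riso C)) = RO C" "Cod C (inv_ar C (Riso C)) = Rfib C"
    using inv_ar_simps(1-4)[OF iso] r by simp_all
  show "a \<in> Ar C \<Longrightarrow> Cod C a = Rfib C \<Longrightarrow> inv_ar C (Riso C) \<cdot> Riso C \<cdot> a = a"
    "a \<in> Ar C \<Longrightarrow> Cod C a = RO C \<Longrightarrow> Riso C \<cdot> inv_ar C (Riso C) \<cdot> a = a"
    using Comp_cancel_inv[OF iso] r by simp_all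
qed

lemma Rfibre_map_simps [simp]:
  shows "Rfibre_map \<in> Ar C" "Dom C Rfibre_map = RO C" "Cod C Rfibre_map = TO C (RO C)"
    "a \<in> Ar C \<Longrightarrow> Cod C a = RO C \<Longrightarrow> Tproj C (RO C) \<cdot> Rfibre_map \<cdot> a = Rzero C \<cdot> bang C (Dom C a)"
proof -
  note F = Rfib_universal(1-4) Riso_simps(1-6)
  show "Rfibre_map \<in> Ar C" "Dom C Rfibre_map = RO C" "Cod C Rfibre_map = TO C (RO C)"
    using F by (simp_all add: Rfibre_map_def)
  show "Tproj C (RO C) \<cdot> Rfibre_map \<cdot> a = Rzero C \<cdot> bang C (Dom C a)"
    if a: "a \<in> Ar C" "Cod C a = RO C"
  proof -
    have "Tproj C (RO C) \<cdot> Rincl C \<cdot> inv_ar C (Riso C) \<cdot> a =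
        (Rzero C \<cdot> bang C (Rfib C)) \<cdot> inv_ar C (Riso C) \<cdot> a"
      by (rule Comp_eq_right[OF Rfib_universal(5)]) (use F a in simp_all)
    then show ?thesis using F a by (simp add: Rfibre_map_def)
  qed
qed

text \<open>Values of \<open>Reta\<close> are compared after embedding into
  \<open>TO C (RO C)\<close>, where they have an explicit formula; \<open>Reta_eqI\<close> packages
  this.\<close>

lemma Rfibre_map_cancel:
  assumes "x \<in> Hom C Z (RO C)" "y \<in> Hom C Z (RO C)" "Rfibre_map \<cdot> x = Rfibre_map \<cdot> y"
  shows "x = y"
proof -
  note F = Rfib_universal(1-4) Riso_simps(1-6)
  have "inv_ar C (Riso C) \<cdot> x = inv_ar C (Riso C) \<cdot> y"
    by (rule Rincl_cancel[of _ Z]) (use F assms in \<open>simp_all add: Rfibre_map_def\<close>)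
  then have "Riso C \<cdot> inv_ar C (Riso C) \<cdot> x = Riso C \<cdot> inv_ar C (Riso C) \<cdot> y" by (rule arg_cong)
  moreover have "Riso C \<cdot> inv_ar C (Riso C) \<cdot> x = x" "Riso C \<cdot> inv_ar C (Riso C) \<cdot> y = y"
    by (rule Riso_simps(8); use assms in simp)+
  ultimately show ?thesis by metis
qed

text \<open>The fiberwise sum of two vectors at zero is again at zero, so the universal property of
  the fiber provides the arrow that the definite description \<open>Rfib_add\<close> asks for. The
  same holds for \<open>Rfib_smult\<close>, as scaling keeps base points.\<close>

lemma Rfib_add_Comp:
  assumes "a \<in> Hom C Z (Rfib C)" "b \<in> Hom C Z (Rfib C)"
  shows "Rfib_add C \<in> Hom C (Prd C (Rfib C) (Rfib C)) (Rfib C)"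
    "Rincl C \<cdot> Rfib_add C \<cdot> \<langle>a, b\<rangle> = Tsum C (RO C) (Rincl C \<cdot> a) (Rincl C \<cdot> b)"
proof -
  note F = Rfib_universal(1-4)
  let ?P = "Prd C (Rfib C) (Rfib C)"
  let ?p = "pr1 C (Rfib C) (Rfib C)" and ?q = "pr2 C (Rfib C) (Rfib C)"
  have z: "Tproj C (RO C) \<cdot> Rincl C \<cdot> c = Rzero C \<cdot> bang C (Dom C c)"
    if "c \<in> Ar C" "Cod C c = Rfib C" for c
    using Comp_eq_right[OF Rfib_universal(5), of c] F that by simp
  have "\<exists>!h. h \<in> Hom C ?P (Rfib C) \<and> Rincl C \<cdot> h = Tsum C (RO C) (Rincl C \<cdot> ?p) (Rincl C \<cdot> ?q)"
    by (rule Rfib_universal(6)) (use F z in simp_all)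
  from theI'[OF this]
  have h: "Rfib_add C \<in> Hom C ?P (Rfib C)"
    "Rincl C \<cdot> Rfib_add C = Tsum C (RO C) (Rincl C \<cdot> ?p) (Rincl C \<cdot> ?q)"
    unfolding Rfib_add_def by blast+
  show "Rfib_add C \<in> Hom C ?P (Rfib C)" by (rule h(1))
  have "Rincl C \<cdot> Rfib_add C \<cdot> \<langle>a, b\<rangle> =
      Tsum C (RO C) (Rincl C \<cdot> ?p) (Rincl C \<cdot> ?q) \<cdot> \<langle>a, b\<rangle>"
    by (rule Comp_eq_right[OF h(2)]) (use h F assms in simp_all)
  then show "Rincl C \<cdot> Rfib_add C \<cdot> \<langle>a, b\<rangle> = Tsum C (RO C) (Rincl C \<cdot> a) (Rincl C \<cdot> b)"
    using F z assms by simp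
qed

lemma Rfib_smult_Comp:
  assumes "r \<in> Hom C Z (RO C)" "b \<in> Hom C Z (Rfib C)"
  shows "Rfib_smult C \<in> Hom C (Prd C (RO C) (Rfib C)) (Rfib C)"
    "Rincl C \<cdot> Rfib_smult C \<cdot> \<langle>r, b\<rangle> = kappa C (RO C) \<cdot> \<langle>r, Rincl C \<cdot> b\<rangle>"
proof -
  note F = Rfib_universal(1-4)
  let ?P = "Prd C (RO C) (Rfib C)"
  let ?k = "kappa C (RO C) \<cdot> (ide C (RO C) \<boxtimes> Rincl C)"
  have z: "Tproj C (RO C) \<cdot> Rincl C \<cdot> c = Rzero C \<cdot> bang C (Dom C c)"
    if "c \<in> Ar C" "Cod C c = Rfib C" for c
    using Comp_eq_right[OF Rfib_universal(5), of c] F that by simp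
  have k: "?k = kappa C (RO C) \<cdot> \<langle>pr1 C (RO C) (Rfib C), Rincl C \<cdot> pr2 C (RO C) (Rfib C)\<rangle>"
    using F by (simp add: cross_def)
  have "\<exists>!h. h \<in> Hom C ?P (Rfib C) \<and> Rincl C \<cdot> h = ?k"
    unfolding k by (rule Rfib_universal(6)) (use F z in simp_all)
  from theI'[OF this]
  have h: "Rfib_smult C \<in> Hom C ?P (Rfib C)" "Rincl C \<cdot> Rfib_smult C = ?k"
    unfolding Rfib_smult_def by blast+
  show "Rfib_smult C \<in> Hom C ?P (Rfib C)" by (rule h(1))
  have "Rincl C \<cdot> Rfib_smult C \<cdot> \<langle>r, b\<rangle> = ?k \<cdot> \<langle>r, b\<rangle>"
    by (rule Comp_eq_right[OF h(2)]) (use h F assms in simp_all)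
  then show "Rincl C \<cdot> Rfib_smult C \<cdot> \<langle>r, b\<rangle> = kappa C (RO C) \<cdot> \<langle>r, Rincl C \<cdot> b\<rangle>"
    using F assms by simp
qed

text \<open>\<open>Riso\<close> is an isomorphism of modules by tangent stability, and the
  operations of the fiber are restrictions of those of the tangent bundle. \<open>Rfibre_map\<close>
  is the inverse of \<open>Riso\<close> followed by the inclusion, so it turns ring operations into
  bundle operations.\<close>

lemma Rfibre_map_linear:
  assumes "x \<in> Hom C Z (RO C)" "y \<in> Hom C Z (RO C)"
  shows "Rfibre_map \<cdot> Radd x y = Tsum C (RO C) (Rfibre_map \<cdot> x) (Rfibre_map \<cdot> y)"
    and "Rfibre_map \<cdot> Rmul x y = kappa C (RO C) \<cdot> \<langle>x, Rfibre_map \<cdot> y\<rangle>"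
proof -
  note F = Rfib_universal(1-4) Riso_simps(1-6)
  let ?a = "inv_ar C (Riso C) \<cdot> x" and ?b = "inv_ar C (Riso C) \<cdot> y"
  have ab: "?a \<in> Hom C Z (Rfib C)" "?b \<in> Hom C Z (Rfib C)" using F assms by simp_all
  have st: "Riso C \<cdot> Rfib_add C = Rplus C \<cdot> (Riso C \<boxtimes> Riso C)"
    "Riso C \<cdot> Rfib_smult C = Rmult C \<cdot> (ide C (RO C) \<boxtimes> Riso C)"
    using R_tangent_stable by (simp_all add: tangent_stable_def)
  note A = Rfib_add_Comp[OF ab] and S = Rfib_smult_Comp[OF assms(1) ab(2)]
  have xy: "Riso C \<cdot> ?a = x" "Riso C \<cdot> ?b = y" using Riso_simps(8) assms by simp_all
  have "Riso C \<cdot> Rfib_add C \<cdot> \<langle>?a, ?b\<rangle> = Rplus C \<cdot> (Riso C \<boxtimes> Riso C) \<cdot> \<langle>?a, ?b\<rangle>"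
    by (rule Comp_cong_right[OF st(1)]) (use F A ab in simp_all)
  also have "\<dots> = Radd x y" using F ab xy by simp
  finally have "inv_ar C (Riso C) \<cdot> Radd x y = Rfib_add C \<cdot> \<langle>?a, ?b\<rangle>"
    using Riso_simps(7)[of "Rfib_add C \<cdot> \<langle>?a, ?b\<rangle>"] A ab by simp
  then show "Rfibre_map \<cdot> Radd x y = Tsum C (RO C) (Rfibre_map \<cdot> x) (Rfibre_map \<cdot> y)"
    using A F assms by (simp add: Rfibre_map_def)
  have "Riso C \<cdot> Rfib_smult C \<cdot> \<langle>x, ?b\<rangle> = Rmult C \<cdot> (ide C (RO C) \<boxtimes> Riso C) \<cdot> \<langle>x, ?b\<rangle>"
    by (rule Comp_cong_right[OF st(2)]) (use F S ab assms in simp_all)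
  also have "\<dots> = Rmul x y" using F ab xy assms by simp
  finally have "inv_ar C (Riso C) \<cdot> Rmul x y = Rfib_smult C \<cdot> \<langle>x, ?b\<rangle>"
    using Riso_simps(7)[of "Rfib_smult C \<cdot> \<langle>x, ?b\<rangle>"] S ab assms by simp
  then show "Rfibre_map \<cdot> Rmul x y = kappa C (RO C) \<cdot> \<langle>x, Rfibre_map \<cdot> y\<rangle>"
    using S F assms by (simp add: Rfibre_map_def)
qed

text \<open>The defining translation subtracts the base point, so its result lies at zero and
  factors through the fiber. Composing with \<open>Rfibre_map\<close> cancels \<open>Riso\<close>
  and leaves the translation itself.\<close>

lemma Reta_closed_Comp:
  shows "Reta C \<in> Ar C" "Dom C (Reta C) = TO C (RO C)" "Cod C (Reta C) = RO C"
    and "t \<in> Ar C \<Longrightarrow> Cod C t = TO C (RO C) \<Longrightarrow> Rfibre_map \<cdot> Reta C \<cdot> t =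
      Tadd (Tzero C (RO C) \<cdot> Rneg C \<cdot> Tproj C (RO C) \<cdot> t) t"
proof -
  note F = Rfib_universal(1-4) Riso_simps(1-6)
  let ?R = "RO C"
  let ?n = "Tadd (Tzero C ?R \<cdot> Rneg C \<cdot> Tproj C ?R) (ide C (TO C ?R))"
  have n: "Tpartial2 C ?R ?R (Rplus C) \<cdot> \<langle>Rneg C \<cdot> Tproj C ?R, ide C (TO C ?R)\<rangle> = ?n"
    using Tpartial_pair(2)[of "Rplus C" ?R ?R "Rneg C \<cdot> Tproj C ?R" "ide C (TO C ?R)"]
    by (simp add: Tadd_def)
  have "\<exists>!h. h \<in> Hom C (TO C ?R) (Rfib C) \<and> Rincl C \<cdot> h = ?n"
    by (rule Rfib_universal(6)) simp_all
  from theI'[OF this] obtain h where h: "h \<in> Ar C" "Dom C h = TO C ?R" "Cod C h = Rfib C"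
    "Rincl C \<cdot> h = ?n" "Reta C = Riso C \<cdot> h"
    unfolding Reta_def n by auto
  show "Reta C \<in> Ar C" "Dom C (Reta C) = TO C (RO C)" "Cod C (Reta C) = RO C"
    using h F by simp_all
  show "Rfibre_map \<cdot> Reta C \<cdot> t = Tadd (Tzero C (RO C) \<cdot> Rneg C \<cdot> Tproj C (RO C) \<cdot> t) t"
    if t: "t \<in> Ar C" "Cod C t = TO C (RO C)"
  proof -
    have "Rincl C \<cdot> h \<cdot> t = ?n \<cdot> t"
      by (rule Comp_eq_right[OF h(4)]) (use h(1-3) F t in simp_all)
    also have "\<dots> = Tadd (Tzero C ?R \<cdot> Rneg C \<cdot> Tproj C ?R \<cdot> t) t"
      using t by (simp add: Tadd_def)
    finally show ?thesis
      using h(1-3,5) F t Riso_simps(7)[of "h \<cdot> t"] by (simp add: Rfibre_map_def)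
  qed
qed

lemmas Reta_simps [simp] = Reta_closed_Comp(1-3)

lemma Reta_eqI:
  assumes "t \<in> Hom C Z (TO C (RO C))" "x \<in> Hom C Z (RO C)"
    "Rfibre_map \<cdot> x = Tadd (Tzero C (RO C) \<cdot> Rneg C \<cdot> Tproj C (RO C) \<cdot> t) t"
  shows "Reta C \<cdot> t = x"
  by (rule Rfibre_map_cancel[of _ Z]) (use assms Reta_closed_Comp(4)[of t] in simp_all)

lemma Rneg_Radd:
  assumes "x \<in> Hom C Z (RO C)" "y \<in> Hom C Z (RO C)"
  shows "Rneg C \<cdot> Radd x y = Radd (Rneg C \<cdot> x) (Rneg C \<cdot> y)"
    and "Rneg C \<cdot> Rzero C \<cdot> bang C Z = Rzero C \<cdot> bang C Z"
proof -
  have Z: "Z \<in> Ob C" using assms by auto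
  interpret F: cring "function_ring C Z" by (rule cring_function_ring[OF Z])
  have neg: "Rneg C \<cdot> a = \<ominus>\<^bsub>function_ring C Z\<^esub> a" if "a \<in> carrier (function_ring C Z)" for a
    by (rule F.minus_equality[symmetric])
      (use that in simp_all)
  have c: "x \<in> carrier (function_ring C Z)" "y \<in> carrier (function_ring C Z)"
    "Radd x y \<in> carrier (function_ring C Z)" "Rzero C \<cdot> bang C Z \<in> carrier (function_ring C Z)"
    using assms Z by simp_all
  show "Rneg C \<cdot> Radd x y = Radd (Rneg C \<cdot> x) (Rneg C \<cdot> y)"
    unfolding neg[OF c(1)] neg[OF c(2)] neg[OF c(3)] using F.minus_add[OF c(1,2)] by simp
  show "Rneg C \<cdot> Rzero C \<cdot> bang C Z = Rzero C \<cdot> bang C Z"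
    unfolding neg[OF c(4)] using F.minus_zero by simp
qed

lemma Rfibre_map_zero [simp]:
  assumes "Z \<in> Ob C"
  shows "Rfibre_map \<cdot> Rzero C \<cdot> bang C Z = Tzero C (RO C) \<cdot> Rzero C \<cdot> bang C Z"
proof -
  let ?z = "Rzero C \<cdot> bang C Z"
  have z: "?z \<in> Hom C Z (RO C)" using assms by simp
  have "Tsum C (RO C) (Rfibre_map \<cdot> ?z) (Rfibre_map \<cdot> ?z) = Rfibre_map \<cdot> ?z"
    using Rfibre_map_linear(1)[OF z z] R_laws(6)[OF z z z] by simp
  from Tsum_eq_right[OF _ _ _ _ _ _ this] show ?thesis using assms by simp
qed

lemma Reta_Rfibre_map [simp]:
  assumes "x \<in> Ar C" "Cod C x = RO C"
  shows "Reta C \<cdot> Rfibre_map \<cdot> x = x"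
  by (rule Reta_eqI[of _ "Dom C x"])
    (use assms Rneg_Radd(2)[of x "Dom C x" x] Tadd_zero(2)[of "Rfibre_map \<cdot> x" "Dom C x"] in simp_all)

lemma Reta_Tzero [simp]:
  assumes "x \<in> Ar C" "Cod C x = RO C"
  shows "Reta C \<cdot> Tzero C (RO C) \<cdot> x = Rzero C \<cdot> bang C (Dom C x)"
  by (rule Reta_eqI[of _ "Dom C x"]) (use assms in simp_all)

text \<open>The translating zero vector \<open>?n\<close> equals its own fiberwise sum with itself.
  The interchange law then makes the translation fiberwise additive, and \<open>Rfibre_map\<close>
  reflects fiberwise sums back to sums in the ring.\<close>

lemma Reta_Tsum [simp]:
  assumes "s \<in> Ar C" "t \<in> Ar C" "Cod C s = TO C (RO C)" "Cod C t = TO C (RO C)"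
    "Tproj C (RO C) \<cdot> s = Tproj C (RO C) \<cdot> t"
  shows "Reta C \<cdot> Tsum C (RO C) s t = Radd (Reta C \<cdot> s) (Reta C \<cdot> t)"
proof -
  have D: "Dom C s = Dom C t" using arg_cong[OF assms(5), of "Dom C"] assms(1-4) by simp
  let ?n = "Tzero C (RO C) \<cdot> Rneg C \<cdot> Tproj C (RO C) \<cdot> t"
  have nn: "Tsum C (RO C) ?n ?n = ?n"
    by (rule Tsum_Tzero(1)) (use assms in simp_all)
  have "Tadd (Tsum C (RO C) ?n ?n) (Tsum C (RO C) s t) = Tsum C (RO C) (Tadd ?n s) (Tadd ?n t)"
    unfolding Tadd_def by (rule TA_Tprd_Tsum[of _ _ _ _ _ _ _ _ "Dom C t"]) (use assms D in simp_all)
  then have e: "Tadd ?n (Tsum C (RO C) s t) = Tsum C (RO C) (Tadd ?n s) (Tadd ?n t)"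
    unfolding nn .
  show ?thesis
    by (rule Reta_eqI[of _ "Dom C t"])
      (use assms D e Rfibre_map_linear(1)[of "Reta C \<cdot> s" "Dom C t" "Reta C \<cdot> t"]
        Reta_closed_Comp(4)[of s] Reta_closed_Comp(4)[of t] in simp_all)
qed

text \<open>Rearranging turns the translate of the sum into the \<open>Tadd\<close> of the two
  translates. Both lie at zero, where \<open>Tadd\<close> is \<open>Tsum\<close>, and there
  \<open>Rfibre_map\<close> is additive. This is what makes vector fields act additively on
  functions.\<close>

lemma Reta_Tadd:
  assumes "s \<in> Hom C Z (TO C (RO C))" "t \<in> Hom C Z (TO C (RO C))"
  shows "Reta C \<cdot> Tadd s t = Radd (Reta C \<cdot> s) (Reta C \<cdot> t)"
proof -
  let ?p = "Tproj C (RO C)"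
  let ?m = "\<lambda>t. Tzero C (RO C) \<cdot> Rneg C \<cdot> ?p \<cdot> t"
  have m: "?m s \<in> Hom C Z (TO C (RO C))" "?m t \<in> Hom C Z (TO C (RO C))"
    "Tadd (?m t) t \<in> Hom C Z (TO C (RO C))" "Tadd s t \<in> Hom C Z (TO C (RO C))"
    using assms by simp_all
  have ps: "?p \<cdot> s \<in> Hom C Z (RO C)" "?p \<cdot> t \<in> Hom C Z (RO C)" using assms by simp_all
  have "?m (Tadd s t) = Tadd (?m s) (?m t)"
    using Rneg_Radd(1)[OF ps] assms by simp
  then have "Tadd (?m (Tadd s t)) (Tadd s t) = Tadd (Tadd (?m s) (?m t)) (Tadd s t)" by simp
  also have "\<dots> = Tadd (?m s) (Tadd (?m t) (Tadd s t))" by (rule Tadd_assoc[OF m(1,2,4)])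
  also have "\<dots> = Tadd (?m s) (Tadd s (Tadd (?m t) t))"
    unfolding Tadd_left_commute[OF m(2) assms] ..
  also have "\<dots> = Tadd (Tadd (?m s) s) (Tadd (?m t) t)"
    by (rule Tadd_assoc[OF m(1) assms(1) m(3), symmetric])
  also have "\<dots> = Tadd (Rfibre_map \<cdot> Reta C \<cdot> s) (Rfibre_map \<cdot> Reta C \<cdot> t)"
    using Reta_closed_Comp(4)[of s] Reta_closed_Comp(4)[of t] assms by simp
  also have "\<dots> = Tsum C (RO C) (Rfibre_map \<cdot> Reta C \<cdot> s) (Rfibre_map \<cdot> Reta C \<cdot> t)"
    by (rule Tsum_eq_Tadd[of _ Z, symmetric]) (use assms in simp_all)
  also have "\<dots> = Rfibre_map \<cdot> Radd (Reta C \<cdot> s) (Reta C \<cdot> t)"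
    by (rule Rfibre_map_linear(1)[of _ Z, symmetric]) (use assms in simp_all)
  finally show ?thesis
    by (intro Reta_eqI[of _ Z]) (use assms in simp_all)
qed

text \<open>Scalar multiplication is natural, componentwise on pairs and fixes zero vectors, so it
  commutes with the translation to the fiber at zero. There \<open>Rfibre_map\<close> identifies it
  with the multiplication of the ring.\<close>

lemma Reta_kappa [simp]:
  assumes "r \<in> Ar C" "t \<in> Ar C" "Cod C r = RO C" "Cod C t = TO C (RO C)" "Dom C r = Dom C t"
  shows "Reta C \<cdot> kappa C (RO C) \<cdot> \<langle>r, t\<rangle> = Rmul r (Reta C \<cdot> t)"
proof (rule Reta_eqI[of _ "Dom C t"])
  let ?n = "Tzero C (RO C) \<cdot> Rneg C \<cdot> Tproj C (RO C) \<cdot> t"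
  let ?k = "kappa C (RO C)"
  have "Rfibre_map \<cdot> Rmul r (Reta C \<cdot> t) = ?k \<cdot> \<langle>r, Tadd ?n t\<rangle>"
    using Rfibre_map_linear(2)[of r "Dom C t" "Reta C \<cdot> t"] Reta_closed_Comp(4)[of t] assms by simp
  also have "\<dots> = TA C (Rplus C) \<cdot> kappa C (Prd C (RO C) (RO C)) \<cdot> \<langle>r, Tprd (RO C) (RO C) ?n t\<rangle>"
    using assms by (simp add: Tadd_def)
  also have "kappa C (Prd C (RO C) (RO C)) \<cdot> \<langle>r, Tprd (RO C) (RO C) ?n t\<rangle> =
      Tprd (RO C) (RO C) (?k \<cdot> \<langle>r, ?n\<rangle>) (?k \<cdot> \<langle>r, t\<rangle>)"
    by (rule kappa_Tprd) (use assms in simp_all)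
  finally show "Rfibre_map \<cdot> Rmul r (Reta C \<cdot> t) =
      Tadd (Tzero C (RO C) \<cdot> Rneg C \<cdot> Tproj C (RO C) \<cdot> ?k \<cdot> \<langle>r, t\<rangle>) (?k \<cdot> \<langle>r, t\<rangle>)"
    using assms by (simp add: Tadd_def)
qed (use assms in simp_all)

lemma Tadd_decomposition:
  assumes "t \<in> Hom C Z (TO C (RO C))"
  shows "Tadd (Tzero C (RO C) \<cdot> Tproj C (RO C) \<cdot> t) (Rfibre_map \<cdot> Reta C \<cdot> t) = t"
proof -
  let ?p = "Tproj C (RO C) \<cdot> t"
  have h: "Tzero C (RO C) \<cdot> ?p \<in> Hom C Z (TO C (RO C))"
    "Tzero C (RO C) \<cdot> Rneg C \<cdot> ?p \<in> Hom C Z (TO C (RO C))"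
    using assms by simp_all
  show ?thesis
    using Tadd_assoc[OF h assms] Reta_closed_Comp(4)[of t] Tadd_zero(2)[OF assms] assms by simp
qed

end

section \<open>Second-order derivatives of functions\<close>

context scalar_tangent_category
begin

lemma TA_Reta_Rfibre_map [simp]:
  assumes "a \<in> Ar C" "Cod C a = TO C (RO C)"
  shows "TA C (Reta C) \<cdot> TA C Rfibre_map \<cdot> a = a"
proof -
  have "Reta C \<cdot> Rfibre_map = ide C (RO C)"
    using Reta_Rfibre_map[of "ide C (RO C)"] by simp
  then have "TA C (Reta C) \<cdot> TA C Rfibre_map = ide C (TO C (RO C))"
    by (simp flip: TA_Comp_simp)
  from Comp_eq_right[OF this, of a] show ?thesis using assms by simp
qed

lemma TA_Reta_TA_Tzero [simp]:
  assumes "a \<in> Ar C" "Cod C a = TO C (RO C)"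
  shows "TA C (Reta C) \<cdot> TA C (Tzero C (RO C)) \<cdot> a = Tzero C (RO C) \<cdot> Rzero C \<cdot> bang C (Dom C a)"
proof -
  have "Reta C \<cdot> Tzero C (RO C) = Rzero C \<cdot> bang C (RO C)"
    using Reta_Tzero[of "ide C (RO C)"] by simp
  then have "TA C (Reta C) \<cdot> TA C (Tzero C (RO C)) = TA C (Rzero C) \<cdot> TA C (bang C (RO C))"
    by (simp flip: TA_Comp_simp)
  from Comp_cong_right[OF this, of a] show ?thesis using assms by simp
qed

abbreviation Reta2 :: "'m \<Rightarrow> 'm" where
  "Reta2 z \<equiv> Reta C \<cdot> TA C (Reta C) \<cdot> z"

lemma Reta2_Tsum:
  assumes "a \<in> Ar C" "b \<in> Ar C" "Cod C a = TO C (TO C (RO C))" "Cod C b = TO C (TO C (RO C))"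
    "Tproj C (TO C (RO C)) \<cdot> a = Tproj C (TO C (RO C)) \<cdot> b"
  shows "Reta2 (Tsum C (TO C (RO C)) a b) = Radd (Reta2 a) (Reta2 b)"
  using assms by simp

text \<open>Differentiate the additivity of \<open>Reta\<close> for \<open>Tadd\<close> and use the
  same additivity once more outside. The element \<open>w\<close> is arbitrary because it will be a
  lift or a flip that naturality has moved to the product.\<close>

lemma Reta2_TA_Rplus:
  assumes "w \<in> Ar C" "Cod C w = TO C (TO C (Prd C (RO C) (RO C)))"
  shows "Reta2 (TA C (TA C (Rplus C)) \<cdot> w) =
    Radd (Reta2 (TA C (TA C (pr1 C (RO C) (RO C))) \<cdot> w)) (Reta2 (TA C (TA C (pr2 C (RO C) (RO C))) \<cdot> w))"
proof -
  let ?p = "TA C (pr1 C (RO C) (RO C))" and ?q = "TA C (pr2 C (RO C) (RO C))"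
  have "Tadd ?p ?q = TA C (Rplus C)"
    using Tprd_TA_pr[of "RO C" "RO C" "ide C (TO C (Prd C (RO C) (RO C)))"] by (simp add: Tadd_def)
  then have "Reta C \<cdot> TA C (Rplus C) = Radd (Reta C \<cdot> ?p) (Reta C \<cdot> ?q)"
    using Reta_Tadd[of ?p "TO C (Prd C (RO C) (RO C))" ?q] by simp
  then have "TA C (Reta C \<cdot> TA C (Rplus C)) \<cdot> w = TA C (Radd (Reta C \<cdot> ?p) (Reta C \<cdot> ?q)) \<cdot> w"
    by simp
  then have "TA C (Reta C) \<cdot> TA C (TA C (Rplus C)) \<cdot> w =
      Tadd (TA C (Reta C) \<cdot> TA C ?p \<cdot> w) (TA C (Reta C) \<cdot> TA C ?q \<cdot> w)"
    using assms by (simp add: Tadd_def)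
  then show ?thesis
    using Reta_Tadd[of "TA C (Reta C) \<cdot> TA C ?p \<cdot> w" "Dom C w" "TA C (Reta C) \<cdot> TA C ?q \<cdot> w"] assms
    by simp
qed

lemma TA_Rfibre_map:
  assumes "s \<in> Ar C" "Cod C s = TO C (RO C)"
  shows "TA C Rfibre_map \<cdot> s = Tflip C (RO C) \<cdot> Tsum C (TO C (RO C))
    (TA C (Tzero C (RO C)) \<cdot> Rfibre_map \<cdot> Tproj C (RO C) \<cdot> s) (Tlift C (RO C) \<cdot> Rfibre_map \<cdot> Reta C \<cdot> s)"
proof -
  let ?R = "RO C"
  let ?k = "kappa C ?R" and ?Z = "Dom C s"
  \<comment> \<open>The constant vector \<open>j(1)\<close>. By linearity \<open>Rfibre_map\<close>
    multiplies \<open>e\<close> by scalars, so its tangent morphism is the partial tangent morphism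
    of \<open>kappa\<close> with \<open>e\<close> held fixed.\<close>
  define e where "e = Rfibre_map \<cdot> Rone C"
  have e: "e \<in> Ar C" "Dom C e = Star C" "Cod C e = TO C ?R"
    "\<And>Z. Z \<in> Ob C \<Longrightarrow> Tproj C ?R \<cdot> e \<cdot> bang C Z = Rzero C \<cdot> bang C Z"
    by (simp_all add: e_def)
  have k: "?k \<cdot> \<langle>r, e \<cdot> bang C (Dom C r)\<rangle> = Rfibre_map \<cdot> r" if "r \<in> Ar C" "Cod C r = ?R" for r
    using Rfibre_map_linear(2)[of r "Dom C r" "Rone C \<cdot> bang C (Dom C r)"]
      R_laws(7)[of r "Dom C r" r r] that by (simp add: e_def)
  have "TA C (?k \<cdot> \<langle>ide C ?R, e \<cdot> bang C ?R\<rangle>) \<cdot> s = TA C Rfibre_map \<cdot> s"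
    using k[of "ide C ?R"] by simp
  then have "TA C Rfibre_map \<cdot> s = TA C ?k \<cdot> Tprd ?R (TO C ?R) s (Tzero C (TO C ?R) \<cdot> e \<cdot> bang C ?Z)"
    using e assms by simp
  also have "\<dots> = Tpartial1 C ?R (TO C ?R) ?k \<cdot> \<langle>s, e \<cdot> bang C ?Z\<rangle>"
    by (rule Tpartial_pair(1)[symmetric]) (use e assms in simp_all)
  also have "\<dots> = Tlift2 C ?R \<cdot>
      Tpair C ?R (?k \<cdot> \<langle>Tproj C ?R \<cdot> s, e \<cdot> bang C ?Z\<rangle>) (?k \<cdot> \<langle>Reta C \<cdot> s, e \<cdot> bang C ?Z\<rangle>)"
  proof -
    let ?f = "?k \<cdot> \<langle>tpr1 C ?R ?R (TO C ?R), tpr3 C ?R ?R (TO C ?R)\<rangle>"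
    let ?g = "?k \<cdot> \<langle>tpr2 C ?R ?R (TO C ?R), tpr3 C ?R ?R (TO C ?R)\<rangle>"
    have pfg: "Tproj C ?R \<cdot> ?f = Tproj C ?R \<cdot> ?g" by simp
    have fg: "?f \<in> Ar C" "?g \<in> Ar C" "Cod C ?f = TO C ?R" "Cod C ?g = TO C ?R"
      "Dom C ?f = Prd C (Prd C ?R ?R) (TO C ?R)" by simp_all
    note p = Tpair_simps[OF R_simps(1) fg(1-4) pfg]
    have L: "Tlift2 C ?R \<in> Ar C" "Dom C (Tlift2 C ?R) = Tk C 2 ?R"
      unfolding Tlift2_eq[OF R_simps(1)] using Tpr_simps[OF R_simps(1)] by simp_all
    let ?c = "\<langle>Tproj C ?R, Reta C\<rangle> \<boxtimes> ide C (TO C ?R)"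
    let ?a = "\<langle>s, e \<cdot> bang C ?Z\<rangle>"
    have c: "?c \<in> Ar C" "Dom C ?c = Prd C (TO C ?R) (TO C ?R)"
      "Cod C ?c = Prd C (Prd C ?R ?R) (TO C ?R)"
      "?c \<cdot> ?a = \<langle>\<langle>Tproj C ?R \<cdot> s, Reta C \<cdot> s\<rangle>, e \<cdot> bang C ?Z\<rangle>"
      using e assms by simp_all
    have a: "?a \<in> Ar C" "Cod C ?a = Prd C (TO C ?R) (TO C ?R)" using e assms by simp_all
    have "Tpartial1 C ?R (TO C ?R) ?k \<cdot> ?a = (Tlift2 C ?R \<cdot> Tpair C ?R ?f ?g \<cdot> ?c) \<cdot> ?a"
      using kappa_Tpartial1[OF R_simps(1)] by simp
    also have "\<dots> = Tlift2 C ?R \<cdot> Tpair C ?R ?f ?g \<cdot> ?c \<cdot> ?a"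
      using Comp_Comp[of ?a "Tpair C ?R ?f ?g \<cdot> ?c" "Tlift2 C ?R"]
        Comp_Comp[of ?a ?c "Tpair C ?R ?f ?g"] Comp_simps[of ?c "Tpair C ?R ?f ?g"]
      unfolding p(1,2,3) a c(1-3) L fg(5) by (metis p(1-3) a c(1-3) L fg(5))
    also have "Tpair C ?R ?f ?g \<cdot> ?c \<cdot> ?a = Tpair C ?R (?f \<cdot> ?c \<cdot> ?a) (?g \<cdot> ?c \<cdot> ?a)"
      by (rule p(6)) (use a c(1-3) fg(5) in simp_all)
    also have "?f \<cdot> ?c \<cdot> ?a = ?k \<cdot> \<langle>Tproj C ?R \<cdot> s, e \<cdot> bang C ?Z\<rangle>"
      unfolding c(4) using e assms by simp
    also have "?g \<cdot> ?c \<cdot> ?a = ?k \<cdot> \<langle>Reta C \<cdot> s, e \<cdot> bang C ?Z\<rangle>"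
      unfolding c(4) using e assms by simp
    finally show ?thesis .
  qed
  also have "\<dots> = Tlift2 C ?R \<cdot> Tpair C ?R (Rfibre_map \<cdot> Tproj C ?R \<cdot> s) (Rfibre_map \<cdot> Reta C \<cdot> s)"
    using k[of "Tproj C ?R \<cdot> s"] k[of "Reta C \<cdot> s"] assms by simp
  also have "\<dots> = Tflip C ?R \<cdot> Tsum C (TO C ?R)
      (TA C (Tzero C ?R) \<cdot> Rfibre_map \<cdot> Tproj C ?R \<cdot> s) (Tlift C ?R \<cdot> Rfibre_map \<cdot> Reta C \<cdot> s)"
    by (rule Tlift2_Tpair) (use assms in simp_all)
  finally show ?thesis .
qed

text \<open>At a vector \<open>j x\<close> the formula for \<open>TA C Rfibre_map\<close> has no
  \<open>T0\<close> contribution and reduces to the lift, and \<open>Reta\<close> and its tangent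
  morphism retract \<open>Rfibre_map\<close> and its tangent morphism. A general vector splits by
  \<open>Tadd_decomposition\<close>; its zero vector contributes nothing.\<close>

lemma Reta2_Tlift:
  assumes "t \<in> Ar C" "Cod C t = TO C (RO C)"
  shows "Reta2 (Tlift C (RO C) \<cdot> t) = Reta C \<cdot> t"
proof -
  let ?R = "RO C"
  have j: "Reta2 (Tlift C ?R \<cdot> Rfibre_map \<cdot> x) = x" if x: "x \<in> Ar C" "Cod C x = ?R" for x
  proof -
    have "TA C Rfibre_map \<cdot> Rfibre_map \<cdot> x = Tlift C ?R \<cdot> Rfibre_map \<cdot> x"
      using TA_Rfibre_map[of "Rfibre_map \<cdot> x"] x
        Tsum_Tzero(2)[of "TO C ?R" "Tlift C ?R \<cdot> Rfibre_map \<cdot> x" "Tzero C ?R \<cdot> Rzero C \<cdot> bang C (Dom C x)"]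
      by simp
    from this[symmetric] show ?thesis using x by simp
  qed
  define u where "u = Tprd ?R ?R (Tzero C ?R \<cdot> Tproj C ?R \<cdot> t) (Rfibre_map \<cdot> Reta C \<cdot> t)"
  have u: "u \<in> Ar C" "Dom C u = Dom C t" "Cod C u = TO C (Prd C ?R ?R)"
    "TA C (pr1 C ?R ?R) \<cdot> u = Tzero C ?R \<cdot> Tproj C ?R \<cdot> t"
    "TA C (pr2 C ?R ?R) \<cdot> u = Rfibre_map \<cdot> Reta C \<cdot> t"
    using assms by (simp_all add: u_def)
  have t: "TA C (Rplus C) \<cdot> u = t"
    using Tadd_decomposition[of t "Dom C t"] assms by (simp add: Tadd_def u_def)
  have "Reta2 (TA C (TA C (Rplus C)) \<cdot> Tlift C (Prd C ?R ?R) \<cdot> u) =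
      Radd (Reta2 (Tlift C ?R \<cdot> Tzero C ?R \<cdot> Tproj C ?R \<cdot> t)) (Reta2 (Tlift C ?R \<cdot> Rfibre_map \<cdot> Reta C \<cdot> t))"
    using Reta2_TA_Rplus[of "Tlift C (Prd C ?R ?R) \<cdot> u"] u by simp
  also have "\<dots> = Radd (Rzero C \<cdot> bang C (Dom C t)) (Reta C \<cdot> t)"
    using j[of "Reta C \<cdot> t"] assms by simp
  also have "\<dots> = Reta C \<cdot> t"
    using R_laws(4)[of "Rzero C \<cdot> bang C (Dom C t)" "Dom C t" "Reta C \<cdot> t" "Reta C \<cdot> t"]
      R_laws(6)[of "Reta C \<cdot> t" "Dom C t" "Reta C \<cdot> t" "Reta C \<cdot> t"] assms by simp
  finally show ?thesis using u t by simp
qed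

text \<open>Flip invariance on the image of \<open>TA C Rfibre_map\<close>, where the value without
  the flip is \<open>Reta C \<cdot> s\<close> as well. The flip cancels the one in
  \<open>TA_Rfibre_map\<close>; the tangent morphism of \<open>Reta\<close> annihilates the
  \<open>T0\<close> part and \<open>Reta2_Tlift\<close> evaluates the rest.\<close>

lemma Reta2_Tflip_TA_Rfibre_map:
  assumes "s \<in> Ar C" "Cod C s = TO C (RO C)"
  shows "Reta2 (Tflip C (RO C) \<cdot> TA C Rfibre_map \<cdot> s) = Reta C \<cdot> s"
proof -
  let ?a = "TA C (Tzero C (RO C)) \<cdot> Rfibre_map \<cdot> Tproj C (RO C) \<cdot> s"
  let ?b = "Tlift C (RO C) \<cdot> Rfibre_map \<cdot> Reta C \<cdot> s"
  have ab: "?a \<in> Ar C" "?b \<in> Ar C" "Cod C ?a = TO C (TO C (RO C))" "Cod C ?b = TO C (TO C (RO C))"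
    "Tproj C (TO C (RO C)) \<cdot> ?a = Tproj C (TO C (RO C)) \<cdot> ?b"
    using assms by simp_all
  have "Tflip C (RO C) \<cdot> TA C Rfibre_map \<cdot> s = Tsum C (TO C (RO C)) ?a ?b"
    unfolding TA_Rfibre_map[OF assms]
    by (rule Tflip_Tflip_simp) (use Tsum_simps(1,3)[OF _ ab] in simp_all)
  then have "Reta2 (Tflip C (RO C) \<cdot> TA C Rfibre_map \<cdot> s) = Radd (Reta2 ?a) (Reta2 ?b)"
    using Reta2_Tsum[OF ab] by simp
  also have "\<dots> = Radd (Rzero C \<cdot> bang C (Dom C s)) (Reta C \<cdot> s)"
    using Reta2_Tlift[of "Rfibre_map \<cdot> Reta C \<cdot> s"] assms by simp
  also have "\<dots> = Reta C \<cdot> s"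
    using R_laws(4)[of "Rzero C \<cdot> bang C (Dom C s)" "Dom C s" "Reta C \<cdot> s" "Reta C \<cdot> s"]
      R_laws(6)[of "Reta C \<cdot> s" "Dom C s" "Reta C \<cdot> s" "Reta C \<cdot> s"] assms by simp
  finally show ?thesis .
qed

text \<open>The tangent morphism of the splitting of vectors writes \<open>z\<close> as a sum of a
  \<open>T0\<close> part and an element in the image of \<open>TA C Rfibre_map\<close>. The first
  contributes zero in either case, since the flip turns it into a zero vector; the second is the
  preceding lemma.\<close>

lemma Reta2_Tflip:
  assumes "z \<in> Ar C" "Cod C z = TO C (TO C (RO C))"
  shows "Reta2 (Tflip C (RO C) \<cdot> z) = Reta2 z"
proof -
  let ?R = "RO C"
  \<comment> \<open>The splitting of \<open>Tadd_decomposition\<close> as one arrow, right inverse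
    to \<open>TA C (Rplus C)\<close>; being an arrow, it can be differentiated.\<close>
  let ?d = "Tprd ?R ?R (Tzero C ?R \<cdot> Tproj C ?R) (Rfibre_map \<cdot> Reta C)"
  define w where "w = TA C ?d \<cdot> z"
  have d: "?d \<in> Ar C" "Dom C ?d = TO C ?R" "Cod C ?d = TO C (Prd C ?R ?R)"
    "TA C (pr1 C ?R ?R) \<cdot> ?d = Tzero C ?R \<cdot> Tproj C ?R"
    "TA C (pr2 C ?R ?R) \<cdot> ?d = Rfibre_map \<cdot> Reta C"
    "TA C (Rplus C) \<cdot> ?d = ide C (TO C ?R)"
    using Tadd_decomposition[of "ide C (TO C ?R)" "TO C ?R"] by (simp_all add: Tadd_def)
  have w: "w \<in> Ar C" "Dom C w = Dom C z" "Cod C w = TO C (TO C (Prd C ?R ?R))"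
    unfolding w_def using d(1-3) assms by simp_all
  have TAd: "TA C g \<cdot> w = TA C (g \<cdot> ?d) \<cdot> z" if "g \<in> Ar C" "Dom C g = TO C (Prd C ?R ?R)" for g
    unfolding w_def using TA_Comp_simp[of ?d g] d(1-3) assms that
      Comp_Comp[of z "TA C ?d" "TA C g"] by simp
  have p: "TA C (TA C (pr1 C ?R ?R)) \<cdot> w = TA C (Tzero C ?R) \<cdot> TA C (Tproj C ?R) \<cdot> z"
    "TA C (TA C (pr2 C ?R ?R)) \<cdot> w = TA C Rfibre_map \<cdot> TA C (Reta C) \<cdot> z"
    "TA C (TA C (Rplus C)) \<cdot> w = z"
    using TAd[of "TA C (pr1 C ?R ?R)"] TAd[of "TA C (pr2 C ?R ?R)"] TAd[of "TA C (Rplus C)"] d(4-6) assms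
    by simp_all
  have "Reta2 (Tflip C ?R \<cdot> z) = Reta2 (TA C (TA C (Rplus C)) \<cdot> Tflip C (Prd C ?R ?R) \<cdot> w)"
    using p(3) w by simp
  also have "\<dots> = Radd (Reta2 (TA C (TA C (pr1 C ?R ?R)) \<cdot> Tflip C (Prd C ?R ?R) \<cdot> w))
      (Reta2 (TA C (TA C (pr2 C ?R ?R)) \<cdot> Tflip C (Prd C ?R ?R) \<cdot> w))"
    by (rule Reta2_TA_Rplus) (use w in simp_all)
  also have "\<dots> = Radd (Rzero C \<cdot> bang C (Dom C z)) (Reta2 z)"
    using p(1,2) w Reta2_Tflip_TA_Rfibre_map[of "TA C (Reta C) \<cdot> z"] assms by simp
  also have "\<dots> = Radd (Reta2 (TA C (TA C (pr1 C ?R ?R)) \<cdot> w)) (Reta2 (TA C (TA C (pr2 C ?R ?R)) \<cdot> w))"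
    unfolding p using assms by simp
  also have "\<dots> = Reta2 z"
    using Reta2_TA_Rplus[OF w(1,3)] p(3) by simp
  finally show ?thesis .
qed

text \<open>Since \<open>j(r s)\<close> is \<open>j(s)\<close> scaled by \<open>r\<close>, the
  derivative with \<open>r\<close> held fixed is given by \<open>kappa_Tpartial2\<close>. Of the two
  flips in that formula, the outer one is removed by \<open>Reta2_Tflip\<close> and the inner one by
  \<open>Reta2_Tflip_TA_Rfibre_map\<close>.\<close>

lemma Reta_TA_Rmult_Tzero:
  assumes "r \<in> Hom C Z (RO C)" "t \<in> Hom C Z (TO C (RO C))"
  shows "Reta C \<cdot> TA C (Rmult C) \<cdot> Tprd (RO C) (RO C) (Tzero C (RO C) \<cdot> r) t = Rmul r (Reta C \<cdot> t)"
proof -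
  let ?R = "RO C"
  let ?k = "kappa C ?R" and ?u = "Tprd ?R ?R (Tzero C ?R \<cdot> r) t"
  have "Rfibre_map \<cdot> Rmult C = ?k \<cdot> \<langle>pr1 C ?R ?R, Rfibre_map \<cdot> pr2 C ?R ?R\<rangle>"
    using Rfibre_map_linear(2)[of "pr1 C ?R ?R" "Prd C ?R ?R" "pr2 C ?R ?R"]
      pair_pr[of ?R ?R "ide C (Prd C ?R ?R)"] by simp
  then have "TA C (Rfibre_map \<cdot> Rmult C) \<cdot> ?u =
      TA C (?k \<cdot> \<langle>pr1 C ?R ?R, Rfibre_map \<cdot> pr2 C ?R ?R\<rangle>) \<cdot> ?u"
    by simp
  then have "TA C Rfibre_map \<cdot> TA C (Rmult C) \<cdot> ?u =
      TA C ?k \<cdot> Tprd ?R (TO C ?R) (Tzero C ?R \<cdot> r) (TA C Rfibre_map \<cdot> t)"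
    using assms by simp
  also have "\<dots> = Tpartial2 C ?R (TO C ?R) ?k \<cdot> \<langle>r, TA C Rfibre_map \<cdot> t\<rangle>"
    by (rule Tpartial_pair(2)[symmetric]) (use assms in simp_all)
  also have "\<dots> = Tflip C ?R \<cdot> kappa C (TO C ?R) \<cdot> \<langle>r, Tflip C ?R \<cdot> TA C Rfibre_map \<cdot> t\<rangle>"
    unfolding kappa_Tpartial2[OF R_simps(1)] using assms by simp
  finally have e: "TA C Rfibre_map \<cdot> TA C (Rmult C) \<cdot> ?u =
      Tflip C ?R \<cdot> kappa C (TO C ?R) \<cdot> \<langle>r, Tflip C ?R \<cdot> TA C Rfibre_map \<cdot> t\<rangle>" .
  \<comment> \<open>The identity is inserted as the tangent morphism of \<open>Reta\<close> after
    that of \<open>Rfibre_map\<close>, which makes a second-order derivative out of a first-order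
    one.\<close>
  have "Reta C \<cdot> TA C (Rmult C) \<cdot> ?u = Reta2 (TA C Rfibre_map \<cdot> TA C (Rmult C) \<cdot> ?u)"
    using assms by simp
  also have "\<dots> = Reta2 (kappa C (TO C ?R) \<cdot> \<langle>r, Tflip C ?R \<cdot> TA C Rfibre_map \<cdot> t\<rangle>)"
    unfolding e by (rule Reta2_Tflip) (use assms in simp_all)
  also have "\<dots> = Rmul r (Reta2 (Tflip C ?R \<cdot> TA C Rfibre_map \<cdot> t))"
    using assms by simp
  also have "\<dots> = Rmul r (Reta C \<cdot> t)"
    using Reta2_Tflip_TA_Rfibre_map[of t] assms by simp
  finally show ?thesis .
qed

text \<open>Adding zero vectors, \<open>s\<close> on the right and \<open>t\<close> on the left, the
  interchange law splits the derivative into two partial ones; symmetry of the multiplication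
  reduces both to the preceding lemma.\<close>

lemma Reta_TA_Rmult:
  assumes "s \<in> Hom C Z (TO C (RO C))" "t \<in> Hom C Z (TO C (RO C))"
  shows "Reta C \<cdot> TA C (Rmult C) \<cdot> Tprd (RO C) (RO C) s t =
    Radd (Rmul (Reta C \<cdot> s) (Tproj C (RO C) \<cdot> t)) (Rmul (Tproj C (RO C) \<cdot> s) (Reta C \<cdot> t))"
proof -
  let ?R = "RO C" and ?m = "TA C (Rmult C)"
  let ?zs = "Tzero C ?R \<cdot> Tproj C ?R \<cdot> s" and ?zt = "Tzero C ?R \<cdot> Tproj C ?R \<cdot> t"
  have h: "?zs \<in> Hom C Z (TO C ?R)" "?zt \<in> Hom C Z (TO C ?R)" using assms by simp_all
  have st: "Tsum C ?R s ?zs = s" "Tsum C ?R ?zt t = t"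
    by (rule Tsum_Tzero; use assms in simp)+
  have "?m \<cdot> Tprd ?R ?R (Tsum C ?R s ?zs) (Tsum C ?R ?zt t) =
      Tsum C ?R (?m \<cdot> Tprd ?R ?R s ?zt) (?m \<cdot> Tprd ?R ?R ?zs t)"
    by (rule TA_Tprd_Tsum) (use assms in simp_all)
  then have "Reta C \<cdot> ?m \<cdot> Tprd ?R ?R s t =
      Radd (Reta C \<cdot> ?m \<cdot> Tprd ?R ?R s ?zt) (Reta C \<cdot> ?m \<cdot> Tprd ?R ?R ?zs t)"
    unfolding st using assms by simp
  also have "?m \<cdot> Tprd ?R ?R s ?zt = ?m \<cdot> Tprd ?R ?R ?zt s"
    by (rule TA_Tprd_swap[OF assms(1) h(2) _ Rmult_comm]) simp
  also have "Reta C \<cdot> ?m \<cdot> Tprd ?R ?R ?zt s = Rmul (Tproj C ?R \<cdot> t) (Reta C \<cdot> s)"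
    by (rule Reta_TA_Rmult_Tzero[of _ Z]) (use assms in simp_all)
  also have "\<dots> = Rmul (Reta C \<cdot> s) (Tproj C ?R \<cdot> t)"
    by (rule R_laws(5)[of _ Z _ "Reta C \<cdot> s"]) (use assms in simp_all)
  also have "Reta C \<cdot> ?m \<cdot> Tprd ?R ?R ?zs t = Rmul (Tproj C ?R \<cdot> s) (Reta C \<cdot> t)"
    by (rule Reta_TA_Rmult_Tzero[of _ Z]) (use assms in simp_all)
  finally show ?thesis .
qed

section \<open>Vector fields as derivations of the ring of functions\<close>

lemma vf_act_simps:
  assumes "v \<in> vector_fields C X" "f \<in> Hom C X (RO C)"
  shows "vf_act C v f \<in> Hom C X (RO C)"
  using assms by (simp add: vf_act_def vector_fields_iff)

lemma vf_act_derivation: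
  assumes "v \<in> vector_fields C X"
  shows "is_derivation (function_ring C X) (vf_act C v)"
  unfolding is_derivation_def
proof (intro conjI ballI)
  note v = assms[unfolded vector_fields_iff Hom_iff]
  show "vf_act C v \<in> carrier (function_ring C X) \<rightarrow> carrier (function_ring C X)"
    using vf_act_simps[OF assms] by (auto simp del: Hom_iff)
  fix f g assume "f \<in> carrier (function_ring C X)" "g \<in> carrier (function_ring C X)"
  then have fg: "f \<in> Hom C X (RO C)" "g \<in> Hom C X (RO C)" by (simp_all del: Hom_iff)
  have h: "TA C f \<cdot> v \<in> Hom C X (TO C (RO C))" "TA C g \<cdot> v \<in> Hom C X (TO C (RO C))"
    using v fg by simp_all
  have p: "Tproj C (RO C) \<cdot> TA C f \<cdot> v = f" "Tproj C (RO C) \<cdot> TA C g \<cdot> v = g"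
    using v fg by simp_all
  show "vf_act C v (f \<oplus>\<^bsub>function_ring C X\<^esub> g) =
      vf_act C v f \<oplus>\<^bsub>function_ring C X\<^esub> vf_act C v g"
    using Reta_Tadd[OF h] v fg by (simp add: vf_act_def Tadd_def)
  show "vf_act C v (f \<otimes>\<^bsub>function_ring C X\<^esub> g) =
      vf_act C v f \<otimes>\<^bsub>function_ring C X\<^esub> g \<oplus>\<^bsub>function_ring C X\<^esub> f \<otimes>\<^bsub>function_ring C X\<^esub> vf_act C v g"
    using Reta_TA_Rmult[OF h] p v fg by (simp add: vf_act_def)
qed

lemma vf_act_Tsum:
  assumes "v \<in> vector_fields C X" "w \<in> vector_fields C X" "f \<in> Hom C X (RO C)"
  shows "vf_act C (Tsum C X v w) f = Radd (vf_act C v f) (vf_act C w f)"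
  using assms by (simp add: vf_act_def vector_fields_iff)

text \<open>The second tangent morphism of \<open>f\<close> carries the sum equation of
  \<open>vf_bracket\<close> from \<open>X\<close> to \<open>R\<close>; naturality moves flips and
  lifts along, so the rules for \<open>Reta2\<close> apply to each term. Writing the claim as a sum
  postpones subtraction to the function ring.\<close>

lemma vf_act_bracket:
  assumes "v \<in> vector_fields C X" "w \<in> vector_fields C X" "f \<in> Hom C X (RO C)"
  shows "Radd (vf_act C (vf_bracket C X v w) f) (vf_act C w (vf_act C v f)) =
    vf_act C v (vf_act C w f)"
proof -
  let ?T = "TO C (RO C)" and ?u = "vf_bracket C X v w" and ?f = "TA C f" and ?F = "TA C (TA C f)"
  have X: "X \<in> Ob C" using assms(3) by auto
  note b = vf_bracket[OF X assms(1,2)]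
  note v = assms(1)[unfolded vector_fields_iff Hom_iff] and w = assms(2)[unfolded vector_fields_iff Hom_iff]
    and u = b(1)[unfolded vector_fields_iff Hom_iff] and f = assms(3)[unfolded Hom_iff]
  define s where "s = Tsum C (TO C X) (TA C (Tzero C X) \<cdot> w) (Tlift C X \<cdot> ?u)"
  have s: "s \<in> Ar C" "Dom C s = X" "Cod C s = TO C (TO C X)" "TA C (Tproj C X) \<cdot> s = w"
    using X u v w Tsum_Tzero(1)[of X w "ide C X"] by (simp_all add: s_def)
  have TTv: "TA C (Tproj C X) \<cdot> TA C v \<cdot> w = w"
    using Comp_eq_right[of "TA C (Tproj C X)" "TA C v" "ide C (TO C X)" w] v w X
    by (simp flip: TA_Comp_simp)
  let ?a = "Tflip C (RO C) \<cdot> ?F \<cdot> s" and ?b = "Tflip C (RO C) \<cdot> ?F \<cdot> TA C v \<cdot> w"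
  have ab: "?a \<in> Ar C" "?b \<in> Ar C" "Cod C ?a = TO C ?T" "Cod C ?b = TO C ?T"
    using s f v w by simp_all
  have "?F \<cdot> Tsum C (TO C X) (Tflip C X \<cdot> s) (Tflip C X \<cdot> TA C v \<cdot> w) = ?F \<cdot> TA C w \<cdot> v"
    using b(2) by (simp add: s_def)
  then have sum: "Tsum C ?T ?a ?b = ?F \<cdot> TA C w \<cdot> v"
    using s TTv v w f X by simp
  \<comment> \<open>Needed to see that the two flipped summands have the same base point, so that
    additivity of \<open>Reta2\<close> applies.\<close>
  have Tpf: "TA C (Tproj C (RO C)) \<cdot> ?F \<cdot> z = ?f \<cdot> TA C (Tproj C X) \<cdot> z"
    if "z \<in> Ar C" "Cod C z = TO C (TO C X)" for z
  proof (rule Comp_cong_right)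
    show "TA C (Tproj C (RO C)) \<cdot> ?F = ?f \<cdot> TA C (Tproj C X)"
      using f X by (simp flip: TA_Comp_simp)
  qed (use f X that in simp_all)
  have "Tproj C ?T \<cdot> ?a = Tproj C ?T \<cdot> ?b"
    using Tpf[of s] Tpf[of "TA C v \<cdot> w"] s TTv v w f by simp
  from Reta2_Tsum[OF ab this]
  have "Reta2 (?F \<cdot> TA C w \<cdot> v) = Radd (Reta2 ?a) (Reta2 ?b)" unfolding sum .
  also have "Reta2 ?b = Reta2 (?F \<cdot> TA C v \<cdot> w)"
    by (rule Reta2_Tflip) (use f v w in simp_all)
  also have "Reta2 ?a = Reta2 (?F \<cdot> s)"
    by (rule Reta2_Tflip) (use f s in simp_all)
  \<comment> \<open>The \<open>T0\<close> part of \<open>s\<close> is annihilated, and the lifted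
    part loses one order of differentiation by \<open>Reta2_Tlift\<close>.\<close>
  also have "Reta2 (?F \<cdot> s) = Reta C \<cdot> ?f \<cdot> ?u"
  proof -
    have "?F \<cdot> TA C (Tzero C X) \<cdot> w = TA C (Tzero C (RO C)) \<cdot> ?f \<cdot> w"
    proof (rule Comp_cong_right)
      show "?F \<cdot> TA C (Tzero C X) = TA C (Tzero C (RO C)) \<cdot> ?f"
        using f X by (simp flip: TA_Comp_simp)
    qed (use f X w in simp_all)
    then have "Reta2 (?F \<cdot> s) = Radd (Rzero C \<cdot> bang C X) (Reta2 (Tlift C (RO C) \<cdot> ?f \<cdot> ?u))"
      using X f u w by (simp add: s_def)
    also have "Reta2 (Tlift C (RO C) \<cdot> ?f \<cdot> ?u) = Reta C \<cdot> ?f \<cdot> ?u"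
      by (rule Reta2_Tlift) (use f u in simp_all)
    also have "Radd (Rzero C \<cdot> bang C X) (Reta C \<cdot> ?f \<cdot> ?u) = Reta C \<cdot> ?f \<cdot> ?u"
      using R_laws(4)[of "Rzero C \<cdot> bang C X" X "Reta C \<cdot> ?f \<cdot> ?u" "Reta C \<cdot> ?f \<cdot> ?u"]
        R_laws(6)[of "Reta C \<cdot> ?f \<cdot> ?u" X "Reta C \<cdot> ?f \<cdot> ?u" "Reta C \<cdot> ?f \<cdot> ?u"] X f u by simp
    finally show ?thesis .
  qed
  finally show ?thesis using f v w u by (simp add: vf_act_def)
qed

end

section \<open>The Lie--Rinehart algebra of sections\<close>

theorem proposition6p4:
  fixes C :: "('o, 'm, 'x) scalar_tangent_category_scheme"
    and A :: "('o, 'm, 'y) algebroid_scheme"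
  assumes "scalar_tangent_category C"
    and "abstract_lie_algebroid C A"
  shows "lie_rinehart_algebra (function_ring C (base A)) (section_module C A)
           (bracket A) (algebroid_act C A)"
proof -
  interpret scalar_tangent_category C by (rule assms(1))
  interpret L: abstract_lie_algebroid C A by (rule assms(2))
  interpret S: slice_module C A "bsmult A" ..
  let ?X = "base A" and ?F = "function_ring C (base A)" and ?M = "section_module C A"
  interpret F: cring ?F by (rule cring_function_ring) simp
  \<comment> \<open>Sections are the elements over the identity of the base, so the module axioms
    are instances of the laws for generalized elements.\<close>
  have sec: "sections C A = S.over (ide C ?X)"
    by (auto simp: sections_def S.over_def)
  have M: "carrier ?M = S.over (ide C ?X)" "add ?M = bsum C A" "zero ?M = bzero A"
    "\<And>f a. f \<odot>\<^bsub>?M\<^esub> a = bsmult A \<cdot>\<^bsub>C\<^esub> \<langle>f, a\<rangle>\<^bsub>C\<^esub>"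
    by (simp_all add: section_module_def sec)
  have secD: "a \<in> Hom C ?X (tot A)" if "a \<in> S.over (ide C ?X)" for a
    using S.overD(1-3)[OF that] by simp
  have mod: "module ?F ?M"
  proof (rule moduleI)
    show "cring ?F" ..
    show "abelian_group ?M"
      by (rule S.abelian_group_over[of "ide C ?X"]) (simp_all add: M)
  next
    fix f a assume f: "f \<in> carrier ?F" and a: "a \<in> carrier ?M"
    then show "f \<odot>\<^bsub>?M\<^esub> a \<in> carrier ?M"
      unfolding M by (intro S.smult_over_mem) simp_all
  next
    fix f g a assume "f \<in> carrier ?F" "g \<in> carrier ?F" and a: "a \<in> carrier ?M"
    then have fg: "f \<in> Hom C ?X (RO C)" "g \<in> Hom C ?X (RO C)" by (simp_all del: Hom_iff)
    note a = secD[OF a[unfolded M]]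
    show "(f \<oplus>\<^bsub>?F\<^esub> g) \<odot>\<^bsub>?M\<^esub> a = f \<odot>\<^bsub>?M\<^esub> a \<oplus>\<^bsub>?M\<^esub> g \<odot>\<^bsub>?M\<^esub> a"
      unfolding M function_ring_simps by (rule S.smult_add_left[OF fg a])
    show "(f \<otimes>\<^bsub>?F\<^esub> g) \<odot>\<^bsub>?M\<^esub> a = f \<odot>\<^bsub>?M\<^esub> (g \<odot>\<^bsub>?M\<^esub> a)"
      unfolding M function_ring_simps by (rule S.smult_mult_one(1)[OF fg a, symmetric])
  next
    fix f a b assume f: "f \<in> carrier ?F" and ab: "a \<in> carrier ?M" "b \<in> carrier ?M"
    show "f \<odot>\<^bsub>?M\<^esub> (a \<oplus>\<^bsub>?M\<^esub> b) = f \<odot>\<^bsub>?M\<^esub> a \<oplus>\<^bsub>?M\<^esub> f \<odot>\<^bsub>?M\<^esub> b"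
      unfolding M by (rule S.smult_add_right[OF _ ab[unfolded M]]) (use f in simp)
  next
    fix a assume "a \<in> carrier ?M"
    then have a: "a \<in> Hom C ?X (tot A)" unfolding M by (rule secD)
    have o: "Rone C \<cdot>\<^bsub>C\<^esub> bang C ?X \<in> Hom C ?X (RO C)" by simp
    show "\<one>\<^bsub>?F\<^esub> \<odot>\<^bsub>?M\<^esub> a = a"
      unfolding M function_ring_simps by (rule S.smult_mult_one(2)[OF o o a])
  qed
  interpret M: module ?F ?M by (rule mod)
  have rho: "anchor A \<in> Ar C" "Dom C (anchor A) = tot A" "Cod C (anchor A) = TO C ?X"
    using L.anchor_closed by simp_all
  have vf: "anchor A \<cdot>\<^bsub>C\<^esub> a \<in> vector_fields C ?X" if a: "a \<in> carrier ?M" for a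
  proof -
    note a = S.overD[OF a[unfolded M]]
    have "Tproj C ?X \<cdot>\<^bsub>C\<^esub> anchor A \<cdot>\<^bsub>C\<^esub> a = bproj A \<cdot>\<^bsub>C\<^esub> a"
      by (rule Comp_eq_right[OF L.anchor_over]) (use a rho in simp_all)
    then show ?thesis using a rho by (simp add: vector_fields_iff)
  qed
  have act: "algebroid_act C A a f = vf_act C (anchor A \<cdot>\<^bsub>C\<^esub> a) f" for a f
    by (simp add: algebroid_act_def)
  have anchor_sum: "anchor A \<cdot>\<^bsub>C\<^esub> bsum C A a b = Tsum C ?X (anchor A \<cdot>\<^bsub>C\<^esub> a) (anchor A \<cdot>\<^bsub>C\<^esub> b)"
    if a: "a \<in> carrier ?M" and b: "b \<in> carrier ?M" for a b
  proof -
    note p = S.bpair_simps[OF a[unfolded M] b[unfolded M]]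
    \<comment> \<open>The anchor lies over the base, so it sends the universal pair to two vectors
      at the same point; this is what allows the sum to be evaluated on
      \<open>bpair C A a b\<close>.\<close>
    have e: "Tproj C ?X \<cdot>\<^bsub>C\<^esub> anchor A \<cdot>\<^bsub>C\<^esub> bpr A 0 = Tproj C ?X \<cdot>\<^bsub>C\<^esub> anchor A \<cdot>\<^bsub>C\<^esub> bpr A 1"
    proof -
      have "Tproj C ?X \<cdot>\<^bsub>C\<^esub> anchor A \<cdot>\<^bsub>C\<^esub> bpr A i = bproj A \<cdot>\<^bsub>C\<^esub> bpr A i" if "i < 2" for i
        by (rule Comp_eq_right[OF L.anchor_over]) (use rho that in simp_all)
      from this[of 0] this[of 1] show ?thesis using S.bproj_bpr by simp
    qed
    have "anchor A \<cdot>\<^bsub>C\<^esub> badd A \<cdot>\<^bsub>C\<^esub> bpair C A a b =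
        Tsum C ?X (anchor A \<cdot>\<^bsub>C\<^esub> bpr A 0) (anchor A \<cdot>\<^bsub>C\<^esub> bpr A 1) \<cdot>\<^bsub>C\<^esub> bpair C A a b"
      by (rule Comp_eq_right[OF L.anchor_badd]) (use p rho in simp_all)
    also have "\<dots> = Tsum C ?X ((anchor A \<cdot>\<^bsub>C\<^esub> bpr A 0) \<cdot>\<^bsub>C\<^esub> bpair C A a b) ((anchor A \<cdot>\<^bsub>C\<^esub> bpr A 1) \<cdot>\<^bsub>C\<^esub> bpair C A a b)"
      by (rule Tsum_simps(5)) (use e p rho in simp_all)
    also have "\<dots> = Tsum C ?X (anchor A \<cdot>\<^bsub>C\<^esub> a) (anchor A \<cdot>\<^bsub>C\<^esub> b)"
      using p rho by simp
    finally show ?thesis by (simp add: bsum_def)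
  qed
  show ?thesis
  proof (intro lie_rinehart_algebra.intro lie_rinehart_algebra_axioms.intro)
    show "module ?F ?M" by (rule mod)
    show "is_lie_bracket ?M (bracket A)" by (rule L.bracket_lie)
    fix a assume a: "a \<in> carrier ?M"
    show "is_derivation ?F (algebroid_act C A a)"
      using vf_act_derivation[OF vf[OF a]] unfolding act[abs_def] .
    fix b f assume b: "b \<in> carrier ?M" and f: "f \<in> carrier ?F"
    have f': "f \<in> Hom C ?X (RO C)" using f by (simp del: Hom_iff)
    show "algebroid_act C A (a \<oplus>\<^bsub>?M\<^esub> b) f = algebroid_act C A a f \<oplus>\<^bsub>?F\<^esub> algebroid_act C A b f"
      unfolding act M anchor_sum[OF a b] function_ring_simps by (rule vf_act_Tsum[OF vf[OF a] vf[OF b] f'])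
    have mem: "algebroid_act C A c g \<in> carrier ?F" if "c \<in> carrier ?M" "g \<in> carrier ?F" for c g
      unfolding act function_ring_simps
      by (rule vf_act_simps[OF vf[OF that(1)]]) (use that(2) in simp)
    have br: "bracket A a b \<in> carrier ?M"
      using L.bracket_lie a b unfolding is_lie_bracket_def by blast
    have "algebroid_act C A (bracket A a b) f \<oplus>\<^bsub>?F\<^esub> algebroid_act C A b (algebroid_act C A a f) =
        algebroid_act C A a (algebroid_act C A b f)"
      using vf_act_bracket[OF vf[OF a] vf[OF b] f'] L.anchor_bracket[of a b] a b
      unfolding act M sec function_ring_simps by simp
    \<comment> \<open>The sum form is solved for its first summand in the additive group of
      functions.\<close>
    then show "algebroid_act C A (bracket A a b) f =
        algebroid_act C A a (algebroid_act C A b f) \<ominus>\<^bsub>?F\<^esub> algebroid_act C A b (algebroid_act C A a f)"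
      using mem[OF br f] mem[OF b mem[OF a f]]
      by (metis F.add.inv_solve_right F.minus_eq F.add.m_closed)
    have ab: "a \<in> sections C A" "b \<in> sections C A" using a b unfolding M sec .
    \<comment> \<open>The Leibniz axiom of the algebroid has the same two summands in the opposite
      order.\<close>
    show "bracket A a (f \<odot>\<^bsub>?M\<^esub> b) = algebroid_act C A a f \<odot>\<^bsub>?M\<^esub> b \<oplus>\<^bsub>?M\<^esub> f \<odot>\<^bsub>?M\<^esub> bracket A a b"
      using L.bracket_leibniz[OF ab f'] M.M.a_comm[OF M.smult_closed[OF f br] M.smult_closed[OF mem[OF a f] b]]
      by simp
  qed
qed

end
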